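(* Let $(X,g,\mu_g)$ be a $2$-parabolic admissible Riemannian polyhedron (with $\partial X=\emptyset$). Let $f\in W^{1,2}_{\mathrm{loc}}(X)$ be a harmonic function such that $\|\nabla f\|_{L^2}$ is finite. Then $f$ is constant.
   Context: Riemannian polyhedra. A polyhedron is a connected locally compact separable Hausdorff space $X$ homeomorphic, via some $\theta:|K|\to X$, to the space $|K|$ of a countable, locally finite simplicial complex $K$ of finite dimension; $(K,\theta)$ is a triangulation. $|K|$ carries the barycentric distance $\rho(\alpha,\beta)=(\sum_v(\alpha(v)-\beta(v))^2)^{1/2}$ and is affinely Lipschitz-homeomorphically embedded as a closed subset of a Euclidean space. $X$ is a Lipschitz polyhedron if it is a metric space and $\theta$ is a Lipschitz homeomorphism. A Riemannian polyhedron is a Lipschitz polyhedron $X$ such that, for some triangulation, each maximal simplex $s$ (viewed in the Euclidean space) carries a measurable Riemannian metric $g^s=g_{ij}dx^idx^j$ with $\Lambda^{-2}\|\xi\|^2\le g_{ij}(x)\xi^i\xi^j\le\Lambda^2\|\xi\|^2$ for a.e. $x\in s$, with $\Lambda$ independent of $s$. $d_X=d_X^g$ is the associated intrinsic distance: $d_X^g(x,y)$ is the supremum, over null sets $Z$, of the infimum of $g$-lengths of Lipschitz paths from $x$ to $y$ meeting $Z$ only on a parameter set of measure zero. The volume measure $\mu_g$ is given simplexwise by $d\mu_g=\sqrt{\det(g_{ij})}\,dx_1\cdots dx_n$. $X^{k}$ denotes the $k$-skeleton. Admissible: in some (hence any) triangulation, all maximal simplexes have the same dimension $n=\dim X$,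 and for every connected open $U\subset X$ the set $U\setminus X^{n-2}$ is connected. $\partial X$ is the union of all non-maximal simplexes contained in only one maximal simplex; it is always assumed that $\partial X=\emptyset$. Sobolev spaces. $W^{1,2}(X)$ is the completion of the space of Lipschitz functions $u:(X,d_X)\to\mathbb R$ with finite norm $\|u\|_{1,2}^2=\int_X(u^2+|\nabla u|^2)\,d\mu_g$, where $\nabla u$ is the Riemannian gradient, defined a.e. on each $n$-simplex. $\mathrm{Lip}_c(X)$: Lipschitz functions with compact support. $W_0^{1,2}(X)$: closure of $\mathrm{Lip}_c(X)$ in $W^{1,2}(X)$ (similarly for domains). $W^{1,2}_{\mathrm{loc}}(X)$: all $u\in L^2_{\mathrm{loc}}(X)$ with $u\in W^{1,2}(U)$ for all relatively compact subdomains $U\subset X$. $\|\nabla f\|_{L^2}=(\int_X|\nabla f|^2\,d\mu_g)^{1/2}$. $f\in W^{1,2}_{\mathrm{loc}}(X)$ is weakly harmonic if $\int_X\langle\nabla f,\nabla\rho\rangle\,d\mu_g=0$ for every $\rho\in\mathrm{Lip}_c(X)$. A harmonic function is a continuous weakly harmonic function. $2$-parabolicity. For $E\subset\Omega$, $\mathrm{cap}(E,\Omega)=\inf\int_\Omega|\nabla u|^2\,d\mu_g$ over $u\in W^{1,2}_0(\Omega)$ with $u\ge1$ on $E$ (equivalently, over such $u$ with $u\le1$ and $u=1$ on a neighborhood of $E$). A domain (connected open set) $\Omega\subset X$ is $2$-parabolic if $\mathrm{cap}(D,\Omega)=0$ for every compact $D\subset\Omega$; $X$ is $2$-parabolic if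 this holds with $\Omega=X$. *)

theory Defs
  imports "HOL-Analysis.Analysis"
begin

section \<open>Simplicial complexes and their geometric realisation\<close>

definition abstract_complex :: "'v set set \<Rightarrow> bool" where
  "abstract_complex K \<longleftrightarrow>
     (\<forall>s\<in>K. finite s \<and> s \<noteq> {}) \<and>
     (\<forall>s\<in>K. \<forall>t. t \<subseteq> s \<and> t \<noteq> {} \<longrightarrow> t \<in> K)"

definition locally_finite_complex :: "'v set set \<Rightarrow> bool" where
  "locally_finite_complex K \<longleftrightarrow> (\<forall>v. finite {s\<in>K. v \<in> s})"

definition finite_dim_complex :: "'v set set \<Rightarrow> bool" where
  "finite_dim_complex K \<longleftrightarrow> (\<exists>n. \<forall>s\<in>K. card s \<le> n + 1)"

definition maximal_simplexes :: "'v set set \<Rightarrow> 'v set set" where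
  "maximal_simplexes K = {s\<in>K. \<forall>t\<in>K. s \<subseteq> t \<longrightarrow> t = s}"

text \<open>Points of \<open>|K|\<close> are given by their barycentric coordinates.\<close>

definition realisation :: "'v set set \<Rightarrow> ('v \<Rightarrow> real) set" where
  "realisation K =
     {\<alpha>. {v. \<alpha> v \<noteq> 0} \<in> K \<and> (\<forall>v. 0 \<le> \<alpha> v) \<and> (\<Sum>v | \<alpha> v \<noteq> 0. \<alpha> v) = 1}"

definition barycentric_dist :: "('v \<Rightarrow> real) \<Rightarrow> ('v \<Rightarrow> real) \<Rightarrow> real" where
  "barycentric_dist \<alpha> \<beta> = sqrt (\<Sum>v | \<alpha> v \<noteq> 0 \<or> \<beta> v \<noteq> 0. (\<alpha> v - \<beta> v)\<^sup>2)"

definition affine_extension :: "('v \<Rightarrow> 'e::euclidean_space) \<Rightarrow> ('v \<Rightarrow> real) \<Rightarrow> 'e" where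
  "affine_extension p \<alpha> = (\<Sum>v | \<alpha> v \<noteq> 0. \<alpha> v *\<^sub>R p v)"

definition loc_lipschitz ::
    "'a set \<Rightarrow> ('a \<Rightarrow> 'a \<Rightarrow> real) \<Rightarrow> ('b \<Rightarrow> 'b \<Rightarrow> real) \<Rightarrow> ('a \<Rightarrow> 'b) \<Rightarrow> bool" where
  "loc_lipschitz A d d' h \<longleftrightarrow>
     (\<forall>x\<in>A. \<exists>e>0. \<exists>C. \<forall>y\<in>A. \<forall>z\<in>A. d x y < e \<and> d x z < e \<longrightarrow> d' (h y) (h z) \<le> C * d y z)"

text \<open>
  Lipschitz homeomorphisms are bi-Lipschitz locally (hence on compact sets), not uniformly: the
  barycentric distance is bounded by \<open>sqrt 2\<close>, so an infinite \<open>|K|\<close> is not globally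
  bi-Lipschitz equivalent to any closed subset of a Euclidean space.
\<close>

definition lipschitz_homeo ::
    "'a set \<Rightarrow> ('a \<Rightarrow> 'a \<Rightarrow> real) \<Rightarrow> 'b set \<Rightarrow> ('b \<Rightarrow> 'b \<Rightarrow> real) \<Rightarrow> ('a \<Rightarrow> 'b) \<Rightarrow> bool" where
  "lipschitz_homeo A d B d' h \<longleftrightarrow>
     bij_betw h A B \<and> loc_lipschitz A d d' h \<and> loc_lipschitz B d' d (inv_into A h)"


section \<open>Riemannian polyhedra\<close>

text \<open>
  The space \<open>X\<close> is the whole metric space type \<open>'x\<close>.  The field \<open>vertex\<close> gives the affine
  embedding of \<open>|K|\<close> into the Euclidean space \<open>'e\<close>.  The metrics \<open>g\<^sup>s\<close> of the various maximal
  simplexes are collected into one field on \<open>X\<close>, which loses nothing because different maximal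
  simplexes meet in a null set.  At a point in the interior of the maximal simplex \<open>s\<close> only the
  restriction of the form to the tangent space of \<open>s\<close> is used; extending it to a bilinear form
  on \<open>'e\<close> (say by orthogonal projection) merely makes the field total.
\<close>

record ('v, 'e, 'x) polyhedron_data =
  complex :: "'v set set"
  triang :: "('v \<Rightarrow> real) \<Rightarrow> 'x"
  vertex :: "'v \<Rightarrow> 'e"
  metric_form :: "'x \<Rightarrow> 'e \<Rightarrow> 'e \<Rightarrow> real"

abbreviation max_simplexes :: "('v, 'e, 'x) polyhedron_data \<Rightarrow> 'v set set" where
  "max_simplexes P \<equiv> maximal_simplexes (complex P)"

definition bary :: "('v, 'e, 'x) polyhedron_data \<Rightarrow> 'x \<Rightarrow> 'v \<Rightarrow> real" where
  "bary P = inv_into (realisation (complex P)) (triang P)"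

definition carrier_simplex :: "('v, 'e, 'x) polyhedron_data \<Rightarrow> 'x \<Rightarrow> 'v set" where
  "carrier_simplex P x = {v. bary P x v \<noteq> 0}"

definition closed_cell :: "('v, 'e, 'x) polyhedron_data \<Rightarrow> 'v set \<Rightarrow> 'x set" where
  "closed_cell P s = {x. carrier_simplex P x \<subseteq> s}"

definition open_cell :: "('v, 'e, 'x) polyhedron_data \<Rightarrow> 'v set \<Rightarrow> 'x set" where
  "open_cell P s = {x. carrier_simplex P x = s}"

definition skeleton :: "('v, 'e, 'x) polyhedron_data \<Rightarrow> int \<Rightarrow> 'x set" where
  "skeleton P k = (\<Union>s\<in>{s \<in> complex P. int (card s) \<le> k + 1}. closed_cell P s)"

definition boundary :: "('v, 'e, 'x) polyhedron_data \<Rightarrow> 'x set" where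
  "boundary P =
     (\<Union>s\<in>{s \<in> complex P. s \<notin> max_simplexes P \<and> (\<exists>!t. t \<in> max_simplexes P \<and> s \<subseteq> t)}.
        closed_cell P s)"

text \<open>The position of a point of \<open>X\<close> in the Euclidean space, and the inverse of this map.\<close>

definition pos :: "('v, 'e::euclidean_space, 'x) polyhedron_data \<Rightarrow> 'x \<Rightarrow> 'e" where
  "pos P x = affine_extension (vertex P) (bary P x)"

definition pt :: "('v, 'e::euclidean_space, 'x) polyhedron_data \<Rightarrow> 'e \<Rightarrow> 'x" where
  "pt P = inv (pos P)"

definition tangent :: "('v, 'e::euclidean_space, 'x) polyhedron_data \<Rightarrow> 'v set \<Rightarrow> 'e set" where
  "tangent P s = span {vertex P v - vertex P w | v w. v \<in> s \<and> w \<in> s}"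

text \<open>
  Euclidean coordinates on a simplex: an orthonormal basis of its tangent space (none of the
  notions below depends on the choice), and the Lebesgue measure of the dimension of \<open>s\<close> on the
  affine hull of \<open>s\<close>, obtained from the product measure in these coordinates.
\<close>

definition frame :: "('v, 'e::euclidean_space, 'x) polyhedron_data \<Rightarrow> 'v set \<Rightarrow> 'e set" where
  "frame P s = (SOME B. pairwise orthogonal B \<and> (\<forall>b\<in>B. norm b = 1) \<and> span B = tangent P s)"

definition simplex_lebesgue ::
    "('v, 'e::euclidean_space, 'x) polyhedron_data \<Rightarrow> 'v set \<Rightarrow> 'e measure" where
  "simplex_lebesgue P s =
     completion (distr (Pi\<^sub>M (frame P s) (\<lambda>_. lborel)) borel
       (\<lambda>x. vertex P (SOME v. v \<in> s) + (\<Sum>b\<in>frame P s. x b *\<^sub>R b)))"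

definition polyhedron_triangulation ::
    "('v, 'e::euclidean_space, 'x::metric_space) polyhedron_data \<Rightarrow> bool" where
  "polyhedron_triangulation P \<longleftrightarrow>
     abstract_complex (complex P) \<and> countable (complex P) \<and>
     locally_finite_complex (complex P) \<and> finite_dim_complex (complex P) \<and>
     connected (UNIV :: 'x set) \<and> locally compact (UNIV :: 'x set) \<and>
     (\<exists>D :: 'x set. countable D \<and> closure D = UNIV) \<and>
     lipschitz_homeo (realisation (complex P)) barycentric_dist UNIV dist (triang P)"

definition euclidean_embedding ::
    "('v, 'e::euclidean_space, 'x) polyhedron_data \<Rightarrow> bool" where
  "euclidean_embedding P \<longleftrightarrow>
     (let R = realisation (complex P); \<iota> = affine_extension (vertex P)
      in closed (\<iota> ` R) \<and> lipschitz_homeo R barycentric_dist (\<iota> ` R) dist \<iota>)"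

definition riemannian_polyhedron ::
    "('v, 'e::euclidean_space, 'x::metric_space) polyhedron_data \<Rightarrow> bool" where
  "riemannian_polyhedron P \<longleftrightarrow>
     polyhedron_triangulation P \<and> euclidean_embedding P \<and>
     (\<forall>x. bilinear (metric_form P x) \<and> (\<forall>\<xi> \<eta>. metric_form P x \<xi> \<eta> = metric_form P x \<eta> \<xi>)) \<and>
     (\<forall>s\<in>max_simplexes P. \<forall>\<xi>\<in>tangent P s. \<forall>\<eta>\<in>tangent P s.
        (\<lambda>y. metric_form P (pt P y) \<xi> \<eta>)
          \<in> borel_measurable (restrict_space (simplex_lebesgue P s) (pos P ` open_cell P s))) \<and>
     (\<exists>\<Lambda>>0. \<forall>s\<in>max_simplexes P.
        AE y in simplex_lebesgue P s. y \<in> pos P ` open_cell P s \<longrightarrow>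
          (\<forall>\<xi>\<in>tangent P s.
             (norm \<xi>)\<^sup>2 / \<Lambda>\<^sup>2 \<le> metric_form P (pt P y) \<xi> \<xi> \<and>
             metric_form P (pt P y) \<xi> \<xi> \<le> \<Lambda>\<^sup>2 * (norm \<xi>)\<^sup>2))"

definition admissible :: "('v, 'e, 'x::topological_space) polyhedron_data \<Rightarrow> bool" where
  "admissible P \<longleftrightarrow>
     (\<exists>n::nat. (\<forall>s\<in>max_simplexes P. card s = n + 1) \<and>
        (\<forall>U. open U \<and> connected U \<longrightarrow> connected (U - skeleton P (int n - 2))))"


section \<open>Volume and intrinsic distance\<close>

text \<open>Leibniz formula for a matrix whose rows and columns are indexed by a finite set.\<close>

definition det_on :: "'i set \<Rightarrow> ('i \<Rightarrow> 'i \<Rightarrow> real) \<Rightarrow> real" where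
  "det_on I a = (\<Sum>\<pi> | \<pi> permutes I. of_int (sign \<pi>) * (\<Prod>i\<in>I. a i (\<pi> i)))"

definition vol ::
    "('v, 'e::euclidean_space, 'x::metric_space) polyhedron_data \<Rightarrow> 'x measure" where
  "vol P = completion (measure_of UNIV (sets borel) (\<lambda>A.
     \<integral>\<^sup>+s. (\<integral>\<^sup>+y\<in>pos P ` (A \<inter> open_cell P s).
               ennreal (sqrt (det_on (frame P s) (metric_form P (pt P y))))
            \<partial>simplex_lebesgue P s)
     \<partial>count_space (max_simplexes P)))"

definition null_subset ::
    "('v, 'e::euclidean_space, 'x) polyhedron_data \<Rightarrow> 'x set \<Rightarrow> bool" where
  "null_subset P Z \<longleftrightarrow>
     (\<forall>s\<in>max_simplexes P. pos P ` (Z \<inter> closed_cell P s) \<in> null_sets (simplex_lebesgue P s))"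

text \<open>
  The length is meaningful for paths that spend almost all of their time in the interiors of
  maximal simplexes.  Other paths do not influence the intrinsic distance below, because the
  infimum increases with \<open>Z\<close> and \<open>Z\<close> may be taken to contain all non-maximal simplexes.
\<close>

definition path_length ::
    "('v, 'e::euclidean_space, 'x) polyhedron_data \<Rightarrow> (real \<Rightarrow> 'x) \<Rightarrow> ennreal" where
  "path_length P \<gamma> =
     (\<integral>\<^sup>+t\<in>{0..1}.
        (let \<xi> = vector_derivative (\<lambda>r. pos P (\<gamma> r)) (at t within {0..1})
         in ennreal (sqrt (metric_form P (\<gamma> t) \<xi> \<xi>)))
      \<partial>lebesgue)"

definition intrinsic_dist ::
    "('v, 'e::euclidean_space, 'x::metric_space) polyhedron_data \<Rightarrow> 'x \<Rightarrow> 'x \<Rightarrow> ennreal" where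
  "intrinsic_dist P x y =
     (SUP Z\<in>{Z. null_subset P Z}.
        INF \<gamma>\<in>{\<gamma>. (\<exists>C. C-lipschitz_on {0..1} \<gamma>) \<and> \<gamma> 0 = x \<and> \<gamma> 1 = y \<and>
                  negligible {t\<in>{0..1}. \<gamma> t \<in> Z}}.
          path_length P \<gamma>)"

definition lipschitz_fun ::
    "('v, 'e::euclidean_space, 'x::metric_space) polyhedron_data \<Rightarrow> 'x set \<Rightarrow> ('x \<Rightarrow> real) \<Rightarrow> bool" where
  "lipschitz_fun P U u \<longleftrightarrow>
     (\<exists>C\<ge>0. \<forall>x\<in>U. \<forall>y\<in>U. ennreal \<bar>u x - u y\<bar> \<le> ennreal C * intrinsic_dist P x y)"

definition lip_c ::
    "('v, 'e::euclidean_space, 'x::metric_space) polyhedron_data \<Rightarrow> 'x set \<Rightarrow> ('x \<Rightarrow> real) set" where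
  "lip_c P U =
     {u. lipschitz_fun P UNIV u \<and> compact (closure {x. u x \<noteq> 0}) \<and> closure {x. u x \<noteq> 0} \<subseteq> U}"


section \<open>Gradients and Sobolev spaces\<close>

definition vector_field_on ::
    "('v, 'e::euclidean_space, 'x::metric_space) polyhedron_data \<Rightarrow> 'x set \<Rightarrow> ('x \<Rightarrow> 'e) \<Rightarrow> bool" where
  "vector_field_on P U G \<longleftrightarrow>
     G \<in> borel_measurable (restrict_space (vol P) U) \<and>
     (AE x in vol P. x \<in> U \<longrightarrow> G x \<in> tangent P (carrier_simplex P x))"

text \<open>
  \<open>G\<close> is the pointwise Riemannian gradient of \<open>u\<close> almost everywhere on \<open>U\<close>.  The derivative
  \<open>L\<close> is determined on the tangent space of the simplex only.
\<close>

definition has_gradient_on ::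
    "('v, 'e::euclidean_space, 'x::metric_space) polyhedron_data \<Rightarrow> 'x set
       \<Rightarrow> ('x \<Rightarrow> real) \<Rightarrow> ('x \<Rightarrow> 'e) \<Rightarrow> bool" where
  "has_gradient_on P U u G \<longleftrightarrow>
     vector_field_on P U G \<and>
     (AE x in vol P. x \<in> U \<longrightarrow>
        (let s = carrier_simplex P x
         in \<exists>L. ((\<lambda>y. u (pt P y)) has_derivative L) (at (pos P x) within pos P ` open_cell P s) \<and>
                (\<forall>\<xi>\<in>tangent P s. metric_form P x (G x) \<xi> = L \<xi>)))"

definition dirichlet_integral ::
    "('v, 'e::euclidean_space, 'x::metric_space) polyhedron_data \<Rightarrow> 'x set \<Rightarrow> ('x \<Rightarrow> 'e) \<Rightarrow> ennreal" where
  "dirichlet_integral P U G = (\<integral>\<^sup>+x\<in>U. ennreal (metric_form P x (G x) (G x)) \<partial>vol P)"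

definition sobolev_norm_sq ::
    "('v, 'e::euclidean_space, 'x::metric_space) polyhedron_data \<Rightarrow> 'x set
       \<Rightarrow> ('x \<Rightarrow> real) \<Rightarrow> ('x \<Rightarrow> 'e) \<Rightarrow> ennreal" where
  "sobolev_norm_sq P U u G =
     (\<integral>\<^sup>+x\<in>U. ennreal ((u x)\<^sup>2 + metric_form P x (G x) (G x)) \<partial>vol P)"

text \<open>
  The completion of a class \<open>F\<close> of Lipschitz functions on \<open>U\<close> under the Sobolev norm, realised
  as the closure of the pairs \<open>(u, \<nabla>u)\<close> in \<open>L\<^sup>2\<close>.  Thus \<open>sobolev_closure P F U u G\<close> says that
  \<open>u\<close> belongs to the completion and that its gradient is \<open>G\<close>.
\<close>

definition sobolev_closure ::
    "('v, 'e::euclidean_space, 'x::metric_space) polyhedron_data \<Rightarrow> ('x \<Rightarrow> real) set \<Rightarrow> 'x set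
       \<Rightarrow> ('x \<Rightarrow> real) \<Rightarrow> ('x \<Rightarrow> 'e) \<Rightarrow> bool" where
  "sobolev_closure P F U u G \<longleftrightarrow>
     u \<in> borel_measurable (restrict_space (vol P) U) \<and> vector_field_on P U G \<and>
     (\<exists>(w :: nat \<Rightarrow> 'x \<Rightarrow> real) (W :: nat \<Rightarrow> 'x \<Rightarrow> 'e).
        (\<forall>k. w k \<in> F \<and> w k \<in> borel_measurable (restrict_space (vol P) U) \<and>
             has_gradient_on P U (w k) (W k) \<and> sobolev_norm_sq P U (w k) (W k) < \<infinity>) \<and>
        (\<lambda>k. sobolev_norm_sq P U (\<lambda>x. w k x - u x) (\<lambda>x. W k x - G x)) \<longlonglongrightarrow> 0)"

definition W12_grad ::
    "('v, 'e::euclidean_space, 'x::metric_space) polyhedron_data \<Rightarrow> 'x set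
       \<Rightarrow> ('x \<Rightarrow> real) \<Rightarrow> ('x \<Rightarrow> 'e) \<Rightarrow> bool" where
  "W12_grad P U = sobolev_closure P {u. lipschitz_fun P U u} U"

definition W12_0_grad ::
    "('v, 'e::euclidean_space, 'x::metric_space) polyhedron_data \<Rightarrow> 'x set
       \<Rightarrow> ('x \<Rightarrow> real) \<Rightarrow> ('x \<Rightarrow> 'e) \<Rightarrow> bool" where
  "W12_0_grad P U = sobolev_closure P (lip_c P U) U"

definition L2_loc ::
    "('v, 'e::euclidean_space, 'x::metric_space) polyhedron_data \<Rightarrow> ('x \<Rightarrow> real) set" where
  "L2_loc P =
     {u. u \<in> borel_measurable (vol P) \<and>
         (\<forall>C. compact C \<longrightarrow> (\<integral>\<^sup>+x\<in>C. ennreal ((u x)\<^sup>2) \<partial>vol P) < \<infinity>)}"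

definition rel_compact_domain :: "'x::metric_space set \<Rightarrow> bool" where
  "rel_compact_domain U \<longleftrightarrow> open U \<and> connected U \<and> compact (closure U)"

definition W12_loc ::
    "('v, 'e::euclidean_space, 'x::metric_space) polyhedron_data \<Rightarrow> ('x \<Rightarrow> real) set" where
  "W12_loc P = {u \<in> L2_loc P. \<forall>U. rel_compact_domain U \<longrightarrow> (\<exists>G. W12_grad P U u G)}"

definition weak_gradient ::
    "('v, 'e::euclidean_space, 'x::metric_space) polyhedron_data
       \<Rightarrow> ('x \<Rightarrow> real) \<Rightarrow> ('x \<Rightarrow> 'e) \<Rightarrow> bool" where
  "weak_gradient P u G \<longleftrightarrow> (\<forall>U. rel_compact_domain U \<longrightarrow> W12_grad P U u G)"

text \<open>
  The square of the \<open>L\<^sup>2\<close> norm of \<open>\<nabla>u\<close>; the infimum is over the almost everywhere equal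
  representatives of \<open>\<nabla>u\<close>.
\<close>

definition grad_norm_sq ::
    "('v, 'e::euclidean_space, 'x::metric_space) polyhedron_data \<Rightarrow> ('x \<Rightarrow> real) \<Rightarrow> ennreal" where
  "grad_norm_sq P u = (INF G\<in>{G. weak_gradient P u G}. dirichlet_integral P UNIV G)"


section \<open>Harmonic functions and parabolicity\<close>

definition weakly_harmonic ::
    "('v, 'e::euclidean_space, 'x::metric_space) polyhedron_data \<Rightarrow> ('x \<Rightarrow> real) \<Rightarrow> bool" where
  "weakly_harmonic P f \<longleftrightarrow>
     f \<in> W12_loc P \<and>
     (\<forall>G \<rho> R. weak_gradient P f G \<and> \<rho> \<in> lip_c P UNIV \<and> has_gradient_on P UNIV \<rho> R \<longrightarrow>
        (\<integral>x. metric_form P x (G x) (R x) \<partial>vol P) = 0)"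

definition harmonic ::
    "('v, 'e::euclidean_space, 'x::metric_space) polyhedron_data \<Rightarrow> ('x \<Rightarrow> real) \<Rightarrow> bool" where
  "harmonic P f \<longleftrightarrow> continuous_on UNIV f \<and> weakly_harmonic P f"

text \<open>
  Sobolev functions are defined up to null sets, so \<open>u \<ge> 1\<close> on \<open>E\<close> is taken to mean that
  \<open>u \<ge> 1\<close> almost everywhere on a neighbourhood of \<open>E\<close>.  Requiring it only almost everywhere on
  \<open>E\<close> would make every null set have capacity 0.
\<close>

definition capacity ::
    "('v, 'e::euclidean_space, 'x::metric_space) polyhedron_data \<Rightarrow> 'x set \<Rightarrow> 'x set \<Rightarrow> ennreal" where
  "capacity P E \<Omega> =
     (INF (u, G)\<in>{(u, G). W12_0_grad P \<Omega> u G \<and>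
                   (\<exists>V. open V \<and> E \<subseteq> V \<and> V \<subseteq> \<Omega> \<and> (AE x in vol P. x \<in> V \<longrightarrow> 1 \<le> u x))}.
        dirichlet_integral P \<Omega> G)"

definition parabolic ::
    "('v, 'e::euclidean_space, 'x::metric_space) polyhedron_data \<Rightarrow> 'x set \<Rightarrow> bool" where
  "parabolic P \<Omega> \<longleftrightarrow>
     open \<Omega> \<and> connected \<Omega> \<and> (\<forall>D. compact D \<and> D \<subseteq> \<Omega> \<longrightarrow> capacity P D \<Omega> = 0)"

end

theory Submission
  imports Defs
begin

text \<open>
  Let \<open>G\<close> be the gradient of \<open>f\<close>, let \<open>w\<close> be a Lipschitz function with compact support and small
  energy which is close to \<open>1\<close> on a compact set, as provided by parabolicity, and let \<open>q\<close> be a Lipschitz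
  approximation of \<open>f\<close> near the support of \<open>w\<close>.  Testing the harmonicity of \<open>f\<close> with
  \<open>h(w) arctan q\<close>, where \<open>h(t) = t\<^sup>2 / (1 + t\<^sup>2)\<close>, bounds \<open>\<integral> h(w) |G|\<^sup>2 / (1 + q\<^sup>2)\<close> by the energies
  of \<open>w\<close> and \<open>q - f\<close>, because \<open>arctan\<close> is bounded.  (No truncation of \<open>f\<close> is needed, and
  \<open>h\<close> makes \<open>w\<close> bounded.)  Hence \<open>G = 0\<close> almost everywhere.

  On a small ball in an open maximal simplex, \<open>f\<close> is then an \<open>L\<^sup>2\<close> limit of Lipschitz functions whose
  gradients tend to \<open>0\<close> in \<open>L\<^sup>2\<close>.  Averages of a Lipschitz function over small balls are differentiable,
  by dominated convergence, and their derivatives are averages of the gradient; so the averages of \<open>f\<close>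
  are constant, and so is \<open>f\<close>.  By continuity \<open>f\<close> is constant on each closed maximal simplex, hence
  locally constant, as the star of a point is a union of simplexes containing that point.
\<close>

section \<open>Determinants of positive definite forms\<close>

text \<open>The test function must be Lipschitz for the intrinsic distance, whereas \<open>f\<close>
  is only a Sobolev function; hence \<open>q\<close> stands inside the arctangent and the gradient
  of \<open>q - f\<close> enters as an error. Outside its domain \<open>U\<close> the function
  \<open>q\<close> may be arbitrary: since h vanishes to second order at 0, the product is still
  differentiable at zeros of \<open>w\<close> lying there. The bound |h'| <= 1 makes the energy of
  \<open>w\<close> the only price of the cutoff.

  The data are intrinsic, but the constancy argument is run in a flat ball. Two one-sided
  comparisons lead there. An upper bound for the intrinsic distance turns intrinsic Lipschitz
  functions into Euclidean ones. A lower bound for the volume density, that is, for a determinant,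
  shows that null sets of the volume are null for the flat measure and that L2 convergence passes to
  the flat ball. The gradients of the approximations are given only almost everywhere; averaging
  absorbs the exceptional sets, because translations preserve flat null sets.\<close>

lemma det_on_cong:
  assumes "\<And>i k. i \<in> I \<Longrightarrow> k \<in> I \<Longrightarrow> a i k = b i k"
  shows "det_on I a = det_on I b"
  unfolding det_on_def
  by (intro sum.cong refl arg_cong2[where f = "(*)"] prod.cong) (auto simp: assms permutes_in_image)

text \<open>Every permutation picks exactly one entry of row \<open>i\<close>; once this factor is
  taken out, the sum is visibly linear in the row.\<close>

lemma det_on_row_add:
  assumes "finite I" "i \<in> I"
  shows "det_on I (a(i := \<lambda>k. u k + c * v k)) = det_on I (a(i := u)) + c * det_on I (a(i := v))"
proof -
  have "(\<Prod>j\<in>I. (a(i := w)) j (p j)) = w (p i) * (\<Prod>j\<in>I - {i}. a j (p j))" for p :: "'a \<Rightarrow> 'a" and w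
    using assms by (subst prod.remove[of _ i]) (auto intro!: prod.cong)
  then show ?thesis
    unfolding det_on_def by (simp add: sum_distrib_left sum.distrib[symmetric] algebra_simps)
qed

text \<open>Composing each permutation with the transposition of \<open>i\<close> and
  \<open>j\<close> reverses its sign and leaves the product unchanged, as the two rows agree. Hence
  the determinant equals its own negative.\<close>

lemma det_on_identical_rows:
  assumes "finite I" "i \<in> I" "j \<in> I" "i \<noteq> j" "a i = a j"
  shows "det_on I a = 0"
proof -
  let ?t = "Transposition.transpose i j"
  have t: "?t permutes I" using assms by (simp add: permutes_swap_id)
  have P: "(\<Prod>k\<in>I. a k ((p \<circ> ?t) k)) = (\<Prod>k\<in>I. a k (p k))" for p
  proof -
    have "(\<Prod>k\<in>I. a k ((p \<circ> ?t) k)) = (\<Prod>k\<in>I. a (?t k) (p k))"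
      by (subst prod.permute[OF t]) (simp add: o_def)
    also have "\<dots> = (\<Prod>k\<in>I. a k (p k))"
      using assms(5) by (intro prod.cong) (auto simp: Transposition.transpose_def)
    finally show ?thesis .
  qed
  have "det_on I a = (\<Sum>p | p permutes I. of_int (sign (p \<circ> ?t)) * (\<Prod>k\<in>I. a k ((p \<circ> ?t) k)))"
    unfolding det_on_def using t by (rule sum_permutations_compose_right)
  also have "\<dots> = (\<Sum>p | p permutes I. - (of_int (sign p) * (\<Prod>k\<in>I. a k (p k))))"
  proof (intro sum.cong refl)
    fix p assume "p \<in> {p. p permutes I}"
    then have "sign (p \<circ> ?t) = - sign p"
      using assms by (subst sign_compose)
        (auto simp: sign_swap_id intro: permutation_swap_id permutes_imp_permutation)
    then show "of_int (sign (p \<circ> ?t)) * (\<Prod>k\<in>I. a k ((p \<circ> ?t) k)) = - (of_int (sign p) * (\<Prod>k\<in>I. a k (p k)))"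
      by (simp add: P del: o_apply)
  qed
  also have "\<dots> = - det_on I a"
    unfolding det_on_def by (simp add: sum_negf)
  finally show ?thesis by simp
qed

text \<open>The rows in \<open>J\<close> are changed one at a time. Each change adds a multiple of
  the determinant of a matrix whose row \<open>r\<close> is a second copy of row \<open>j\<close>;
  since \<open>j\<close> is not in \<open>J\<close>, the pivot row itself survives.\<close>

lemma det_on_eliminate:
  assumes "finite I" "j \<in> I" "finite J" "J \<subseteq> I - {j}"
  shows "det_on I (\<lambda>i k. if i \<in> J then a i k - m i * a j k else a i k) = det_on I a"
  using assms(3,4)
proof (induction J)
  case empty
  then show ?case by simp
next
  case (insert r J)
  let ?b = "\<lambda>i k. if i \<in> J then a i k - m i * a j k else a i k"
  have r: "r \<in> I" "r \<noteq> j" "r \<notin> J" "j \<notin> J" using insert by auto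
  have "det_on I (\<lambda>i k. if i \<in> insert r J then a i k - m i * a j k else a i k)
      = det_on I (?b(r := \<lambda>k. a r k + (- m r) * a j k))"
    by (intro arg_cong[where f = "det_on I"] ext) auto
  also have "\<dots> = det_on I (?b(r := a r)) + (- m r) * det_on I (?b(r := a j))"
    by (rule det_on_row_add[OF assms(1) r(1)])
  also have "det_on I (?b(r := a j)) = 0"
    using r assms by (intro det_on_identical_rows[of I r j]) auto
  also have "?b(r := a r) = ?b" using r by auto
  finally show ?case using insert by simp
qed

text \<open>A permutation of \<open>insert j I\<close> that moves \<open>j\<close> sends some
  \<open>i\<close> in \<open>I\<close> to \<open>j\<close> and picks up the factor
  \<open>b i j = 0\<close>. The remaining ones fix \<open>j\<close> and are the permutations of
  \<open>I\<close>.\<close>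

lemma det_on_column_zero:
  assumes "finite I" "j \<notin> I" "\<And>i. i \<in> I \<Longrightarrow> b i j = 0"
  shows "det_on (insert j I) b = b j j * det_on I b"
proof -
  have "det_on (insert j I) b
      = (\<Sum>p | p permutes I. of_int (sign p) * (\<Prod>i\<in>insert j I. b i (p i)))"
    unfolding det_on_def
  proof (rule sum.mono_neutral_right)
    show "finite {p. p permutes insert j I}" using assms by (simp add: finite_permutations)
    show "{p. p permutes I} \<subseteq> {p. p permutes insert j I}"
      by (auto intro: permutes_subset)
    show "\<forall>p\<in>{p. p permutes insert j I} - {p. p permutes I}.
            of_int (sign p) * (\<Prod>i\<in>insert j I. b i (p i)) = 0"
    proof
      fix p assume p: "p \<in> {p. p permutes insert j I} - {p. p permutes I}"
      then have p1: "p permutes insert j I" and "\<not> p permutes I" by auto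
      then have "p j \<noteq> j"
        by (metis permutes_superset Diff_iff insert_iff)
      moreover obtain i where i: "i \<in> insert j I" "p i = j"
        using permutes_image[OF p1] by (metis image_iff insertI1)
      ultimately have "i \<in> I" by auto
      then have "(\<Prod>i\<in>insert j I. b i (p i)) = 0"
        using assms i by (intro prod_zero) (auto intro!: bexI[of _ i])
      then show "of_int (sign p) * (\<Prod>i\<in>insert j I. b i (p i)) = 0" by simp
    qed
  qed
  also have "\<dots> = (\<Sum>p | p permutes I. b j j * (of_int (sign p) * (\<Prod>i\<in>I. b i (p i))))"
    using assms by (intro sum.cong refl) (auto simp: permutes_not_in)
  also have "\<dots> = b j j * det_on I b"
    unfolding det_on_def by (simp add: sum_distrib_left)
  finally show ?thesis .
qed

text \<open>Gaussian elimination: the Schur complement inherits the lower bound of the form.\<close>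

lemma det_on_ge:
  assumes "finite I" "0 < c"
    and "\<And>i k. i \<in> I \<Longrightarrow> k \<in> I \<Longrightarrow> a i k = a k i"
    and "\<And>x. c * (\<Sum>i\<in>I. (x i)\<^sup>2) \<le> (\<Sum>i\<in>I. \<Sum>k\<in>I. a i k * x i * x k)"
  shows "c ^ card I \<le> det_on I a"
  using assms(1,3,4)
proof (induction I arbitrary: a)
  case empty
  then show ?case by (simp add: det_on_def)
next
  case (insert j I)
  have sym: "a i k = a k i" if "i \<in> insert j I" "k \<in> insert j I" for i k using insert.prems(1) that .
  have form: "(\<Sum>i\<in>insert j I. \<Sum>k\<in>insert j I. a i k * x i * x k)
      = (\<Sum>i\<in>I. \<Sum>k\<in>I. a i k * x i * x k) + 2 * x j * (\<Sum>i\<in>I. a i j * x i) + a j j * (x j)\<^sup>2" for x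
  proof -
    have "(\<Sum>i\<in>I. a j i * x j * x i) = (\<Sum>i\<in>I. a i j * x i * x j)"
      by (intro sum.cong refl) (use sym in auto)
    then show ?thesis
      using insert.hyps by (simp add: sum.distrib power2_eq_square sum_distrib_left algebra_simps)
  qed
  have ajj: "c \<le> a j j"
  proof -
    \<comment> \<open>The unit vector of index \<open>j\<close> isolates the pivot in the quadratic
      form.\<close>
    let ?x = "\<lambda>i. if i = j then 1 else (0::real)"
    have "c * (\<Sum>i\<in>insert j I. (?x i)\<^sup>2) \<le> (\<Sum>i\<in>insert j I. \<Sum>k\<in>insert j I. a i k * ?x i * ?x k)"
      by (rule insert.prems(2))
    moreover have "(\<Sum>i\<in>insert j I. (?x i)\<^sup>2) = 1"
    proof -
      have "(\<Sum>i\<in>I. (?x i)\<^sup>2) = 0" using insert.hyps by (intro sum.neutral) auto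
      then show ?thesis using insert.hyps by simp
    qed
    moreover have "(\<Sum>i\<in>insert j I. \<Sum>k\<in>insert j I. a i k * ?x i * ?x k) = a j j"
    proof -
      have z: "(\<Sum>i\<in>I. a i j * ?x i) = 0" "(\<Sum>i\<in>I. \<Sum>k\<in>I. a i k * ?x i * ?x k) = 0"
        using insert.hyps by (auto intro!: sum.neutral)
      show ?thesis unfolding form z by simp
    qed
    ultimately show ?thesis by simp
  qed
  then have pos: "0 < a j j" using assms(2) by simp
  define b where "b i k = a i k - a i j / a j j * a j k" for i k
  have "c ^ card I \<le> det_on I b"
  proof (rule insert.IH)
    show "b i k = b k i" if "i \<in> I" "k \<in> I" for i k
      unfolding b_def using that sym[of i k] sym[of i j] sym[of k j] by simp
    show "c * (\<Sum>i\<in>I. (x i)\<^sup>2) \<le> (\<Sum>i\<in>I. \<Sum>k\<in>I. b i k * x i * x k)" for x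
    proof -
      define s where "s = (\<Sum>i\<in>I. a i j * x i)"
      \<comment> \<open>This value at \<open>j\<close> minimises the form while the other
        coordinates are those of \<open>x\<close>. The minimum is the form of the Schur complement
        \<open>b\<close>, and the extra square on the left only helps.\<close>
      define y where "y = x(j := - s / a j j)"
      have yI: "y i = x i" if "i \<in> I" for i using that insert.hyps by (auto simp: y_def)
      have "c * (\<Sum>i\<in>I. (x i)\<^sup>2) \<le> c * (\<Sum>i\<in>insert j I. (y i)\<^sup>2)"
        using insert.hyps assms(2) by (simp add: yI)
      also have "\<dots> \<le> (\<Sum>i\<in>insert j I. \<Sum>k\<in>insert j I. a i k * y i * y k)"
        by (rule insert.prems(2))
      also have "\<dots> = (\<Sum>i\<in>I. \<Sum>k\<in>I. a i k * x i * x k) + 2 * y j * s + a j j * (y j)\<^sup>2"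
        unfolding form by (simp add: yI s_def cong: sum.cong)
      also have "\<dots> = (\<Sum>i\<in>I. \<Sum>k\<in>I. a i k * x i * x k) - s * s / a j j"
        using pos by (simp add: y_def power2_eq_square field_simps)
      also have "s * s / a j j = (\<Sum>i\<in>I. \<Sum>k\<in>I. a i j / a j j * a j k * x i * x k)"
      proof -
        have "s * s = (\<Sum>i\<in>I. a i j * x i) * (\<Sum>k\<in>I. a j k * x k)"
          unfolding s_def by (intro arg_cong2[where f = "(*)"] refl sum.cong) (use sym in auto)
        then show ?thesis
          by (simp add: sum_product sum_divide_distrib field_simps)
      qed
      also have "(\<Sum>i\<in>I. \<Sum>k\<in>I. a i k * x i * x k) - \<dots> = (\<Sum>i\<in>I. \<Sum>k\<in>I. b i k * x i * x k)"
        by (simp add: b_def sum_subtractf[symmetric] algebra_simps)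
      finally show ?thesis .
    qed
  qed
  moreover have "det_on (insert j I) a = a j j * det_on I b"
  proof -
    have "det_on (insert j I) a
        = det_on (insert j I) (\<lambda>i k. if i \<in> I then a i k - a i j / a j j * a j k else a i k)"
      using insert.hyps by (subst det_on_eliminate) auto
    also have "\<dots> = a j j * det_on I b"
      using insert.hyps pos by (subst det_on_column_zero) (auto simp: b_def intro!: det_on_cong)
    finally show ?thesis .
  qed
  ultimately show ?case
    using ajj assms(2) insert.hyps by (simp add: mult_mono)
qed

section \<open>Lebesgue measure on subspaces\<close>

text \<open>For orthonormal \<open>B\<close> this is Lebesgue measure on the subspace spanned by
  \<open>B\<close>, regarded as a Borel measure on the ambient space.
  \<open>simplex_lebesgue\<close> is the completion of one of its translates.\<close>

definition flat_measure :: "'e::euclidean_space set \<Rightarrow> 'e measure" where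
  "flat_measure B = distr (Pi\<^sub>M B (\<lambda>_. lborel)) borel (\<lambda>x. \<Sum>b\<in>B. x b *\<^sub>R b)"

lemma sets_flat_measure [simp, measurable_cong]: "sets (flat_measure B) = sets borel"
  and space_flat_measure [simp]: "space (flat_measure B) = UNIV"
  by (simp_all add: flat_measure_def)

lemma measurable_frame_sum [measurable]:
  fixes B :: "'e::euclidean_space set"
  shows "(\<lambda>x. \<Sum>b\<in>B. x b *\<^sub>R b) \<in> borel_measurable (Pi\<^sub>M B (\<lambda>_. lborel))"
proof (intro borel_measurable_sum borel_measurable_scaleR)
  fix b assume "b \<in> B"
  then show "(\<lambda>x. x b) \<in> borel_measurable (Pi\<^sub>M B (\<lambda>_. lborel))"
    using measurable_component_singleton[of b B "\<lambda>_. lborel :: real measure"] by simp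
qed simp

text \<open>A product measure is determined by its values on boxes, where the one-dimensional
  scaling law is applied in each coordinate; the factors \<open>t\<close> multiply to the
  Jacobian.\<close>

lemma PiM_lborel_affine:
  assumes "finite I" "0 < t"
  shows "scale_measure (ennreal (t ^ card I))
           (distr (Pi\<^sub>M I (\<lambda>_. lborel)) (Pi\<^sub>M I (\<lambda>_. lborel)) (\<lambda>x. \<lambda>i\<in>I. c i + t * x i)) =
         Pi\<^sub>M I (\<lambda>_. lborel :: real measure)"
proof -
  interpret product_sigma_finite "\<lambda>_. lborel :: real measure" by standard
  let ?T = "\<lambda>x. \<lambda>i\<in>I. c i + t * x i"
  let ?P = "Pi\<^sub>M I (\<lambda>_. lborel :: real measure)"
  have T [measurable]: "?T \<in> measurable ?P ?P" by measurable
  show ?thesis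
  proof (rule PiM_eqI)
    fix A :: "'a \<Rightarrow> real set" assume "\<And>i. i \<in> I \<Longrightarrow> A i \<in> sets lborel"
    then have A [measurable]: "\<And>i. i \<in> I \<Longrightarrow> A i \<in> sets borel" by simp
    have pre: "?T -` Pi\<^sub>E I A \<inter> space ?P = Pi\<^sub>E I (\<lambda>i. (\<lambda>x. c i + t * x) -` A i)"
      by (auto simp: space_PiM PiE_iff)
    have one: "ennreal t * emeasure lborel ((\<lambda>x. c i + t * x) -` A i) = emeasure lborel (A i)"
      if "i \<in> I" for i
    proof -
      have "emeasure lborel (A i)
          = emeasure (density (distr lborel borel (\<lambda>x. c i + t * x)) (\<lambda>_. ennreal \<bar>t\<bar>)) (A i)"
        using assms by (subst lborel_real_affine[of t "c i"]) auto
      also have "\<dots> = ennreal t * emeasure lborel ((\<lambda>x. c i + t * x) -` A i)"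
        using assms that by (simp add: emeasure_density nn_integral_cmult_indicator emeasure_distr A)
      finally show ?thesis by simp
    qed
    have "emeasure (scale_measure (ennreal (t ^ card I)) (distr ?P ?P ?T)) (Pi\<^sub>E I A)
        = ennreal (t ^ card I) * emeasure ?P (Pi\<^sub>E I (\<lambda>i. (\<lambda>x. c i + t * x) -` A i))"
      using assms by (simp add: emeasure_distr pre sets_PiM_I_finite A)
    also have "emeasure ?P (Pi\<^sub>E I (\<lambda>i. (\<lambda>x. c i + t * x) -` A i))
        = (\<Prod>i\<in>I. emeasure lborel ((\<lambda>x. c i + t * x) -` A i))"
      using assms A by (intro emeasure_PiM) (auto intro!: measurable_sets_borel[OF _ A])
    also have "ennreal (t ^ card I) * \<dots> = (\<Prod>i\<in>I. ennreal t * emeasure lborel ((\<lambda>x. c i + t * x) -` A i))"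
      using assms by (simp add: prod.distrib ennreal_power)
    also have "\<dots> = (\<Prod>i\<in>I. emeasure lborel (A i))"
      by (intro prod.cong refl one)
    finally show "emeasure (scale_measure (ennreal (t ^ card I)) (distr ?P ?P ?T)) (Pi\<^sub>E I A)
        = (\<Prod>i\<in>I. emeasure lborel (A i))" .
  qed (use assms in auto)
qed

text \<open>Because \<open>v\<close> lies in the span, the map on the subspace is an affine map of
  the coordinates, to which the product version applies.\<close>

lemma flat_measure_affine:
  fixes B :: "'e::euclidean_space set"
  assumes "finite B" "0 < t" "v \<in> span B"
  shows "scale_measure (ennreal (t ^ card B)) (distr (flat_measure B) borel (\<lambda>y. v + t *\<^sub>R y))
       = flat_measure B"
proof -
  obtain c where c: "v = (\<Sum>b\<in>B. c b *\<^sub>R b)"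
    using assms(3) unfolding span_finite[OF assms(1)] by blast
  let ?P = "Pi\<^sub>M B (\<lambda>_. lborel :: real measure)" and ?s = "\<lambda>x. \<Sum>b\<in>B. x b *\<^sub>R b"
  let ?T = "\<lambda>x. \<lambda>i\<in>B. c i + t * x i"
  have [measurable]: "?T \<in> measurable ?P ?P" by measurable
  have comp: "(\<lambda>y. v + t *\<^sub>R y) \<circ> ?s = ?s \<circ> ?T"
    unfolding c by (auto simp: fun_eq_iff scaleR_sum_right sum.distrib[symmetric] scaleR_add_left intro!: sum.cong)
  have "scale_measure (ennreal (t ^ card B)) (distr (flat_measure B) borel (\<lambda>y. v + t *\<^sub>R y))
      = scale_measure (ennreal (t ^ card B)) (distr (distr ?P ?P ?T) borel ?s)"
    unfolding flat_measure_def by (subst (1 2) distr_distr) (auto simp: comp)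
  also have "\<dots> = distr (scale_measure (ennreal (t ^ card B)) (distr ?P ?P ?T)) borel ?s"
    by (rule measure_eqI) (auto simp: emeasure_distr space_scale_measure)
  also have "\<dots> = flat_measure B"
    using assms by (simp add: PiM_lborel_affine flat_measure_def)
  finally show ?thesis .
qed

lemma flat_measure_translate:
  assumes "finite B" "v \<in> span B"
  shows "distr (flat_measure B) borel (\<lambda>y. v + y) = flat_measure B"
  using flat_measure_affine[OF assms(1) zero_less_one assms(2)] by simp

text \<open>With \<open>t = 1\<close> this moves null sets by translations; a general
  \<open>t > 0\<close> is what the Fubini argument for rays requires.\<close>

lemma AE_flat_measure_affine:
  fixes B :: "'e::euclidean_space set"
  assumes "finite B" "0 < t" "v \<in> span B" and "AE y in flat_measure B. P y"
  shows "AE y in flat_measure B. P (v + t *\<^sub>R y)"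
proof -
  obtain N where N: "{y. \<not> P y} \<subseteq> N" "emeasure (flat_measure B) N = 0" and [measurable]: "N \<in> sets borel"
    using AE_E[OF assms(4)] by auto
  have "ennreal (t ^ card B) * emeasure (distr (flat_measure B) borel (\<lambda>y. v + t *\<^sub>R y)) N = 0"
    using N(2) flat_measure_affine[OF assms(1-3)] by (metis emeasure_scale_measure)
  then have "emeasure (flat_measure B) ((\<lambda>y. v + t *\<^sub>R y) -` N) = 0"
    using assms(2) by (simp add: emeasure_distr)
  moreover have "(\<lambda>y. v + t *\<^sub>R y) -` N \<in> sets (flat_measure B)"
    using measurable_sets[of "\<lambda>y. v + t *\<^sub>R y" "flat_measure B" borel N] by simp
  ultimately show ?thesis
    using N(1) by (intro AE_I[where N = "(\<lambda>y. v + t *\<^sub>R y) -` N"]) auto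
qed

lemma orthonormal_basics:
  fixes B :: "'e::euclidean_space set"
  assumes "pairwise orthogonal B" "\<forall>b\<in>B. norm b = 1"
  shows orthonormal_finite: "finite B"
    and orthonormal_norm_sum: "(norm (\<Sum>b\<in>B. x b *\<^sub>R b))\<^sup>2 = (\<Sum>b\<in>B. (x b)\<^sup>2)"
    and orthonormal_inner_sum: "c \<in> B \<Longrightarrow> (\<Sum>b\<in>B. x b *\<^sub>R b) \<bullet> c = x c"
proof -
  have "0 \<notin> B" using assms(2) by force
  then show fin: "finite B"
    using assms(1) by (simp add: independent_imp_finite pairwise_orthogonal_independent)
  have ip: "b \<bullet> c = (if b = c then 1 else 0)" if "b \<in> B" "c \<in> B" for b c
    using that assms by (auto simp: pairwise_def orthogonal_def norm_eq_1)
  show inner: "(\<Sum>b\<in>B. x b *\<^sub>R b) \<bullet> c = x c" if "c \<in> B" for c x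
    using that fin by (simp add: inner_sum_left ip if_distrib[of "\<lambda>u. _ * u"] cong: if_cong)
  show "(norm (\<Sum>b\<in>B. x b *\<^sub>R b))\<^sup>2 = (\<Sum>b\<in>B. (x b)\<^sup>2)"
    unfolding power2_norm_eq_inner by (subst inner_sum_right) (simp add: inner power2_eq_square)
qed

lemma orthonormal_expansion:
  fixes B :: "'e::euclidean_space set"
  assumes "pairwise orthogonal B" "\<forall>b\<in>B. norm b = 1" "y \<in> span B"
  shows "y = (\<Sum>b\<in>B. (y \<bullet> b) *\<^sub>R b)"
proof -
  obtain c where c: "y = (\<Sum>b\<in>B. c b *\<^sub>R b)"
    using assms(3) unfolding span_finite[OF orthonormal_finite[OF assms(1,2)]] by blast
  then have "y \<bullet> b = c b" if "b \<in> B" for b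
    using orthonormal_inner_sum[OF assms(1,2) that, of c] by simp
  then show ?thesis using c by simp
qed

lemma emeasure_flat_ball:
  fixes B :: "'e::euclidean_space set"
  assumes "pairwise orthogonal B" "\<forall>b\<in>B. norm b = 1"
  shows emeasure_flat_ball_finite: "emeasure (flat_measure B) (ball 0 r) < \<infinity>"
    and emeasure_flat_ball_pos: "v \<in> span B \<Longrightarrow> 0 < r \<Longrightarrow> 0 < emeasure (flat_measure B) (ball v r)"
proof -
  note fin = orthonormal_finite[OF assms]
  interpret product_sigma_finite "\<lambda>_. lborel :: real measure" by standard
  let ?P = "Pi\<^sub>M B (\<lambda>_. lborel :: real measure)" and ?s = "\<lambda>x. \<Sum>b\<in>B. x b *\<^sub>R b"
  have eball: "emeasure (flat_measure B) (ball 0 r) = emeasure ?P (?s -` ball 0 r \<inter> space ?P)" for r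
    unfolding flat_measure_def by (simp add: emeasure_distr)
  have box: "emeasure ?P (Pi\<^sub>E B (\<lambda>_. {- r..r})) = ennreal (2 * r) ^ card B" if "0 \<le> r" for r
    using fin that by (subst emeasure_PiM) (auto simp: emeasure_lborel_Icc_eq)
  have "?s -` ball 0 r \<inter> space ?P \<subseteq> Pi\<^sub>E B (\<lambda>_. {- \<bar>r\<bar>..\<bar>r\<bar>})"
  proof
    fix x assume x: "x \<in> ?s -` ball 0 r \<inter> space ?P"
    have "\<bar>x b\<bar> \<le> \<bar>r\<bar>" if "b \<in> B" for b
    proof -
      have "\<bar>x b\<bar> = \<bar>?s x \<bullet> b\<bar>" using orthonormal_inner_sum[OF assms that] by simp
      also have "\<dots> \<le> norm (?s x) * norm b" by (rule Cauchy_Schwarz_ineq2)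
      also have "\<dots> \<le> \<bar>r\<bar>" using x that assms(2) by auto
      finally show ?thesis .
    qed
    then show "x \<in> Pi\<^sub>E B (\<lambda>_. {- \<bar>r\<bar>..\<bar>r\<bar>})"
      using x by (auto simp: space_PiM PiE_iff abs_le_iff minus_le_iff)
  qed
  then have "emeasure (flat_measure B) (ball 0 r) \<le> emeasure ?P (Pi\<^sub>E B (\<lambda>_. {- \<bar>r\<bar>..\<bar>r\<bar>}))"
    unfolding eball by (intro emeasure_mono sets_PiM_I_finite fin) auto
  also have "\<dots> < \<infinity>" by (subst box) (auto simp: ennreal_power)
  finally show "emeasure (flat_measure B) (ball 0 r) < \<infinity>" .
  assume v: "v \<in> span B" and r: "0 < r"
  \<comment> \<open>A vector with \<open>card B\<close> coordinates of size at most \<open>e\<close>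
    has norm at most \<open>card B * e\<close>, which is below \<open>r\<close>. The summand 1
    covers the zero-dimensional case.\<close>
  define e where "e = r / (1 + real (card B))"
  have e: "0 < e" using r by (simp add: e_def)
  have "Pi\<^sub>E B (\<lambda>_. {- e..e}) \<subseteq> ?s -` ball 0 r \<inter> space ?P"
  proof
    fix x assume x: "x \<in> Pi\<^sub>E B (\<lambda>_. {- e..e})"
    have "norm (?s x) \<le> (\<Sum>b\<in>B. norm (x b *\<^sub>R b))" by (rule norm_sum)
    also have "\<dots> \<le> (\<Sum>b\<in>B. e)"
      using x assms(2) by (intro sum_mono) (auto simp: PiE_iff abs_le_iff minus_le_iff)
    also have "\<dots> < r" using r by (simp add: e_def field_simps)
    finally show "x \<in> ?s -` ball 0 r \<inter> space ?P" using x by (auto simp: space_PiM PiE_iff)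
  qed
  then have "emeasure ?P (Pi\<^sub>E B (\<lambda>_. {- e..e})) \<le> emeasure (flat_measure B) (ball 0 r)"
    unfolding eball by (intro emeasure_mono) auto
  moreover have "0 < emeasure ?P (Pi\<^sub>E B (\<lambda>_. {- e..e}))"
    using e by (subst box) (auto simp: ennreal_power)
  moreover have "emeasure (flat_measure B) (ball v r) = emeasure (flat_measure B) (ball 0 r)"
    by (subst (1) flat_measure_translate[OF fin v, symmetric])
       (auto simp: emeasure_distr dist_norm intro!: arg_cong2[where f = emeasure])
  ultimately show "0 < emeasure (flat_measure B) (ball v r)" by simp
qed

lemma AE_flat_measure_span:
  "finite B \<Longrightarrow> AE y in flat_measure B. y \<in> span B"
  unfolding flat_measure_def
  by (subst AE_distr_iff)
     (auto intro!: AE_I2 span_sum span_scale intro: span_base borel_closed)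

lemma sigma_finite_flat_measure:
  fixes B :: "'e::euclidean_space set"
  assumes "pairwise orthogonal B" "\<forall>b\<in>B. norm b = 1"
  shows "sigma_finite_measure (flat_measure B)"
proof
  have "(\<Union>n::nat. ball (0::'e) (real n)) = UNIV"
    using reals_Archimedean2 by auto
  then show "\<exists>A. countable A \<and> A \<subseteq> sets (flat_measure B) \<and> \<Union>A = space (flat_measure B) \<and>
      (\<forall>a\<in>A. emeasure (flat_measure B) a \<noteq> \<infinity>)"
    using emeasure_flat_ball_finite[OF assms]
    by (intro exI[of _ "range (\<lambda>n::nat. ball 0 (real n))"]) (auto simp: less_top)
qed

section \<open>Limits with vanishing gradients\<close>

lemma measurable_indicator_ball [measurable]:
  "(indicator (ball c r) :: 'a::metric_space \<Rightarrow> 'b::{zero_neq_one,topological_space}) \<in> borel_measurable borel"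
  by (intro borel_measurable_indicator) simp

text \<open>Cauchy-Schwarz against the indicator of \<open>A\<close> bounds the square of the L1
  norm. The limit is then read off by comparing squares in \<open>ennreal\<close>, so no square root
  of an integral is taken.\<close>

lemma Cauchy_Schwarz_set_tendsto_0:
  fixes h :: "nat \<Rightarrow> 'a \<Rightarrow> real"
  assumes [measurable]: "A \<in> sets M" "\<And>k. h k \<in> borel_measurable M"
    and "emeasure M A < \<infinity>"
    and "(\<lambda>k. \<integral>\<^sup>+x\<in>A. ennreal ((h k x)\<^sup>2) \<partial>M) \<longlonglongrightarrow> 0"
  shows "(\<lambda>k. \<integral>\<^sup>+x\<in>A. ennreal \<bar>h k x\<bar> \<partial>M) \<longlonglongrightarrow> 0"
proof -
  let ?m = "measure M A"
  have m: "emeasure M A = ennreal ?m" using assms(3) by (simp add: emeasure_eq_ennreal_measure)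
  have le: "(\<integral>\<^sup>+x\<in>A. ennreal \<bar>h k x\<bar> \<partial>M)\<^sup>2 \<le> (\<integral>\<^sup>+x\<in>A. ennreal ((h k x)\<^sup>2) \<partial>M) * ennreal ?m" for k
  proof -
    have "(\<integral>\<^sup>+x\<in>A. ennreal \<bar>h k x\<bar> \<partial>M)\<^sup>2
        = (\<integral>\<^sup>+x. (ennreal \<bar>h k x\<bar> * indicator A x) * indicator A x \<partial>M)\<^sup>2"
      by (intro arg_cong[where f = "\<lambda>x. x\<^sup>2"] nn_integral_cong) (auto split: split_indicator)
    also have "\<dots> \<le> (\<integral>\<^sup>+x. (ennreal \<bar>h k x\<bar> * indicator A x)\<^sup>2 \<partial>M) * (\<integral>\<^sup>+x. (indicator A x)\<^sup>2 \<partial>M)"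
      by (intro Cauchy_Schwarz_nn_integral) auto
    also have "(\<integral>\<^sup>+x. (ennreal \<bar>h k x\<bar> * indicator A x)\<^sup>2 \<partial>M) = (\<integral>\<^sup>+x\<in>A. ennreal ((h k x)\<^sup>2) \<partial>M)"
      by (intro nn_integral_cong) (auto split: split_indicator simp: ennreal_power)
    also have "(\<integral>\<^sup>+x. (indicator A x)\<^sup>2 \<partial>M) = (\<integral>\<^sup>+x. indicator A x \<partial>M)"
      by (intro nn_integral_cong) (auto split: split_indicator)
    also have "\<dots> = ennreal ?m" using m by simp
    finally show ?thesis .
  qed
  have lim: "(\<lambda>k. (\<integral>\<^sup>+x\<in>A. ennreal ((h k x)\<^sup>2) \<partial>M) * ennreal ?m) \<longlonglongrightarrow> 0"
    using ennreal_tendsto_cmult[OF _ assms(4), of "ennreal ?m"] by (simp add: mult.commute)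
  show ?thesis
  proof (rule order_tendstoI)
    \<comment> \<open>The threshold \<open>a\<close> may be infinite, so a finite positive real
      \<open>e\<close> below it is chosen before squaring.\<close>
    fix a :: ennreal assume "0 < a"
    then obtain e :: real where e: "0 < e" "ennreal e < a"
    proof -
      obtain b where b: "0 < b" "b < a" using dense[OF \<open>0 < a\<close>] by auto
      then obtain e where "b = ennreal e" "0 \<le> e" by (cases b) (auto simp: top_unique)
      then show ?thesis using b that[of e] by (cases "e = 0") auto
    qed
    have "\<forall>\<^sub>F k in sequentially. (\<integral>\<^sup>+x\<in>A. ennreal ((h k x)\<^sup>2) \<partial>M) * ennreal ?m < (ennreal e)\<^sup>2"
      using lim e by (intro order_tendstoD) (auto simp: ennreal_power)
    then show "\<forall>\<^sub>F k in sequentially. (\<integral>\<^sup>+x\<in>A. ennreal \<bar>h k x\<bar> \<partial>M) < a"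
    proof eventually_elim
      case (elim k)
      then have "(\<integral>\<^sup>+x\<in>A. ennreal \<bar>h k x\<bar> \<partial>M)\<^sup>2 < (ennreal e)\<^sup>2" using le[of k] by simp
      then have "(\<integral>\<^sup>+x\<in>A. ennreal \<bar>h k x\<bar> \<partial>M) < ennreal e"
        by (meson not_le power_mono zero_le)
      then show ?case using e by simp
    qed
  qed simp
qed

lemma abs_integral_le_nn_integral:
  fixes f :: "'a \<Rightarrow> real"
  shows "ennreal \<bar>integral\<^sup>L M f\<bar> \<le> (\<integral>\<^sup>+x. ennreal \<bar>f x\<bar> \<partial>M)"
proof (cases "integrable M f")
  case True
  then show ?thesis using integral_norm_bound_ennreal[OF True] by simp
next
  \<comment> \<open>A nonintegrable function has Bochner integral 0 by convention.\<close>
  case False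
  then show ?thesis by (simp add: not_integrable_integral_eq)
qed

section \<open>Averages over balls in a flat subspace\<close>

locale flat_space =
  fixes B :: "'e::euclidean_space set"
  assumes orthonormal: "pairwise orthogonal B" "\<forall>b\<in>B. norm b = 1"
begin

abbreviation "\<mu> \<equiv> flat_measure B"

lemma finite_B: "finite B"
  by (rule orthonormal_finite[OF orthonormal])

lemma emeasure_ball_finite: "emeasure \<mu> (ball 0 r) < \<infinity>"
  by (rule emeasure_flat_ball_finite[OF orthonormal])

lemma nn_integral_translate:
  assumes "f \<in> borel_measurable borel" "v \<in> span B"
  shows "(\<integral>\<^sup>+z. f (v + z) \<partial>\<mu>) = (\<integral>\<^sup>+z. f z \<partial>\<mu>)"
proof -
  have "(\<integral>\<^sup>+z. f z \<partial>\<mu>) = (\<integral>\<^sup>+z. f z \<partial>distr \<mu> borel (\<lambda>z. v + z))"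
    by (simp add: flat_measure_translate[OF finite_B assms(2)])
  also have "\<dots> = (\<integral>\<^sup>+z. f (v + z) \<partial>\<mu>)"
    using assms(1) by (subst nn_integral_distr) auto
  finally show ?thesis by simp
qed

lemma AE_translate:
  assumes "AE y in \<mu>. P y" "v \<in> span B"
  shows "AE y in \<mu>. P (v + y)"
  using AE_flat_measure_affine[OF finite_B zero_less_one assms(2), of P] assms(1)
  by simp

text \<open>The domain of integration is a fixed ball and the centre enters through the argument of
  \<open>q\<close>, so that differentiation in \<open>x\<close> falls on \<open>q\<close>. The
  integral is not divided by the measure of the ball.\<close>

definition average :: "real \<Rightarrow> ('e \<Rightarrow> real) \<Rightarrow> 'e \<Rightarrow> real" where
  "average \<rho> q x = (\<integral>z. indicator (ball 0 \<rho>) z * q (x + z) \<partial>\<mu>)"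

text \<open>This makes an L1 bound on the large ball uniform in the centre: the small ball around
  \<open>x\<close> lies inside the large one, and \<open>\<mu>\<close> is invariant under
  translation by vectors of the span.\<close>

lemma translated_ball_nn_integral_le:
  fixes d :: "'e \<Rightarrow> real"
  assumes [measurable]: "d \<in> borel_measurable borel"
    and "x \<in> span B" "norm x \<le> R - \<rho>"
  shows "(\<integral>\<^sup>+z. ennreal \<bar>indicator (ball 0 \<rho>) z * d (x + z)\<bar> \<partial>\<mu>) \<le> (\<integral>\<^sup>+z\<in>ball 0 R. ennreal \<bar>d z\<bar> \<partial>\<mu>)"
proof -
  have "(\<integral>\<^sup>+z. ennreal \<bar>indicator (ball 0 \<rho>) z * d (x + z)\<bar> \<partial>\<mu>)
      \<le> (\<integral>\<^sup>+z. ennreal \<bar>d (x + z)\<bar> * indicator (ball 0 R) (x + z) \<partial>\<mu>)"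
  proof (intro nn_integral_mono)
    fix z
    have "norm (x + z) < R" if "norm z < \<rho>" using norm_triangle_ineq[of x z] assms(3) that by simp
    then show "ennreal \<bar>indicator (ball 0 \<rho>) z * d (x + z)\<bar>
        \<le> ennreal \<bar>d (x + z)\<bar> * indicator (ball 0 R) (x + z)"
      by (auto split: split_indicator)
  qed
  also have "\<dots> = (\<integral>\<^sup>+z\<in>ball 0 R. ennreal \<bar>d z\<bar> \<partial>\<mu>)"
    by (rule nn_integral_translate[OF _ assms(2)]) auto
  finally show ?thesis .
qed

lemma integrable_average:
  fixes q :: "'e \<Rightarrow> real"
  assumes [measurable]: "q \<in> borel_measurable borel" and "\<And>y. \<bar>q y\<bar> \<le> K"
  shows "integrable \<mu> (\<lambda>z. indicator (ball 0 \<rho>) z * q (x + z))"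
proof (rule Bochner_Integration.integrable_bound)
  show "integrable \<mu> (\<lambda>z. indicator (ball 0 \<rho>) z * K)"
    using emeasure_ball_finite by (intro integrable_mult_left integrable_real_indicator) auto
  \<comment> \<open>\<open>undefined\<close> is merely some point at which the bound is
    evaluated.\<close>
  have "0 \<le> K" using assms(2)[of undefined] by linarith
  then show "AE z in \<mu>. norm (indicator (ball 0 \<rho>) z * q (x + z)) \<le> norm (indicator (ball 0 \<rho>) z * K)"
    using assms(2) by (auto split: split_indicator)
qed simp

lemma abs_average_diff_le:
  fixes p q :: "'e \<Rightarrow> real"
  assumes [measurable]: "p \<in> borel_measurable borel" "q \<in> borel_measurable borel"
    and "\<And>y. \<bar>p y\<bar> \<le> K" "\<And>y. \<bar>q y\<bar> \<le> K'" and "x \<in> span B" "norm x \<le> R - \<rho>"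
  shows "ennreal \<bar>average \<rho> p x - average \<rho> q x\<bar> \<le> (\<integral>\<^sup>+z\<in>ball 0 R. ennreal \<bar>p z - q z\<bar> \<partial>\<mu>)"
proof -
  have "average \<rho> p x - average \<rho> q x = (\<integral>z. indicator (ball 0 \<rho>) z * (p (x + z) - q (x + z)) \<partial>\<mu>)"
    unfolding average_def
    by (subst Bochner_Integration.integral_diff[symmetric])
       (auto intro!: integrable_average assms Bochner_Integration.integral_cong simp: right_diff_distrib)
  then show ?thesis
    using abs_integral_le_nn_integral[of \<mu> "\<lambda>z. indicator (ball 0 \<rho>) z * (p (x + z) - q (x + z))"]
      translated_ball_nn_integral_le[of "\<lambda>z. p z - q z" x R \<rho>] assms by simp
qed

text \<open>Differentiability of \<open>q\<close> almost everywhere gives differentiability of the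
  average at every parameter: a change of base point only translates the exceptional null set. The
  Lipschitz constant times \<open>norm \<xi>\<close>, supported in the ball, dominates all
  difference quotients.\<close>

lemma average_has_derivative:
  fixes q :: "'e \<Rightarrow> real"
  assumes [measurable]: "q \<in> borel_measurable borel" "d \<in> borel_measurable borel"
    and bound: "\<And>y. \<bar>q y\<bar> \<le> K"
    and lip: "C-lipschitz_on (span B \<inter> ball 0 R) q"
    and deriv: "AE y in \<mu>. y \<in> ball 0 R \<longrightarrow> ((\<lambda>t. (q (y + t *\<^sub>R \<xi>) - q y) / t) \<longlongrightarrow> d y) (at 0)"
    and x: "x \<in> span B" and \<xi>: "\<xi> \<in> span B"
    and R: "\<And>s. s \<in> {0..1} \<Longrightarrow> norm (x + s *\<^sub>R \<xi>) \<le> R - \<rho>" and t: "t \<in> {0..1}"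
  shows "((\<lambda>s. average \<rho> q (x + s *\<^sub>R \<xi>)) has_field_derivative average \<rho> d (x + t *\<^sub>R \<xi>)) (at t within {0..1})"
  unfolding has_field_derivative_iff tendsto_at_iff_sequentially
proof (intro allI impI)
  fix s :: "nat \<Rightarrow> real" assume s: "\<forall>i. s i \<in> {0..1} - {t}" and lim: "s \<longlonglongrightarrow> t"
  define D where "D i z = indicator (ball 0 \<rho>) z * ((q (x + s i *\<^sub>R \<xi> + z) - q (x + t *\<^sub>R \<xi> + z)) / (s i - t))" for i z
  have sp: "x + s *\<^sub>R \<xi> \<in> span B" for s using x \<xi> by (intro span_add span_scale)
  have in_ball: "x + s *\<^sub>R \<xi> + z \<in> ball 0 R" if "s \<in> {0..1}" "z \<in> ball 0 \<rho>" for s z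
    using norm_triangle_ineq[of "x + s *\<^sub>R \<xi>" z] R[OF that(1)] that(2) by simp
  have C: "0 \<le> C" using lip by (rule lipschitz_on_nonneg)
  have [measurable]: "D i \<in> borel_measurable borel" for i
    unfolding D_def by measurable
  have "(\<lambda>i. integral\<^sup>L \<mu> (D i)) \<longlonglongrightarrow> (\<integral>z. indicator (ball 0 \<rho>) z * d (x + t *\<^sub>R \<xi> + z) \<partial>\<mu>)"
  proof (rule integral_dominated_convergence)
    show "integrable \<mu> (\<lambda>z. indicator (ball 0 \<rho>) z * (C * norm \<xi>))"
      using emeasure_ball_finite by (intro integrable_mult_left integrable_real_indicator) auto
    show "AE z in \<mu>. norm (D i z) \<le> indicator (ball 0 \<rho>) z * (C * norm \<xi>)" for i
    proof -
      \<comment> \<open>The Lipschitz bound is available on the subspace only, and the measure is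
        concentrated there.\<close>
      have "AE z in \<mu>. z \<in> span B" by (rule AE_flat_measure_span[OF finite_B])
      then show ?thesis
      proof eventually_elim
        case (elim z)
        show ?case
        proof (cases "z \<in> ball 0 \<rho>")
          case True
          have "\<bar>q (x + s i *\<^sub>R \<xi> + z) - q (x + t *\<^sub>R \<xi> + z)\<bar>
              \<le> C * dist (x + s i *\<^sub>R \<xi> + z) (x + t *\<^sub>R \<xi> + z)"
            using lipschitz_onD[OF lip, of "x + s i *\<^sub>R \<xi> + z" "x + t *\<^sub>R \<xi> + z"]
              in_ball[OF _ True, of "s i"] in_ball[OF t True] s sp elim
            by (simp add: span_add dist_real_def del: mem_ball)
          also have "\<dots> = C * norm \<xi> * \<bar>s i - t\<bar>"
            by (simp add: dist_norm scaleR_diff_left[symmetric])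
          finally show ?thesis using s True by (auto simp: D_def abs_divide divide_le_eq)
        qed (simp add: D_def)
      qed
    qed
    have "AE z in \<mu>. x + t *\<^sub>R \<xi> + z \<in> ball 0 R \<longrightarrow>
        ((\<lambda>r. (q (x + t *\<^sub>R \<xi> + z + r *\<^sub>R \<xi>) - q (x + t *\<^sub>R \<xi> + z)) / r) \<longlongrightarrow> d (x + t *\<^sub>R \<xi> + z)) (at 0)"
      by (rule AE_translate[OF deriv sp])
    then show "AE z in \<mu>. (\<lambda>i. D i z) \<longlonglongrightarrow> indicator (ball 0 \<rho>) z * d (x + t *\<^sub>R \<xi> + z)"
    proof eventually_elim
      case (elim z)
      show ?case
      proof (cases "z \<in> ball 0 \<rho>")
        case True
        then have "((\<lambda>r. (q (x + t *\<^sub>R \<xi> + z + r *\<^sub>R \<xi>) - q (x + t *\<^sub>R \<xi> + z)) / r) \<longlongrightarrow> d (x + t *\<^sub>R \<xi> + z)) (at 0)"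
          using elim in_ball[OF t True] by simp
        moreover have "filterlim (\<lambda>i. s i - t) (at 0) sequentially"
          using lim s by (auto simp: filterlim_at tendsto_diff intro!: tendsto_eq_intros)
        ultimately have "(\<lambda>i. (q (x + t *\<^sub>R \<xi> + z + (s i - t) *\<^sub>R \<xi>) - q (x + t *\<^sub>R \<xi> + z)) / (s i - t))
            \<longlonglongrightarrow> d (x + t *\<^sub>R \<xi> + z)"
          by (rule filterlim_compose)
        moreover have "x + t *\<^sub>R \<xi> + z + (s i - t) *\<^sub>R \<xi> = x + s i *\<^sub>R \<xi> + z" for i
          by (simp add: algebra_simps)
        ultimately show ?thesis using True by (simp add: D_def)
      qed (simp add: D_def)
    qed
  qed measurable
  moreover have "integral\<^sup>L \<mu> (D i) = (average \<rho> q (x + s i *\<^sub>R \<xi>) - average \<rho> q (x + t *\<^sub>R \<xi>)) / (s i - t)" for i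
  proof -
    have "integral\<^sup>L \<mu> (D i) = (\<integral>z. (indicator (ball 0 \<rho>) z * q (x + s i *\<^sub>R \<xi> + z)
        - indicator (ball 0 \<rho>) z * q (x + t *\<^sub>R \<xi> + z)) / (s i - t) \<partial>\<mu>)"
      by (intro Bochner_Integration.integral_cong refl) (simp add: D_def algebra_simps)
    also have "\<dots> = (average \<rho> q (x + s i *\<^sub>R \<xi>) - average \<rho> q (x + t *\<^sub>R \<xi>)) / (s i - t)"
      unfolding average_def using bound
      by (subst integral_divide_zero, subst Bochner_Integration.integral_diff) (auto intro!: integrable_average)
    finally show ?thesis .
  qed
  ultimately show "((\<lambda>y. (average \<rho> q (x + y *\<^sub>R \<xi>) - average \<rho> q (x + t *\<^sub>R \<xi>)) / (y - t)) \<circ> s)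
      \<longlonglongrightarrow> average \<rho> d (x + t *\<^sub>R \<xi>)"
    by (simp add: o_def average_def)
qed

lemma average_approximates:
  fixes f :: "'e \<Rightarrow> real"
  assumes [measurable]: "f \<in> borel_measurable borel"
    and "\<And>y. \<bar>f y\<bar> \<le> K" and "\<And>z. z \<in> span B \<Longrightarrow> norm z < \<rho> \<Longrightarrow> \<bar>f (x + z) - f x\<bar> \<le> \<epsilon>"
  shows "\<bar>average \<rho> f x - measure \<mu> (ball 0 \<rho>) * f x\<bar> \<le> measure \<mu> (ball 0 \<rho>) * \<epsilon>"
proof -
  let ?i = "indicator (ball 0 \<rho>) :: 'e \<Rightarrow> real"
  have int: "integrable \<mu> ?i"
    using emeasure_ball_finite by (intro integrable_real_indicator) auto
  have "average \<rho> f x - measure \<mu> (ball 0 \<rho>) * f x = (\<integral>z. ?i z * f (x + z) - ?i z * f x \<partial>\<mu>)"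
    unfolding average_def using int
    by (subst Bochner_Integration.integral_diff) (auto intro!: integrable_average assms)
  moreover have "\<bar>\<integral>z. ?i z * f (x + z) - ?i z * f x \<partial>\<mu>\<bar> \<le> (\<integral>z. ?i z * \<epsilon> \<partial>\<mu>)"
  proof -
    have "norm (\<integral>z. ?i z * f (x + z) - ?i z * f x \<partial>\<mu>) \<le> (\<integral>z. norm (?i z * f (x + z) - ?i z * f x) \<partial>\<mu>)"
      by (rule integral_norm_bound)
    also have "\<dots> \<le> (\<integral>z. ?i z * \<epsilon> \<partial>\<mu>)"
    proof (rule integral_mono_AE)
      show "integrable \<mu> (\<lambda>z. norm (?i z * f (x + z) - ?i z * f x))"
        using int
        by (intro integrable_norm Bochner_Integration.integrable_diff integrable_average[OF assms(1,2)] integrable_mult_left) auto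
      show "integrable \<mu> (\<lambda>z. ?i z * \<epsilon>)" using int by simp
      have "AE z in \<mu>. z \<in> span B" by (rule AE_flat_measure_span[OF finite_B])
      then show "AE z in \<mu>. norm (?i z * f (x + z) - ?i z * f x) \<le> ?i z * \<epsilon>"
      proof eventually_elim
        case (elim z)
        then show ?case using assms(3)[of z] by (auto split: split_indicator)
      qed
    qed
    finally show ?thesis by simp
  qed
  ultimately show ?thesis using int by simp
qed

text \<open>The order of the limits matters. With the averaging radius fixed, the derivatives of the
  averages along the segment are bounded by the L1 norms of \<open>d k\<close>, so \<open>k\<close>
  tending to infinity equates the averages of \<open>f\<close> at both ends; only then does the
  radius shrink. The bound \<open>R / 2\<close> for the end points leaves room for averaging balls
  of radius below \<open>R / 2\<close>.\<close>

lemma constant_if_gradients_vanish: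
  fixes f :: "'e \<Rightarrow> real" and q d :: "nat \<Rightarrow> 'e \<Rightarrow> real" and C :: "nat \<Rightarrow> real"
  defines "S R \<equiv> span B \<inter> cball 0 R"
  assumes "0 < R" and cont: "continuous_on (S R) f"
    and lip: "\<And>k. (C k)-lipschitz_on (S R) (q k)"
    and [measurable]: "\<And>k. d k \<in> borel_measurable borel"
    and deriv: "\<And>k. AE y in \<mu>. y \<in> ball 0 R \<longrightarrow> ((\<lambda>t. (q k (y + t *\<^sub>R \<xi>) - q k y) / t) \<longlongrightarrow> d k y) (at 0)"
    and lim: "(\<lambda>k. \<integral>\<^sup>+z\<in>ball 0 R. ennreal ((q k z - f z)\<^sup>2) \<partial>\<mu>) \<longlonglongrightarrow> 0"
    and lim_d: "(\<lambda>k. \<integral>\<^sup>+z\<in>ball 0 R. ennreal ((d k z)\<^sup>2) \<partial>\<mu>) \<longlonglongrightarrow> 0"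
    and x: "x \<in> span B" "norm x < R / 2" and \<xi>: "\<xi> \<in> span B" "norm (x + \<xi>) < R / 2"
  shows "f (x + \<xi>) = f x"
proof -
  let ?S = "S R"
  have compact: "compact ?S" unfolding S_def by (intro closed_Int_compact) auto
  have [measurable]: "?S \<in> sets borel" using compact by (simp add: borel_compact)
  \<comment> \<open>Extension by zero produces bounded Borel functions on the whole space, as the
    averages require, and changes nothing on the part of the ball that carries the measure.\<close>
  define Q where "Q k y = indicator ?S y *\<^sub>R q k y" for k y
  define F where "F y = indicator ?S y *\<^sub>R f y" for y
  have contq: "continuous_on ?S (q k)" for k using lip by (rule lipschitz_on_continuous_on)
  have [measurable]: "Q k \<in> borel_measurable borel" "F \<in> borel_measurable borel" for k
    unfolding Q_def F_def by (intro borel_measurable_continuous_on_indicator contq cont; simp)+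
  have bounded: "\<exists>K. \<forall>y. \<bar>indicator ?S y *\<^sub>R g y\<bar> \<le> K" if "continuous_on ?S g" for g :: "'e \<Rightarrow> real"
  proof -
    have "bounded (g ` ?S)" using compact that by (intro compact_imp_bounded compact_continuous_image)
    then obtain K where "\<forall>y\<in>?S. \<bar>g y\<bar> \<le> K" by (auto simp: bounded_iff)
    then show ?thesis by (intro exI[of _ "max K 0"]) (auto split: split_indicator)
  qed
  obtain KF where KF: "\<And>y. \<bar>F y\<bar> \<le> KF" using bounded[OF cont] unfolding F_def by metis
  have "\<forall>k. \<exists>K. \<forall>y. \<bar>Q k y\<bar> \<le> K" using bounded[OF contq] unfolding Q_def by blast
  then obtain KQ where KQ: "\<And>k y. \<bar>Q k y\<bar> \<le> KQ k" by metis
  have AE_span: "AE y in \<mu>. y \<in> span B" by (rule AE_flat_measure_span[OF finite_B])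
  have lim': "(\<lambda>k. \<integral>\<^sup>+z\<in>ball 0 R. ennreal ((Q k z - F z)\<^sup>2) \<partial>\<mu>) \<longlonglongrightarrow> 0"
  proof -
    have "(\<integral>\<^sup>+z\<in>ball 0 R. ennreal ((Q k z - F z)\<^sup>2) \<partial>\<mu>)
        = (\<integral>\<^sup>+z\<in>ball 0 R. ennreal ((q k z - f z)\<^sup>2) \<partial>\<mu>)" for k
    proof (rule nn_integral_cong_AE)
      show "AE z in \<mu>. ennreal ((Q k z - F z)\<^sup>2) * indicator (ball 0 R) z
          = ennreal ((q k z - f z)\<^sup>2) * indicator (ball 0 R) z"
        using AE_span by eventually_elim (auto simp: Q_def F_def S_def split: split_indicator)
    qed
    then show ?thesis using lim by simp
  qed
  have ball: "ball 0 R \<in> sets \<mu>" by simp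
  have L1: "(\<lambda>k. \<integral>\<^sup>+z\<in>ball 0 R. ennreal \<bar>Q k z - F z\<bar> \<partial>\<mu>) \<longlonglongrightarrow> 0"
    by (rule Cauchy_Schwarz_set_tendsto_0[OF ball _ emeasure_ball_finite lim']) simp
  have L1d: "(\<lambda>k. \<integral>\<^sup>+z\<in>ball 0 R. ennreal \<bar>d k z\<bar> \<partial>\<mu>) \<longlonglongrightarrow> 0"
    by (rule Cauchy_Schwarz_set_tendsto_0[OF ball _ emeasure_ball_finite lim_d]) simp
  have lipQ: "(C k)-lipschitz_on (span B \<inter> ball 0 R) (Q k)" for k
  proof -
    have "(C k)-lipschitz_on (span B \<inter> ball 0 R) (q k)"
      by (rule lipschitz_on_subset[OF lip]) (auto simp: S_def)
    then show ?thesis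
      by (rule lipschitz_on_transform) (auto simp: Q_def S_def)
  qed
  \<comment> \<open>For small \<open>t\<close> the points \<open>y\<close> and
    \<open>y + t *\<^sub>R \<xi>\<close> both stay in \<open>?S\<close>, so the cutoff is invisible
    to the difference quotient.\<close>
  have derivQ: "AE y in \<mu>. y \<in> ball 0 R \<longrightarrow> ((\<lambda>t. (Q k (y + t *\<^sub>R \<xi>) - Q k y) / t) \<longlongrightarrow> d k y) (at 0)" for k
    using deriv[of k] AE_span
  proof eventually_elim
    case (elim y)
    show ?case
    proof
      assume y: "y \<in> ball 0 R"
      have "((\<lambda>t. y + t *\<^sub>R \<xi>) \<longlongrightarrow> y) (at 0)" by (auto intro!: tendsto_eq_intros)
      then have "\<forall>\<^sub>F t in at 0. y + t *\<^sub>R \<xi> \<in> ball 0 R"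
        using y by (intro topological_tendstoD) auto
      then have "\<forall>\<^sub>F t in at 0. (q k (y + t *\<^sub>R \<xi>) - q k y) / t = (Q k (y + t *\<^sub>R \<xi>) - Q k y) / t"
        by eventually_elim (use y elim \<xi> in \<open>auto simp: Q_def S_def span_add span_scale\<close>)
      then show "((\<lambda>t. (Q k (y + t *\<^sub>R \<xi>) - Q k y) / t) \<longlongrightarrow> d k y) (at 0)"
        using elim y by (auto intro: Lim_transform_eventually)
    qed
  qed
  have path: "norm (x + s *\<^sub>R \<xi>) \<le> R / 2" if "s \<in> {0..1}" for s
  proof -
    have "x + s *\<^sub>R \<xi> = (1 - s) *\<^sub>R x + s *\<^sub>R (x + \<xi>)" by (simp add: algebra_simps)
    moreover have "(1 - s) *\<^sub>R x + s *\<^sub>R (x + \<xi>) \<in> ball 0 (R / 2)"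
      using x \<xi> that by (intro convexD[OF convex_ball]) auto
    ultimately show ?thesis by simp
  qed
  have avg_eq: "average \<rho> F (x + \<xi>) = average \<rho> F x" if \<rho>: "0 < \<rho>" "\<rho> < R / 2" for \<rho>
  proof -
    let ?e = "\<lambda>k. \<integral>\<^sup>+z\<in>ball 0 R. ennreal \<bar>Q k z - F z\<bar> \<partial>\<mu>"
    let ?d = "\<lambda>k. \<integral>\<^sup>+z\<in>ball 0 R. ennreal \<bar>d k z\<bar> \<partial>\<mu>"
    \<comment> \<open>For finite \<open>?d k\<close> the passage through \<open>enn2real\<close>
      loses nothing, and the real mean value inequality applies.\<close>
    have fin: "\<forall>\<^sub>F k in sequentially. ?d k < \<infinity>"
      using L1d by (rule order_tendstoD) simp
    have "\<forall>\<^sub>F k in sequentially. ennreal \<bar>average \<rho> F (x + \<xi>) - average \<rho> F x\<bar> \<le> ?e k + ?d k + ?e k"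
      using fin
    proof eventually_elim
      case (elim k)
      have r: "norm (x + \<xi>) \<le> R - \<rho>" "norm x \<le> R - \<rho>" using x \<xi> \<rho> by auto
      have sp: "x + s *\<^sub>R \<xi> \<in> span B" for s using x \<xi> by (intro span_add span_scale)
      have bound: "\<bar>average \<rho> (d k) (x + s *\<^sub>R \<xi>)\<bar> \<le> enn2real (?d k)" if "s \<in> {0..1}" for s
      proof -
        have "ennreal \<bar>average \<rho> (d k) (x + s *\<^sub>R \<xi>)\<bar> \<le> ?d k"
          unfolding average_def using path[OF that] \<rho>
          by (intro order_trans[OF abs_integral_le_nn_integral] translated_ball_nn_integral_le sp) auto
        also have "?d k = ennreal (enn2real (?d k))" using elim by simp
        finally show ?thesis by (subst (asm) ennreal_le_iff) (rule enn2real_nonneg)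
      qed
      have "norm (average \<rho> (Q k) (x + 1 *\<^sub>R \<xi>) - average \<rho> (Q k) (x + 0 *\<^sub>R \<xi>)) \<le> enn2real (?d k) * norm (1 - 0 :: real)"
      proof (rule field_differentiable_bound[where f = "\<lambda>s. average \<rho> (Q k) (x + s *\<^sub>R \<xi>)" and S = "{0..1}"])
        show "((\<lambda>s. average \<rho> (Q k) (x + s *\<^sub>R \<xi>)) has_field_derivative average \<rho> (d k) (x + s *\<^sub>R \<xi>))
            (at s within {0..1})" if "s \<in> {0..1}" for s
          using path \<rho> by (intro average_has_derivative[OF _ _ KQ lipQ derivQ x(1) \<xi>(1) _ that]) fastforce+
      qed (use bound in auto)
      then have "\<bar>average \<rho> (Q k) (x + \<xi>) - average \<rho> (Q k) x\<bar> \<le> enn2real (?d k)" by simp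
      then have "ennreal \<bar>average \<rho> (Q k) (x + \<xi>) - average \<rho> (Q k) x\<bar> \<le> ?d k"
        using ennreal_leI[of _ "enn2real (?d k)"] elim by (simp only: ennreal_enn2real infinity_ennreal_def)
      moreover have "ennreal \<bar>average \<rho> (Q k) (x + \<xi>) - average \<rho> F (x + \<xi>)\<bar> \<le> ?e k"
        "ennreal \<bar>average \<rho> (Q k) x - average \<rho> F x\<bar> \<le> ?e k"
        using r x \<xi> by (intro abs_average_diff_le[OF _ _ KQ KF]; simp add: span_add)+
      moreover have "ennreal \<bar>average \<rho> F (x + \<xi>) - average \<rho> F x\<bar>
          \<le> ennreal \<bar>average \<rho> (Q k) (x + \<xi>) - average \<rho> F (x + \<xi>)\<bar>
            + ennreal \<bar>average \<rho> (Q k) (x + \<xi>) - average \<rho> (Q k) x\<bar>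
            + ennreal \<bar>average \<rho> (Q k) x - average \<rho> F x\<bar>"
        by (simp add: ennreal_plus[symmetric] del: ennreal_plus)
      ultimately show ?case by (meson add_mono order_trans)
    qed
    moreover have "(\<lambda>k. ?e k + ?d k + ?e k) \<longlonglongrightarrow> 0 + 0 + 0"
      by (intro tendsto_add L1 L1d)
    ultimately have "ennreal \<bar>average \<rho> F (x + \<xi>) - average \<rho> F x\<bar> \<le> 0"
      by (intro tendsto_lowerbound) auto
    then show ?thesis by simp
  qed
  have Fx: "F x = f x" "F (x + \<xi>) = f (x + \<xi>)"
    using x \<xi> \<open>0 < R\<close> by (auto simp: F_def S_def span_add indicator_def)
  have "\<bar>f (x + \<xi>) - f x\<bar> \<le> 2 * \<epsilon>" if "0 < \<epsilon>" for \<epsilon>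
  proof -
    have near: "\<exists>\<delta>>0. \<forall>z\<in>span B. norm z < \<delta> \<longrightarrow> \<bar>F (y + z) - F y\<bar> \<le> \<epsilon>"
      if y: "y \<in> span B" "norm y < R / 2" for y
    proof -
      have yS: "y \<in> ?S" using y \<open>0 < R\<close> by (auto simp: S_def)
      obtain \<delta> where \<delta>: "\<delta> > 0" "\<And>w. w \<in> ?S \<Longrightarrow> dist w y < \<delta> \<Longrightarrow> dist (f w) (f y) < \<epsilon>"
        using cont yS \<open>0 < \<epsilon>\<close> by (metis continuous_on_iff)
      have "\<bar>F (y + z) - F y\<bar> \<le> \<epsilon>" if z: "z \<in> span B" "norm z < min \<delta> (R / 2)" for z
      proof -
        have "y + z \<in> ?S" using y z norm_triangle_ineq[of y z] by (auto simp: S_def span_add)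
        then show ?thesis using \<delta>(2)[of "y + z"] yS z by (auto simp: F_def dist_real_def dist_norm)
      qed
      then show ?thesis using \<delta>(1) \<open>0 < R\<close> by (intro exI[of _ "min \<delta> (R / 2)"]) auto
    qed
    obtain \<delta>1 where \<delta>1: "\<delta>1 > 0" "\<forall>z\<in>span B. norm z < \<delta>1 \<longrightarrow> \<bar>F (x + z) - F x\<bar> \<le> \<epsilon>"
      using near[OF x] by blast
    obtain \<delta>2 where \<delta>2: "\<delta>2 > 0" "\<forall>z\<in>span B. norm z < \<delta>2 \<longrightarrow> \<bar>F (x + \<xi> + z) - F (x + \<xi>)\<bar> \<le> \<epsilon>"
      using near[of "x + \<xi>"] x \<xi> by (auto simp: span_add)
    \<comment> \<open>The first two bounds give closeness to \<open>F\<close> at both end points;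
      \<open>R / 4\<close> keeps the radius strictly below \<open>R / 2\<close>.\<close>
    define \<rho> where "\<rho> = min (min \<delta>1 \<delta>2) (R / 4)"
    have \<rho>: "0 < \<rho>" "\<rho> < R / 2" "\<rho> \<le> \<delta>1" "\<rho> \<le> \<delta>2" using \<delta>1 \<delta>2 \<open>0 < R\<close> by (auto simp: \<rho>_def)
    let ?m = "measure \<mu> (ball 0 \<rho>)"
    have "0 < ?m"
      using emeasure_flat_ball_pos[OF orthonormal span_0 \<rho>(1)] emeasure_ball_finite[of \<rho>]
      by (simp add: measure_def enn2real_positive_iff)
    have "\<bar>average \<rho> F x - ?m * F x\<bar> \<le> ?m * \<epsilon>"
      using \<delta>1 \<rho> by (intro average_approximates[OF _ KF]) auto
    moreover have "\<bar>average \<rho> F (x + \<xi>) - ?m * F (x + \<xi>)\<bar> \<le> ?m * \<epsilon>"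
      using \<delta>2 \<rho> by (intro average_approximates[OF _ KF]) auto
    ultimately have "\<bar>?m * F (x + \<xi>) - ?m * F x\<bar> \<le> ?m * (2 * \<epsilon>)"
      using avg_eq[OF \<rho>(1,2)] by linarith
    then have "?m * \<bar>F (x + \<xi>) - F x\<bar> \<le> ?m * (2 * \<epsilon>)"
      by (simp add: abs_mult right_diff_distrib[symmetric])
    then show ?thesis using \<open>0 < ?m\<close> by (simp add: Fx)
  qed
  \<comment> \<open>For this \<epsilon> the estimate says that the difference is at most half of
    itself.\<close>
  from this[of "\<bar>f (x + \<xi>) - f x\<bar> / 4"] show ?thesis
    by (cases "f (x + \<xi>) = f x") auto
qed

end

section \<open>Geometry of the triangulation\<close>

text \<open>The set summed over in \<open>barycentric_dist\<close> varies with the two points. A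
  common finite \<open>S\<close> makes several distances comparable, as in the triangle
  inequality.\<close>

lemma barycentric_dist_L2_set:
  assumes "finite S" "{v. \<alpha> v \<noteq> 0} \<union> {v. \<beta> v \<noteq> 0} \<subseteq> S"
  shows "barycentric_dist \<alpha> \<beta> = L2_set (\<lambda>v. \<alpha> v - \<beta> v) S"
  unfolding barycentric_dist_def L2_set_def
  using assms by (intro arg_cong[where f = sqrt] sum.mono_neutral_left) auto

lemma loc_lipschitz_compose:
  assumes h: "loc_lipschitz A d d' h" and k: "loc_lipschitz B d' d'' k" and "h ` A \<subseteq> B"
    and d': "\<And>x y. 0 \<le> d' x y" and d0: "\<And>x. x \<in> A \<Longrightarrow> d x x = 0"
    and d: "\<And>x y. 0 \<le> d x y"
  shows "loc_lipschitz A d d'' (k \<circ> h)"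
  unfolding loc_lipschitz_def
proof
  fix x assume x: "x \<in> A"
  obtain e C where e: "e > 0" "\<forall>y\<in>A. \<forall>z\<in>A. d x y < e \<and> d x z < e \<longrightarrow> d' (h y) (h z) \<le> C * d y z"
    using h x unfolding loc_lipschitz_def by blast
  have "h x \<in> B" using x assms(3) by auto
  then obtain e' C' where e': "e' > 0"
    "\<forall>y\<in>B. \<forall>z\<in>B. d' (h x) y < e' \<and> d' (h x) z < e' \<longrightarrow> d'' (k y) (k z) \<le> C' * d' y z"
    using k unfolding loc_lipschitz_def by blast
  \<comment> \<open>The second bound forces the image under \<open>h\<close> into the region where
    \<open>k\<close> is controlled. Using \<open>\<bar>C\<bar> + 1\<close> makes the divisor
    positive whatever the sign of \<open>C\<close>.\<close>
  let ?e = "min e (e' / (\<bar>C\<bar> + 1))"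
  have "d'' ((k \<circ> h) y) ((k \<circ> h) z) \<le> (\<bar>C'\<bar> * \<bar>C\<bar>) * d y z"
    if y: "y \<in> A" "d x y < ?e" and z: "z \<in> A" "d x z < ?e" for y z
  proof -
    have near: "d' (h x) (h w) < e'" if w: "w \<in> A" "d x w < ?e" for w
    proof -
      have "d' (h x) (h w) \<le> C * d x w" using e x w d0[OF x] by auto
      also have "\<dots> \<le> (\<bar>C\<bar> + 1) * d x w" using d by (intro mult_right_mono) auto
      also have "\<dots> < e'" using w by (simp add: field_simps)
      finally show ?thesis .
    qed
    have "d'' (k (h y)) (k (h z)) \<le> C' * d' (h y) (h z)"
      using e'(2) near[OF y] near[OF z] y z assms(3) by blast
    also have "\<dots> \<le> \<bar>C'\<bar> * d' (h y) (h z)" using d' by (intro mult_right_mono) auto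
    also have "\<dots> \<le> \<bar>C'\<bar> * (C * d y z)" using e y z by (intro mult_left_mono) auto
    also have "\<dots> \<le> \<bar>C'\<bar> * (\<bar>C\<bar> * d y z)" using d by (intro mult_left_mono mult_right_mono) auto
    finally show ?thesis by (simp add: mult.assoc)
  qed
  then show "\<exists>e>0. \<exists>C. \<forall>y\<in>A. \<forall>z\<in>A. d x y < e \<and> d x z < e \<longrightarrow> d'' ((k \<circ> h) y) ((k \<circ> h) z) \<le> C * d y z"
    using e(1) e'(1) by (intro exI[of _ ?e]) auto
qed

lemma loc_lipschitz_continuous_on:
  fixes h :: "'a::metric_space \<Rightarrow> 'b::metric_space"
  assumes "loc_lipschitz A dist dist h"
  shows "continuous_on A h"
  unfolding continuous_on_iff
proof (intro ballI allI impI)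
  fix x and \<epsilon> :: real assume x: "x \<in> A" and \<epsilon>: "0 < \<epsilon>"
  obtain e C where e: "e > 0" "\<forall>y\<in>A. \<forall>z\<in>A. dist x y < e \<and> dist x z < e \<longrightarrow> dist (h y) (h z) \<le> C * dist y z"
    using assms x unfolding loc_lipschitz_def by blast
  have "dist (h y) (h x) < \<epsilon>" if "y \<in> A" "dist y x < min e (\<epsilon> / (\<bar>C\<bar> + 1))" for y
  proof -
    have "dist (h y) (h x) \<le> C * dist y x" using e x that by (auto simp: dist_commute)
    also have "\<dots> \<le> (\<bar>C\<bar> + 1) * dist y x" by (intro mult_right_mono) auto
    also have "\<dots> < \<epsilon>" using that by (simp add: field_simps)
    finally show ?thesis .
  qed
  then show "\<exists>d>0. \<forall>x'\<in>A. dist x' x < d \<longrightarrow> dist (h x') (h x) < \<epsilon>"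
    using e(1) \<epsilon> by (intro exI[of _ "min e (\<epsilon> / (\<bar>C\<bar> + 1))"]) auto
qed

lemma barycentric_dist_nonneg: "0 \<le> barycentric_dist \<alpha> \<beta>"
  unfolding barycentric_dist_def by (simp add: sum_nonneg)

lemma barycentric_dist_self [simp]: "barycentric_dist \<alpha> \<alpha> = 0"
  unfolding barycentric_dist_def by simp

definition segment :: "('v \<Rightarrow> real) \<Rightarrow> ('v \<Rightarrow> real) \<Rightarrow> real \<Rightarrow> 'v \<Rightarrow> real" where
  "segment \<alpha> \<beta> t v = (1 - t) * \<alpha> v + t * \<beta> v"

lemma segment_0 [simp]: "segment \<alpha> \<beta> 0 = \<alpha>"
  and segment_1 [simp]: "segment \<alpha> \<beta> 1 = \<beta>"
  by (auto simp: segment_def fun_eq_iff)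

lemma barycentric_dist_segment:
  assumes "finite {v. \<alpha> v \<noteq> 0}" "finite {v. \<beta> v \<noteq> 0}"
  shows "barycentric_dist (segment \<alpha> \<beta> t) (segment \<alpha> \<beta> s) = \<bar>t - s\<bar> * barycentric_dist \<alpha> \<beta>"
proof -
  let ?S = "{v. \<alpha> v \<noteq> 0} \<union> {v. \<beta> v \<noteq> 0}"
  have "barycentric_dist (segment \<alpha> \<beta> t) (segment \<alpha> \<beta> s)
      = L2_set (\<lambda>v. segment \<alpha> \<beta> t v - segment \<alpha> \<beta> s v) ?S"
    using assms by (intro barycentric_dist_L2_set) (auto simp: segment_def)
  also have "\<dots> = L2_set (\<lambda>v. \<bar>t - s\<bar> * \<bar>\<alpha> v - \<beta> v\<bar>) ?S"
  proof -
    have "segment \<alpha> \<beta> t v - segment \<alpha> \<beta> s v = (s - t) * (\<alpha> v - \<beta> v)" for v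
      by (simp add: segment_def algebra_simps)
    then show ?thesis
      unfolding L2_set_def by (simp add: power_mult_distrib power2_commute[of s t])
  qed
  also have "\<dots> = \<bar>t - s\<bar> * L2_set (\<lambda>v. \<bar>\<alpha> v - \<beta> v\<bar>) ?S"
    by (simp add: L2_set_right_distrib)
  also have "L2_set (\<lambda>v. \<bar>\<alpha> v - \<beta> v\<bar>) ?S = barycentric_dist \<alpha> \<beta>"
    using assms by (subst barycentric_dist_L2_set[of ?S]) (auto simp: L2_set_def)
  finally show ?thesis .
qed

lemma open_if_eventually:
  assumes "\<And>x. x \<in> S \<Longrightarrow> \<forall>\<^sub>F y in nhds x. y \<in> S"
  shows "open S"
proof (subst open_subopen, intro ballI)
  fix x assume "x \<in> S"
  then show "\<exists>T. open T \<and> x \<in> T \<and> T \<subseteq> S" using assms[of x] unfolding eventually_nhds by blast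
qed

lemma finite_union_rel_compact_domain:
  assumes "finite \<F>" "\<And>U. U \<in> \<F> \<Longrightarrow> rel_compact_domain U \<and> a \<in> U" "rel_compact_domain V" "a \<in> V"
  shows "rel_compact_domain (V \<union> \<Union>\<F>)"
proof -
  have "connected (\<Union>(insert V \<F>))"
    using assms by (intro connected_Union) (auto simp: rel_compact_domain_def)
  moreover have "compact (closure (V \<union> \<Union>\<F>))"
  proof -
    let ?Z = "closure V \<union> (\<Union>U\<in>\<F>. closure U)"
    have Z: "compact ?Z" using assms by (intro compact_Un compact_UN) (auto simp: rel_compact_domain_def)
    have "V \<union> \<Union>\<F> \<subseteq> ?Z" by (auto intro: closure_subset[THEN subsetD])
    then have "closure (V \<union> \<Union>\<F>) \<subseteq> ?Z" using Z by (intro closure_minimal compact_imp_closed)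
    then have "?Z \<inter> closure (V \<union> \<Union>\<F>) = closure (V \<union> \<Union>\<F>)" by (rule inf.absorb2)
    then show ?thesis using compact_Int_closed[OF Z closed_closure, of "V \<union> \<Union>\<F>"] by (rule subst)
  qed
  ultimately show ?thesis
    using assms by (auto simp: rel_compact_domain_def)
qed

section \<open>Barycentric coordinates and position in Euclidean space\<close>

locale riemannian_complex =
  fixes P :: "('v, 'e::euclidean_space, 'x::metric_space) polyhedron_data"
  assumes riemannian: "riemannian_polyhedron P"
begin

abbreviation "K \<equiv> complex P"
abbreviation "R \<equiv> realisation K"
abbreviation "\<iota> \<equiv> affine_extension (vertex P)"

lemma triangulation: "polyhedron_triangulation P" and embedding: "euclidean_embedding P"
  using riemannian by (auto simp: riemannian_polyhedron_def)

lemma complexD: "s \<in> K \<Longrightarrow> finite s" "s \<in> K \<Longrightarrow> s \<noteq> {}" "s \<in> K \<Longrightarrow> t \<subseteq> s \<Longrightarrow> t \<noteq> {} \<Longrightarrow> t \<in> K"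
  using triangulation unfolding polyhedron_triangulation_def abstract_complex_def by blast+

lemma max_simplexesD: "s \<in> max_simplexes P \<Longrightarrow> s \<in> K" "s \<in> max_simplexes P \<Longrightarrow> t \<in> K \<Longrightarrow> s \<subseteq> t \<Longrightarrow> t = s"
  by (auto simp: maximal_simplexes_def)

lemma countable_max_simplexes: "countable (max_simplexes P)"
  using triangulation countable_subset[of "max_simplexes P" K]
  by (auto simp: polyhedron_triangulation_def maximal_simplexes_def)

lemma triang_bij: "bij_betw (triang P) R UNIV"
  and triang_lipschitz: "loc_lipschitz R barycentric_dist dist (triang P)"
  and bary_lipschitz: "loc_lipschitz UNIV dist barycentric_dist (bary P)"
  using triangulation by (auto simp: polyhedron_triangulation_def lipschitz_homeo_def bary_def)

lemma embedding_closed: "closed (\<iota> ` R)"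
  and embedding_inj: "inj_on \<iota> R"
  and embedding_lipschitz: "loc_lipschitz R barycentric_dist dist \<iota>"
  and embedding_inv_lipschitz: "loc_lipschitz (\<iota> ` R) dist barycentric_dist (inv_into R \<iota>)"
  using embedding by (auto simp: euclidean_embedding_def lipschitz_homeo_def Let_def bij_betw_def)

lemma bary_in_R [simp]: "bary P x \<in> R"
  using triang_bij unfolding bary_def bij_betw_def by (metis UNIV_I inv_into_into)

lemma triang_bary [simp]: "triang P (bary P x) = x"
  using triang_bij unfolding bary_def bij_betw_def by (metis UNIV_I f_inv_into_f)

lemma bary_triang [simp]: "\<alpha> \<in> R \<Longrightarrow> bary P (triang P \<alpha>) = \<alpha>"
  using triang_bij unfolding bary_def bij_betw_def by (simp add: inv_into_f_f)

lemma R_D: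
  assumes "\<alpha> \<in> R"
  shows "{v. \<alpha> v \<noteq> 0} \<in> K" "finite {v. \<alpha> v \<noteq> 0}" "0 \<le> \<alpha> v"
    and "finite S \<Longrightarrow> {v. \<alpha> v \<noteq> 0} \<subseteq> S \<Longrightarrow> sum \<alpha> S = 1"
    and "finite S \<Longrightarrow> {v. \<alpha> v \<noteq> 0} \<subseteq> S \<Longrightarrow> \<iota> \<alpha> = (\<Sum>v\<in>S. \<alpha> v *\<^sub>R vertex P v)"
proof -
  show K: "{v. \<alpha> v \<noteq> 0} \<in> K" and "0 \<le> \<alpha> v" using assms by (auto simp: realisation_def)
  then show "finite {v. \<alpha> v \<noteq> 0}" using complexD by blast
  show "sum \<alpha> S = 1" if "finite S" "{v. \<alpha> v \<noteq> 0} \<subseteq> S"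
  proof -
    have "sum \<alpha> {v. \<alpha> v \<noteq> 0} = sum \<alpha> S" using that by (intro sum.mono_neutral_left) auto
    then show ?thesis using assms by (simp add: realisation_def)
  qed
  show "\<iota> \<alpha> = (\<Sum>v\<in>S. \<alpha> v *\<^sub>R vertex P v)" if "finite S" "{v. \<alpha> v \<noteq> 0} \<subseteq> S"
    unfolding affine_extension_def using that by (intro sum.mono_neutral_left) auto
qed

lemma R_I:
  assumes "s \<in> K" "\<And>v. 0 \<le> \<alpha> v" "\<And>v. v \<notin> s \<Longrightarrow> \<alpha> v = 0" "sum \<alpha> s = 1"
  shows "\<alpha> \<in> R"
proof -
  have sub: "{v. \<alpha> v \<noteq> 0} \<subseteq> s" using assms by auto
  have "sum \<alpha> {v. \<alpha> v \<noteq> 0} = sum \<alpha> s"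
    using sub complexD(1)[OF assms(1)] by (intro sum.mono_neutral_left) auto
  then have one: "sum \<alpha> {v. \<alpha> v \<noteq> 0} = 1" using assms by simp
  then have "{v. \<alpha> v \<noteq> 0} \<noteq> {}" by (intro notI) simp
  then show ?thesis using one complexD(3)[OF assms(1) sub] assms by (auto simp: realisation_def)
qed

text \<open>The common simplex \<open>s\<close> is what keeps the combination in the realisation;
  segments between points of unrelated simplexes may leave it.\<close>

lemma segment_in_R:
  assumes "\<alpha> \<in> R" "\<beta> \<in> R" "{v. \<alpha> v \<noteq> 0} \<subseteq> s" "{v. \<beta> v \<noteq> 0} \<subseteq> s" "s \<in> K" "t \<in> {0..1}"
  shows "segment \<alpha> \<beta> t \<in> R"
proof (rule R_I[OF assms(5)])
  show "0 \<le> segment \<alpha> \<beta> t v" for v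
    using assms R_D(3)[OF assms(1), of v] R_D(3)[OF assms(2), of v] by (auto simp: segment_def)
  show "segment \<alpha> \<beta> t v = 0" if "v \<notin> s" for v
  proof -
    have "\<alpha> v = 0" "\<beta> v = 0" using assms(3,4) that by auto
    then show ?thesis by (simp add: segment_def)
  qed
  have "sum \<alpha> s = 1" "sum \<beta> s = 1" using R_D(4) assms complexD by auto
  then show "sum (segment \<alpha> \<beta> t) s = 1"
    by (simp add: segment_def sum.distrib sum_distrib_left[symmetric])
qed

lemma continuous_on_triang_segment:
  assumes "\<alpha> \<in> R" "\<beta> \<in> R" "\<And>t. t \<in> {0..1} \<Longrightarrow> segment \<alpha> \<beta> t \<in> R"
  shows "continuous_on {0..1} (\<lambda>t. triang P (segment \<alpha> \<beta> t))"
proof -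
  have "loc_lipschitz {0..1} dist barycentric_dist (segment \<alpha> \<beta>)"
    unfolding loc_lipschitz_def
    using barycentric_dist_segment[OF R_D(2)[OF assms(1)] R_D(2)[OF assms(2)]]
    by (intro ballI exI[of _ 1] conjI exI[of _ "barycentric_dist \<alpha> \<beta>"]) (auto simp: dist_real_def mult.commute)
  then have "loc_lipschitz {0..1} dist dist (triang P \<circ> segment \<alpha> \<beta>)"
    by (rule loc_lipschitz_compose[OF _ triang_lipschitz]) (auto simp: assms barycentric_dist_nonneg)
  then show ?thesis using loc_lipschitz_continuous_on by (fastforce simp: o_def)
qed

lemma pos_lipschitz: "loc_lipschitz UNIV dist dist (pos P)"
proof -
  have "pos P = \<iota> \<circ> bary P" by (auto simp: pos_def)
  then show ?thesis
    using loc_lipschitz_compose[OF bary_lipschitz embedding_lipschitz] by (simp add: barycentric_dist_nonneg image_subset_iff)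
qed

lemma continuous_pos: "continuous_on UNIV (pos P)"
  using pos_lipschitz by (rule loc_lipschitz_continuous_on)

lemma inj_pos: "inj (pos P)"
  by (metis (no_types, opaque_lifting) injI bary_in_R embedding_inj inj_onD pos_def triang_bary)

lemma pt_pos [simp]: "pt P (pos P x) = x"
  using inj_pos by (simp add: pt_def)

lemma range_pos: "range (pos P) = \<iota> ` R"
proof
  show "range (pos P) \<subseteq> \<iota> ` R" by (auto simp: pos_def)
  show "\<iota> ` R \<subseteq> range (pos P)"
  proof
    fix y assume "y \<in> \<iota> ` R"
    then obtain \<alpha> where "\<alpha> \<in> R" "y = \<iota> \<alpha>" by auto
    then show "y \<in> range (pos P)" by (intro range_eqI[of _ _ "triang P \<alpha>"]) (simp add: pos_def)
  qed
qed

lemma closed_range_pos: "closed (range (pos P))"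
  using embedding_closed range_pos by simp

text \<open>On the range of \<open>pos\<close> the map \<open>pt\<close> factors through the
  realisation, and both factors are locally Lipschitz.\<close>

lemma pt_lipschitz: "loc_lipschitz (range (pos P)) dist dist (pt P)"
proof -
  have "loc_lipschitz (range (pos P)) dist dist (triang P \<circ> inv_into R \<iota>)"
    using loc_lipschitz_compose[OF embedding_inv_lipschitz triang_lipschitz]
    by (simp add: range_pos barycentric_dist_nonneg image_subset_iff inv_into_into)
  moreover have "(triang P \<circ> inv_into R \<iota>) y = pt P y" if "y \<in> range (pos P)" for y
    using that embedding_inj by (auto simp: pos_def inv_into_f_f simp flip: pt_pos[unfolded pos_def])
  ultimately show ?thesis unfolding loc_lipschitz_def by simp
qed

lemma continuous_pt: "continuous_on (range (pos P)) (pt P)"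
  using pt_lipschitz by (rule loc_lipschitz_continuous_on)

lemma carrier_in_K [simp]: "carrier_simplex P x \<in> K"
  unfolding carrier_simplex_def by (rule R_D(1)) simp

lemma carrier_finite [simp]: "finite (carrier_simplex P x)"
  using complexD(1) by simp

lemma bary_pos_iff: "v \<in> carrier_simplex P x \<longleftrightarrow> 0 < bary P x v"
  using R_D(3)[OF bary_in_R[of x], of v] by (auto simp: carrier_simplex_def)

lemma barycentric_triangle:
  assumes "\<alpha> \<in> R" "\<beta> \<in> R" "\<gamma> \<in> R"
  shows "barycentric_dist \<alpha> \<gamma> \<le> barycentric_dist \<alpha> \<beta> + barycentric_dist \<beta> \<gamma>"
proof -
  let ?S = "{v. \<alpha> v \<noteq> 0} \<union> {v. \<beta> v \<noteq> 0} \<union> {v. \<gamma> v \<noteq> 0}"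
  have "finite ?S" using assms R_D(2) by simp
  then show ?thesis
    using L2_set_triangle_ineq[of "\<lambda>v. \<alpha> v - \<beta> v" "\<lambda>v. \<beta> v - \<gamma> v" ?S]
    by (subst (1 2 3) barycentric_dist_L2_set[of ?S]) auto
qed

lemma bary_coordinate_le:
  assumes "\<alpha> \<in> R" "\<beta> \<in> R"
  shows "\<bar>\<alpha> v - \<beta> v\<bar> \<le> barycentric_dist \<alpha> \<beta>"
proof -
  let ?S = "insert v ({v. \<alpha> v \<noteq> 0} \<union> {v. \<beta> v \<noteq> 0})"
  have fin: "finite ?S" using assms R_D(2) by simp
  then have "\<bar>\<alpha> v - \<beta> v\<bar> \<le> L2_set (\<lambda>v. \<bar>\<alpha> v - \<beta> v\<bar>) ?S"
    by (intro member_le_L2_set) auto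
  then show ?thesis using fin by (subst barycentric_dist_L2_set[of ?S]) (auto simp: L2_set_def)
qed

section \<open>Stars, cells and local constancy\<close>

lemma bary_near:
  assumes "0 < r"
  shows "\<forall>\<^sub>F y in nhds x. barycentric_dist (bary P x) (bary P y) < r"
proof -
  obtain e C where e: "e > 0"
    "\<forall>y z. dist x y < e \<and> dist x z < e \<longrightarrow> barycentric_dist (bary P y) (bary P z) \<le> C * dist y z"
    using bary_lipschitz unfolding loc_lipschitz_def by blast
  have "barycentric_dist (bary P x) (bary P y) < r" if "dist y x < min e (r / (\<bar>C\<bar> + 1))" for y
  proof -
    have "barycentric_dist (bary P x) (bary P y) \<le> C * dist x y" using e that by (auto simp: dist_commute)
    also have "\<dots> \<le> (\<bar>C\<bar> + 1) * dist x y" by (intro mult_right_mono) auto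
    also have "\<dots> < r" using that by (simp add: field_simps dist_commute)
    finally show ?thesis .
  qed
  then show ?thesis
    using e(1) assms unfolding eventually_nhds_metric by (intro exI[of _ "min e (r / (\<bar>C\<bar> + 1))"]) auto
qed

text \<open>The finitely many positive coordinates of \<open>x\<close> stay positive nearby, so a
  neighbourhood of \<open>x\<close> lies in its open star.\<close>

lemma star_near: "\<forall>\<^sub>F y in nhds x. carrier_simplex P x \<subseteq> carrier_simplex P y"
proof -
  have "\<forall>\<^sub>F y in nhds x. v \<in> carrier_simplex P y" if "v \<in> carrier_simplex P x" for v
  proof -
    have "0 < bary P x v" using that by (simp add: bary_pos_iff)
    from bary_near[OF this, of x] show ?thesis
    proof eventually_elim
      case (elim y)
      then show ?case
        using bary_coordinate_le[OF bary_in_R[of x] bary_in_R[of y], of v] unfolding bary_pos_iff by linarith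
    qed
  qed
  then have "\<forall>\<^sub>F y in nhds x. \<forall>v\<in>carrier_simplex P x. v \<in> carrier_simplex P y"
    by (intro eventually_ball_finite) auto
  then show ?thesis by eventually_elim auto
qed

text \<open>A nearby point has a carrier containing \<open>s\<close>, and maximality of
  \<open>s\<close> forces equality.\<close>

lemma open_cell_open:
  assumes "s \<in> max_simplexes P"
  shows "open (open_cell P s)"
proof -
  have "\<forall>\<^sub>F y in nhds x. y \<in> open_cell P s" if "x \<in> open_cell P s" for x
    using star_near[of x] by eventually_elim
      (use that assms max_simplexesD carrier_in_K in \<open>auto simp: open_cell_def\<close>)
  then show ?thesis by (rule open_if_eventually)
qed

text \<open>Finite dimension bounds the cardinalities, so among the simplexes containing the carrier
  there is one of greatest cardinality; it is maximal.\<close>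

lemma carrier_in_max_simplex: "\<exists>s\<in>max_simplexes P. carrier_simplex P x \<subseteq> s"
proof -
  obtain n where n: "\<forall>s\<in>K. card s \<le> n + 1"
    using triangulation by (auto simp: polyhedron_triangulation_def finite_dim_complex_def)
  let ?A = "{s\<in>K. carrier_simplex P x \<subseteq> s}"
  have "\<exists>s. s \<in> ?A \<and> (\<forall>t. t \<in> ?A \<longrightarrow> card t \<le> card s)"
    by (rule ex_has_greatest_nat[of _ "carrier_simplex P x" card "n + 2"]) (use n in auto)
  then obtain s where s: "s \<in> ?A" "\<And>t. t \<in> ?A \<Longrightarrow> card t \<le> card s" by blast
  have "t = s" if "t \<in> K" "s \<subseteq> t" for t
    using s(1) s(2)[of t] that complexD(1)[OF that(1)] card_seteq[of t s] by auto
  then show ?thesis using s by (intro bexI[of _ s]) (auto simp: maximal_simplexes_def)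
qed

text \<open>Every point of the closed cell is joined to the barycentre \<beta> by a segment that
  lies in the open cell for all positive parameters. Connectedness of \<open>{0<..1}\<close> makes
  \<open>f\<close> constant there, and continuity includes the parameter 0.\<close>

lemma locally_constant_imp_constant_on_closed_cell:
  fixes f :: "'x \<Rightarrow> real"
  assumes s: "s \<in> max_simplexes P" and cont: "continuous_on UNIV f"
    and loc: "\<And>x. x \<in> open_cell P s \<Longrightarrow> \<forall>\<^sub>F y in nhds x. f y = f x"
  shows "\<exists>c. \<forall>x\<in>closed_cell P s. f x = c"
proof -
  have sK: "s \<in> K" "finite s" "s \<noteq> {}" using s max_simplexesD complexD by blast+
  define \<beta> where "\<beta> v = (if v \<in> s then 1 / real (card s) else 0)" for v
  have supp: "{v. \<beta> v \<noteq> 0} = s" using sK by (auto simp: \<beta>_def)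
  have \<beta>: "\<beta> \<in> R" using sK by (intro R_I[of s]) (auto simp: \<beta>_def)
  have "f x = f (triang P \<beta>)" if x: "x \<in> closed_cell P s" for x
  proof -
    let ?\<alpha> = "bary P x"
    have sub: "{v. ?\<alpha> v \<noteq> 0} \<subseteq> s" using x by (simp add: closed_cell_def carrier_simplex_def)
    have seg: "segment ?\<alpha> \<beta> t \<in> R" if "t \<in> {0..1}" for t
      using segment_in_R[OF bary_in_R \<beta> sub _ sK(1) that] supp by simp
    define c where "c t = triang P (segment ?\<alpha> \<beta> t)" for t
    have cc: "continuous_on {0..1} c"
      unfolding c_def by (intro continuous_on_triang_segment bary_in_R \<beta> seg)
    then have cf: "continuous_on {0..1} (\<lambda>t. f (c t))"
      by (intro continuous_on_compose2[OF cont]) auto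
    have cell: "c t \<in> open_cell P s" if "t \<in> {0<..1}" for t
    proof -
      have "{v. segment ?\<alpha> \<beta> t v \<noteq> 0} = s"
      proof
        show "{v. segment ?\<alpha> \<beta> t v \<noteq> 0} \<subseteq> s" using sub supp by (auto simp: segment_def)
        have "segment ?\<alpha> \<beta> t v > 0" if v: "v \<in> s" for v
        proof -
          have "0 < \<beta> v" using v sK by (simp add: \<beta>_def card_gt_0_iff)
          then show ?thesis
            using \<open>t \<in> _\<close> R_D(3)[OF bary_in_R[of x], of v] by (simp add: segment_def add_nonneg_pos)
        qed
        then show "s \<subseteq> {v. segment ?\<alpha> \<beta> t v \<noteq> 0}" by force
      qed
      then show ?thesis using seg that by (simp add: c_def open_cell_def carrier_simplex_def)
    qed
    have const: "f (c t) = f (c 1)" if t: "t \<in> {0<..1}" for t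
    proof (rule connected_local_const[of "{0<..1}" _ _ "\<lambda>t. f (c t)"])
      show "\<forall>a\<in>{0<..1}. \<forall>\<^sub>F b in at a within {0<..1}. f (c a) = f (c b)"
      proof
        fix a :: real assume a: "a \<in> {0<..1}"
        have "(c \<longlongrightarrow> c a) (at a within {0..1})"
          using cc a by (auto simp: continuous_on_def)
        then have "(c \<longlongrightarrow> c a) (at a within {0<..1})"
          by (rule tendsto_within_subset) auto
        with loc[OF cell[OF a]] have "\<forall>\<^sub>F b in at a within {0<..1}. f (c b) = f (c a)"
          by (rule eventually_compose_filterlim)
        then show "\<forall>\<^sub>F b in at a within {0<..1}. f (c a) = f (c b)"
          by eventually_elim simp
      qed
    qed (use t in auto)
    have "f (c 0) = f (c 1)"
    proof (rule continuous_constant_on_closure[of "{0<..1}" "\<lambda>t. f (c t)"])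
      show "continuous_on (closure {0<..1::real}) (\<lambda>t. f (c t))" using cf by simp
      show "f (c t) = f (c 1)" if "t \<in> {0<..1}" for t using const[OF that] .
    qed simp
    then show ?thesis by (simp add: c_def)
  qed
  then show ?thesis by blast
qed

lemma constant_if_locally_constant_on_open_cells:
  fixes f :: "'x \<Rightarrow> real"
  assumes cont: "continuous_on UNIV f"
    and loc: "\<And>s x. s \<in> max_simplexes P \<Longrightarrow> x \<in> open_cell P s \<Longrightarrow> \<forall>\<^sub>F y in nhds x. f y = f x"
  shows "f constant_on UNIV"
proof -
  have conn: "connected (UNIV :: 'x set)"
    using triangulation by (auto simp: polyhedron_triangulation_def)
  have "f x = f y" for x y
  proof (rule connected_local_const[OF conn])
    show "\<forall>a\<in>UNIV. \<forall>\<^sub>F b in at a within UNIV. f a = f b"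
    proof
      fix a
      have "\<forall>\<^sub>F b in nhds a. f a = f b"
        using star_near[of a]
      proof eventually_elim
        case (elim b)
        obtain s where s: "s \<in> max_simplexes P" "carrier_simplex P b \<subseteq> s"
          using carrier_in_max_simplex by blast
        then show ?case
          using locally_constant_imp_constant_on_closed_cell[OF s(1) cont loc[OF s(1)]] elim
          by (fastforce simp: closed_cell_def)
      qed
      then show "\<forall>\<^sub>F b in at a within UNIV. f a = f b"
        by (simp add: eventually_at_filter eventually_mono)
    qed
  qed auto
  then show ?thesis by (auto simp: constant_on_def)
qed

text \<open>A small metric ball of \<open>'x\<close> might be disconnected. A small ball for the
  barycentric distance is star-shaped around \<open>x\<close> instead: each of its points shares a
  closed simplex with \<open>x\<close>, and the segment to it stays in the ball.\<close>

lemma rel_compact_domain_near: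
  fixes x :: 'x
  shows "\<exists>U. rel_compact_domain U \<and> x \<in> U"
proof -
  have "locally compact (UNIV :: 'x set)"
    using triangulation by (auto simp: polyhedron_triangulation_def)
  from this[unfolded locally_def, THEN spec, of UNIV, THEN spec, of x]
  obtain u v where uv: "open u" "compact v" "x \<in> u" "u \<subseteq> v"
    by (auto simp: open_openin[symmetric])
  obtain e C where e: "e > 0" "\<forall>\<alpha>\<in>R. \<forall>\<beta>\<in>R. barycentric_dist (bary P x) \<alpha> < e \<and> barycentric_dist (bary P x) \<beta> < e
      \<longrightarrow> dist (triang P \<alpha>) (triang P \<beta>) \<le> C * barycentric_dist \<alpha> \<beta>"
    using triang_lipschitz bary_in_R[of x] unfolding loc_lipschitz_def by blast
  obtain d where d: "d > 0" "ball x d \<subseteq> u" using uv by (meson openE)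
  let ?c = "carrier_simplex P x"
  \<comment> \<open>A point at barycentric distance less than \<open>m\<close> still has every
    vertex of the carrier of \<open>x\<close> in its own carrier, so the joining segment
    exists.\<close>
  define m where "m = Min (bary P x ` ?c)"
  have "?c \<noteq> {}" using complexD carrier_in_K by blast
  then have m: "0 < m" "\<And>v. v \<in> ?c \<Longrightarrow> m \<le> bary P x v"
    by (auto simp: m_def bary_pos_iff)
  \<comment> \<open>The bounds by \<open>e\<close> and by \<open>d / (\<bar>C\<bar> + 1)\<close>
    place the barycentric ball inside the compact neighbourhood \<open>v\<close>.\<close>
  define r where "r = min m (min e (d / (\<bar>C\<bar> + 1)))"
  have r: "0 < r" "r \<le> m" "r \<le> e" "r \<le> d / (\<bar>C\<bar> + 1)" using m e d by (auto simp: r_def)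
  define U where "U = {y. barycentric_dist (bary P x) (bary P y) < r}"
  have xU: "x \<in> U" using r by (simp add: U_def)
  have "U \<subseteq> v"
  proof
    fix y assume y: "y \<in> U"
    have "dist x y \<le> C * barycentric_dist (bary P x) (bary P y)"
      using e(2)[rule_format, of "bary P x" "bary P y"] e(1) y r by (simp add: U_def)
    also have "\<dots> \<le> (\<bar>C\<bar> + 1) * barycentric_dist (bary P x) (bary P y)"
      by (intro mult_right_mono barycentric_dist_nonneg) auto
    also have "\<dots> < (\<bar>C\<bar> + 1) * r" using y by (intro mult_strict_left_mono) (auto simp: U_def)
    also have "\<dots> \<le> d" using r(4) by (simp add: pos_le_divide_eq mult.commute add_pos_nonneg)
    finally show "y \<in> v" using d uv by auto
  qed
  then have "closure U \<subseteq> v" using uv by (intro closure_minimal compact_imp_closed) auto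
  then have cpt: "compact (closure U)" using uv compact_Int_closed[of v "closure U"] by (simp add: inf.absorb2)
  have "open U"
  proof -
    have "\<forall>\<^sub>F z in nhds y. z \<in> U" if "y \<in> U" for y
    proof -
      have "0 < r - barycentric_dist (bary P x) (bary P y)" using that by (simp add: U_def)
      from bary_near[OF this, of y] show ?thesis
      proof eventually_elim
        case (elim z)
        then show ?case
          using barycentric_triangle[OF bary_in_R[of x] bary_in_R[of y] bary_in_R[of z]] by (simp add: U_def)
      qed
    qed
    then show ?thesis by (rule open_if_eventually)
  qed
  moreover have "connected U"
  proof -
    have "\<exists>T. connected T \<and> T \<subseteq> U \<and> x \<in> T \<and> y \<in> T" if y: "y \<in> U" for y
    proof -
      let ?c = "\<lambda>t. triang P (segment (bary P x) (bary P y) t)"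
      have sub: "carrier_simplex P x \<subseteq> carrier_simplex P y"
      proof
        fix v assume "v \<in> carrier_simplex P x"
        then have "m \<le> bary P x v" by (rule m)
        then show "v \<in> carrier_simplex P y"
          using bary_coordinate_le[OF bary_in_R[of x] bary_in_R[of y], of v] y r
          unfolding bary_pos_iff U_def by simp
      qed
      have seg: "segment (bary P x) (bary P y) t \<in> R" if "t \<in> {0..1}" for t
        using segment_in_R[OF bary_in_R bary_in_R _ _ carrier_in_K that, of x y y] sub
        by (simp add: carrier_simplex_def)
      have "continuous_on {0..1} ?c" by (intro continuous_on_triang_segment bary_in_R seg)
      then have "connected (?c ` {0..1})" by (intro connected_continuous_image) auto
      moreover have "?c ` {0..1} \<subseteq> U"
      proof safe
        fix t :: real assume t: "t \<in> {0..1}"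
        have "barycentric_dist (segment (bary P x) (bary P y) 0) (segment (bary P x) (bary P y) t)
            = \<bar>0 - t\<bar> * barycentric_dist (bary P x) (bary P y)"
          by (intro barycentric_dist_segment R_D(2) bary_in_R)
        also have "\<dots> \<le> 1 * barycentric_dist (bary P x) (bary P y)"
          using t by (intro mult_right_mono barycentric_dist_nonneg) auto
        also have "\<dots> < r" using y by (simp add: U_def)
        finally show "?c t \<in> U" using seg[OF t] by (simp add: U_def)
      qed
      moreover have "x \<in> ?c ` {0..1}" "y \<in> ?c ` {0..1}"
        using imageI[of 0 "{0..1}" ?c] imageI[of 1 "{0..1}" ?c] by auto
      ultimately show ?thesis by blast
    qed
    then obtain T where T: "\<And>y. y \<in> U \<Longrightarrow> connected (T y) \<and> T y \<subseteq> U \<and> x \<in> T y \<and> y \<in> T y" by metis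
    then have "U = \<Union>(T ` U)" by auto
    moreover have "connected (\<Union>(T ` U))" using T by (intro connected_Union) auto
    ultimately show ?thesis by simp
  qed
  ultimately show ?thesis using cpt xU by (auto simp: rel_compact_domain_def)
qed

text \<open>Lying in a common relatively compact domain is an equivalence relation with open
  classes, so by connectedness any two points are related. Thus \<open>D\<close> is covered by
  finitely many such domains through one point \<open>a\<close>, whose union is again
  connected.\<close>

lemma rel_compact_domain_covering_compact:
  fixes D :: "'x set"
  assumes "compact D"
  shows "\<exists>U. rel_compact_domain U \<and> D \<subseteq> U"
proof -
  have conn: "connected (UNIV :: 'x set)"
    using triangulation by (auto simp: polyhedron_triangulation_def)
  have joint: "\<exists>U. rel_compact_domain U \<and> a \<in> U \<and> b \<in> U" for a b :: 'x
  proof (rule connected_equivalence_relation[OF conn])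
    show "\<exists>U. rel_compact_domain U \<and> x \<in> U \<and> z \<in> U"
      if "\<exists>U. rel_compact_domain U \<and> x \<in> U \<and> y \<in> U" "\<exists>U. rel_compact_domain U \<and> y \<in> U \<and> z \<in> U" for x y z :: 'x
    proof -
      from that obtain U V where "rel_compact_domain U" "x \<in> U" "y \<in> U" "rel_compact_domain V" "y \<in> V" "z \<in> V"
        by blast
      then show ?thesis
        using finite_union_rel_compact_domain[of "{U}" y V] by (intro exI[of _ "V \<union> U"]) auto
    qed
    show "\<exists>T. openin (top_of_set UNIV) T \<and> a \<in> T \<and> (\<forall>x\<in>T. \<exists>U. rel_compact_domain U \<and> a \<in> U \<and> x \<in> U)" for a :: 'x
      using rel_compact_domain_near[of a] by (metis open_openin rel_compact_domain_def subtopology_UNIV)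
  qed auto
  fix a :: 'x
  obtain W where W: "\<And>b. rel_compact_domain (W b) \<and> a \<in> W b \<and> b \<in> W b" using joint[of a] by metis
  obtain D' where D': "finite D'" "D \<subseteq> (\<Union>b\<in>D'. W b)"
    using compactE_image[OF assms, of UNIV W] W by (metis UNIV_I UN_I rel_compact_domain_def subsetI)
  have "rel_compact_domain (W a \<union> \<Union>(W ` D'))"
    using W D' by (intro finite_union_rel_compact_domain[of _ a]) auto
  then show ?thesis using D' by (intro exI[of _ "W a \<union> \<Union>(W ` D')"]) auto
qed

section \<open>Tangent spaces and relative openness of cells\<close>

lemma frame_orthonormal: "pairwise orthogonal (frame P s)" "\<forall>b\<in>frame P s. norm b = 1"
  and span_frame: "span (frame P s) = tangent P s"
proof -
  have "subspace (tangent P s)" by (simp add: tangent_def)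
  then have "\<exists>B. pairwise orthogonal B \<and> (\<forall>b\<in>B. norm b = 1) \<and> span B = tangent P s"
    by (rule orthonormal_basis_subspace) blast
  from someI_ex[OF this]
  show "pairwise orthogonal (frame P s)" "\<forall>b\<in>frame P s. norm b = 1" "span (frame P s) = tangent P s"
    unfolding frame_def by auto
qed

lemma subspace_tangent: "subspace (tangent P s)"
  by (simp add: tangent_def)

text \<open>Coefficients with sum 0 can be added to barycentric coordinates without disturbing their
  total 1.\<close>

lemma tangent_combination:
  assumes "finite s" "w \<in> tangent P s"
  shows "\<exists>c. (\<Sum>v\<in>s. c v) = 0 \<and> w = (\<Sum>v\<in>s. c v *\<^sub>R vertex P v)"
  using assms(2) unfolding tangent_def
proof (induction rule: span_induct_alt)
  case base
  then show ?case by (intro exI[of _ "\<lambda>_. 0"]) simp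
next
  case (step c x y)
  then obtain a b d where ab: "x = vertex P a - vertex P b" "a \<in> s" "b \<in> s"
    and d: "(\<Sum>v\<in>s. d v) = 0" "y = (\<Sum>v\<in>s. d v *\<^sub>R vertex P v)" by blast
  let ?d = "\<lambda>v. (if v = a then c else 0) - (if v = b then c else 0) + d v"
  have "(\<Sum>v\<in>s. ?d v) = 0"
    using assms(1) ab d by (simp add: sum.distrib sum_subtractf)
  moreover have "(\<Sum>v\<in>s. ?d v *\<^sub>R vertex P v) = c *\<^sub>R x + y"
    using assms(1) ab d
    by (simp add: scaleR_add_left scaleR_diff_left sum.distrib sum_subtractf if_distrib[of "\<lambda>u. u *\<^sub>R _"]
        scaleR_diff_right cong: if_cong)
  ultimately show ?case by (intro exI[of _ ?d]) simp
qed

lemma pos_in_affine_hull: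
  assumes "x \<in> closed_cell P s" "s \<in> K" "w \<in> s"
  shows "pos P x - vertex P w \<in> tangent P s"
proof -
  have sub: "{v. bary P x v \<noteq> 0} \<subseteq> s" using assms by (simp add: closed_cell_def carrier_simplex_def)
  have "pos P x - vertex P w = (\<Sum>v\<in>s. bary P x v *\<^sub>R vertex P v) - (\<Sum>v\<in>s. bary P x v) *\<^sub>R vertex P w"
    using sub complexD(1)[OF assms(2)] by (simp add: pos_def R_D(4,5)[OF bary_in_R])
  also have "\<dots> = (\<Sum>v\<in>s. bary P x v *\<^sub>R (vertex P v - vertex P w))"
    by (simp add: scaleR_sum_left sum_subtractf scaleR_diff_right)
  also have "\<dots> \<in> tangent P s"
    unfolding tangent_def using assms(3) by (intro span_sum span_scale span_base) blast
  finally show ?thesis .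
qed

text \<open>A tangent vector changes the barycentric coordinates linearly. As long as each change is
  smaller than the least coordinate of \<open>x\<close>, all coordinates on \<open>s\<close> remain
  positive.\<close>

lemma open_cell_relatively_open:
  assumes "x \<in> open_cell P s"
  shows "\<exists>r>0. \<forall>w\<in>tangent P s. norm w < r \<longrightarrow> pos P x + w \<in> pos P ` open_cell P s"
proof -
  have cs: "carrier_simplex P x = s" using assms by (simp add: open_cell_def)
  have s: "s \<in> K" "finite s" "s \<noteq> {}" using complexD carrier_in_K[of x] unfolding cs by blast+
  let ?B = "frame P s"
  have "\<forall>b\<in>?B. \<exists>c. (\<Sum>v\<in>s. c v) = 0 \<and> b = (\<Sum>v\<in>s. c v *\<^sub>R vertex P v)"
    using tangent_combination[OF s(2)] span_frame span_base by blast
  then obtain c where c: "\<And>b. b \<in> ?B \<Longrightarrow> (\<Sum>v\<in>s. c b v) = 0"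
    "\<And>b. b \<in> ?B \<Longrightarrow> b = (\<Sum>v\<in>s. c b v *\<^sub>R vertex P v)" by metis
  \<comment> \<open>\<open>M\<close> bounds the change of every coordinate per unit of
    \<open>norm w\<close>; the summand 1 makes it a positive divisor.\<close>
  define M where "M = 1 + (\<Sum>v\<in>s. \<Sum>b\<in>?B. \<bar>c b v\<bar>)"
  have M: "1 \<le> M" by (simp add: M_def sum_nonneg)
  define m where "m = Min (bary P x ` s)"
  have m: "0 < m" "\<And>v. v \<in> s \<Longrightarrow> m \<le> bary P x v" using s cs bary_pos_iff[of _ x] by (auto simp: m_def)
  have "pos P x + w \<in> pos P ` open_cell P s" if w: "w \<in> tangent P s" "norm w < m / M" for w
  proof -
    define a where "a v = (\<Sum>b\<in>?B. (w \<bullet> b) * c b v)" for v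
    have wexp: "w = (\<Sum>b\<in>?B. (w \<bullet> b) *\<^sub>R b)"
      using orthonormal_expansion[OF frame_orthonormal, of w s] w span_frame by simp
    also have "\<dots> = (\<Sum>b\<in>?B. (w \<bullet> b) *\<^sub>R (\<Sum>v\<in>s. c b v *\<^sub>R vertex P v))"
      using c(2) by (intro sum.cong refl) metis
    also have "\<dots> = (\<Sum>v\<in>s. a v *\<^sub>R vertex P v)"
      unfolding a_def by (simp add: scaleR_sum_left scaleR_sum_right sum.swap[of _ ?B])
    finally have wa: "w = (\<Sum>v\<in>s. a v *\<^sub>R vertex P v)" .
    have suma: "(\<Sum>v\<in>s. a v) = 0"
    proof -
      have "(\<Sum>v\<in>s. a v) = (\<Sum>b\<in>?B. (w \<bullet> b) * (\<Sum>v\<in>s. c b v))"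
        unfolding a_def by (simp add: sum_distrib_left sum.swap[of _ s])
      then show ?thesis using c(1) by simp
    qed
    have a_small: "\<bar>a v\<bar> < m" if v: "v \<in> s" for v
    proof -
      have "\<bar>a v\<bar> \<le> (\<Sum>b\<in>?B. \<bar>(w \<bullet> b) * c b v\<bar>)" unfolding a_def by (rule sum_abs)
      also have "\<dots> \<le> (\<Sum>b\<in>?B. norm w * \<bar>c b v\<bar>)"
      proof (rule sum_mono)
        fix b assume "b \<in> ?B"
        then have "\<bar>w \<bullet> b\<bar> \<le> norm w" using Cauchy_Schwarz_ineq2[of w b] frame_orthonormal(2)[of s] by simp
        then show "\<bar>(w \<bullet> b) * c b v\<bar> \<le> norm w * \<bar>c b v\<bar>" by (simp add: abs_mult mult_right_mono)
      qed
      also have "\<dots> = norm w * (\<Sum>b\<in>?B. \<bar>c b v\<bar>)" by (simp add: sum_distrib_left)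
      also have "\<dots> \<le> norm w * M"
      proof (intro mult_left_mono)
        have "(\<Sum>b\<in>?B. \<bar>c b v\<bar>) \<le> (\<Sum>v\<in>s. \<Sum>b\<in>?B. \<bar>c b v\<bar>)"
          using v s by (intro member_le_sum[of v s "\<lambda>v. \<Sum>b\<in>?B. \<bar>c b v\<bar>"]) (auto simp: sum_nonneg)
        then show "(\<Sum>b\<in>?B. \<bar>c b v\<bar>) \<le> M" by (simp add: M_def)
      qed simp
      also have "\<dots> < m" using w(2) M by (simp add: field_simps)
      finally show ?thesis .
    qed
    define \<beta> where "\<beta> v = (if v \<in> s then bary P x v + a v else 0)" for v
    have \<beta>pos: "0 < \<beta> v" if "v \<in> s" for v using a_small[OF that] m(2)[OF that] that by (simp add: \<beta>_def)
    have supp: "{v. \<beta> v \<noteq> 0} = s" using \<beta>pos by (force simp: \<beta>_def)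
    have bx: "{v. bary P x v \<noteq> 0} \<subseteq> s" using cs by (simp add: carrier_simplex_def)
    have \<beta>: "\<beta> \<in> R"
    proof (rule R_I[OF s(1)])
      show "0 \<le> \<beta> v" for v using \<beta>pos[of v] by (cases "v \<in> s") (auto simp: \<beta>_def)
      show "sum \<beta> s = 1" using suma R_D(4)[OF bary_in_R s(2) bx] by (simp add: \<beta>_def sum.distrib)
    qed (simp add: \<beta>_def)
    have "pos P (triang P \<beta>) = pos P x + w"
      using R_D(5)[OF \<beta> s(2)] R_D(5)[OF bary_in_R s(2) bx] supp \<beta>
      by (simp add: pos_def wa \<beta>_def scaleR_add_left sum.distrib)
    moreover have "triang P \<beta> \<in> open_cell P s" using \<beta> supp by (simp add: open_cell_def carrier_simplex_def)
    ultimately show ?thesis by (metis imageI)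
  qed
  then show ?thesis using m M by (intro exI[of _ "m / M"]) auto
qed

end

section \<open>The volume measure\<close>

text \<open>The metric form has Borel representatives only up to null sets of a completed measure,
  so measurability has to be transported along equality almost everywhere.\<close>

lemma (in complete_measure) measurable_AE_eq:
  assumes f: "f \<in> measurable M N" and ae: "AE x in M. f x = g x" and g: "\<And>x. x \<in> space M \<Longrightarrow> g x \<in> space N"
  shows "g \<in> measurable M N"
proof (rule measurableI)
  fix A assume A: "A \<in> sets N"
  show "g -` A \<inter> space M \<in> sets M"
  proof (rule in_sets_AE)
    show "AE x in M. x \<in> f -` A \<inter> space M \<longleftrightarrow> x \<in> g -` A \<inter> space M"
      using ae by eventually_elim auto
    show "f -` A \<inter> space M \<in> sets M" using f A by (rule measurable_sets)
  qed auto
qed (rule g)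

context riemannian_complex
begin

section \<open>Flat measures on the planes of the simplexes\<close>

abbreviation cell_image :: "'v set \<Rightarrow> 'e set" where
  "cell_image s \<equiv> pos P ` open_cell P s"

text \<open>This is \<open>simplex_lebesgue\<close> before completion. Pushforwards and restrictions
  are computed with Borel sets here; the completion enters only through almost everywhere statements
  and nonnegative integrals.\<close>

definition plane_measure :: "'v set \<Rightarrow> 'e measure" where
  "plane_measure s = distr (flat_measure (frame P s)) borel (\<lambda>y. vertex P (SOME v. v \<in> s) + y)"

lemma sets_plane_measure [simp, measurable_cong]: "sets (plane_measure s) = sets borel"
  and space_plane_measure [simp]: "space (plane_measure s) = UNIV"
  by (simp_all add: plane_measure_def)

lemma simplex_lebesgue_eq: "simplex_lebesgue P s = completion (plane_measure s)"
  unfolding simplex_lebesgue_def plane_measure_def flat_measure_def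
  by (subst distr_distr) (auto simp: o_def)

lemma frame_finite: "finite (frame P s)"
  by (rule orthonormal_finite[OF frame_orthonormal])

text \<open>By translation invariance any point of the affine hull may replace the chosen vertex;
  charts are centred at a point of the cell in this way.\<close>

lemma plane_measure_at:
  assumes "a - vertex P (SOME v. v \<in> s) \<in> tangent P s"
  shows "plane_measure s = distr (flat_measure (frame P s)) borel (\<lambda>y. a + y)"
proof -
  let ?p = "vertex P (SOME v. v \<in> s)"
  have "distr (flat_measure (frame P s)) borel (\<lambda>y. a + y)
      = distr (distr (flat_measure (frame P s)) borel (\<lambda>y. (a - ?p) + y)) borel (\<lambda>y. ?p + y)"
    by (subst distr_distr) (auto simp: o_def add.assoc[symmetric])
  also have "distr (flat_measure (frame P s)) borel (\<lambda>y. (a - ?p) + y) = flat_measure (frame P s)"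
    using assms by (intro flat_measure_translate frame_finite) (simp add: span_frame)
  finally show ?thesis by (simp add: plane_measure_def)
qed

lemma pos_minus_base:
  assumes "x \<in> open_cell P s"
  shows "pos P x - vertex P (SOME v. v \<in> s) \<in> tangent P s"
proof -
  have "s \<in> K" "s \<noteq> {}" using assms carrier_in_K[of x] complexD by (auto simp: open_cell_def)
  then show ?thesis
    using assms by (intro pos_in_affine_hull) (auto simp: closed_cell_def open_cell_def some_in_eq)
qed

text \<open>The image is also the preimage of \<open>A\<close> under \<open>pt\<close> within the
  range of \<open>pos\<close>. That range is closed and \<open>pt\<close> is continuous on
  it.\<close>

lemma borel_pos_image:
  assumes "A \<in> sets borel"
  shows "pos P ` A \<in> sets borel"
proof -
  have "pt P \<in> borel_measurable (restrict_space borel (range (pos P)))"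
    by (rule borel_measurable_continuous_on_restrict[OF continuous_pt])
  from measurable_sets[OF this assms]
  have "pt P -` A \<inter> range (pos P) \<in> sets (restrict_space borel (range (pos P)))"
    by (simp add: space_restrict_space)
  then have "pt P -` A \<inter> range (pos P) \<in> sets borel"
    by (subst (asm) sets_restrict_space_iff) (auto simp: closed_range_pos borel_closed)
  moreover have "pos P ` A = pt P -` A \<inter> range (pos P)" by auto
  ultimately show ?thesis by simp
qed

lemma borel_pos [measurable]: "pos P \<in> borel_measurable borel"
  by (intro borel_measurable_continuous_onI continuous_pos)

lemma borel_open_cell: "s \<in> max_simplexes P \<Longrightarrow> open_cell P s \<in> sets borel"
  by (intro borel_open open_cell_open)

section \<open>The volume as a Borel measure\<close>

definition density_at :: "'v set \<Rightarrow> 'e \<Rightarrow> ennreal" where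
  "density_at s y = ennreal (sqrt (det_on (frame P s) (metric_form P (pt P y))))"

definition cell_vol :: "'v set \<Rightarrow> 'x set \<Rightarrow> ennreal" where
  "cell_vol s A = (\<integral>\<^sup>+y\<in>pos P ` (A \<inter> open_cell P s). density_at s y \<partial>simplex_lebesgue P s)"

definition borel_vol :: "'x measure" where
  "borel_vol = measure_of UNIV (sets borel) (\<lambda>A. \<integral>\<^sup>+s. cell_vol s A \<partial>count_space (max_simplexes P))"

lemma vol_eq: "vol P = completion borel_vol"
  by (simp add: vol_def borel_vol_def cell_vol_def density_at_def)

lemma sets_borel_vol [simp, measurable_cong]: "sets borel_vol = sets borel"
  and space_borel_vol [simp]: "space borel_vol = UNIV"
  using sets.sigma_sets_eq[of borel] by (simp_all add: borel_vol_def)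

lemma space_vol [simp]: "space (vol P) = UNIV"
  by (simp add: vol_eq)

lemma borel_measurable_vol: "f \<in> borel_measurable borel \<Longrightarrow> f \<in> borel_measurable (vol P)"
  unfolding vol_eq by (intro measurable_completion) (simp cong: measurable_cong_sets)

lemma sets_vol_borel: "A \<in> sets borel \<Longrightarrow> A \<in> sets (vol P)"
  unfolding vol_eq by (intro sets_completionI_sets) simp

lemma metric_form_measurable:
  assumes "s \<in> max_simplexes P" "\<xi> \<in> tangent P s" "\<eta> \<in> tangent P s"
  shows "(\<lambda>y. metric_form P (pt P y) \<xi> \<eta>) \<in> borel_measurable (restrict_space (simplex_lebesgue P s) (cell_image s))"
  using riemannian assms unfolding riemannian_polyhedron_def by blast

lemma metric_bilinear: "bilinear (metric_form P x)"
  and metric_sym: "metric_form P x \<xi> \<eta> = metric_form P x \<eta> \<xi>"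
  using riemannian unfolding riemannian_polyhedron_def by blast+

lemma cell_image_sets:
  assumes "A \<in> sets borel" "s \<in> max_simplexes P"
  shows "pos P ` (A \<inter> open_cell P s) \<in> sets (simplex_lebesgue P s)"
  unfolding simplex_lebesgue_eq
  using assms borel_open_cell by (intro sets_completionI_sets) (auto intro!: borel_pos_image)

text \<open>Measurability of the form is assumed for tangent vectors on the open cell. Frame vectors
  are tangent and are permuted among themselves in the determinant; the indicator confines the
  density to the cell.\<close>

lemma density_measurable:
  assumes "s \<in> max_simplexes P" "A \<in> sets borel"
  shows "(\<lambda>y. density_at s y * indicator (pos P ` (A \<inter> open_cell P s)) y) \<in> borel_measurable (simplex_lebesgue P s)"
proof -
  let ?N = "restrict_space (simplex_lebesgue P s) (cell_image s)"
  have "(\<lambda>y. det_on (frame P s) (metric_form P (pt P y))) \<in> borel_measurable ?N"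
    unfolding det_on_def
  proof (intro borel_measurable_sum borel_measurable_times borel_measurable_prod)
    fix \<pi> b assume "\<pi> \<in> {\<pi>. \<pi> permutes frame P s}" "b \<in> frame P s"
    then have "b \<in> tangent P s" "\<pi> b \<in> tangent P s"
      using span_base[of _ "frame P s"] by (auto simp: span_frame[symmetric] permutes_in_image)
    then show "(\<lambda>y. metric_form P (pt P y) b (\<pi> b)) \<in> borel_measurable ?N"
      by (rule metric_form_measurable[OF assms(1)])
  qed simp
  then have "density_at s \<in> borel_measurable ?N"
    unfolding density_at_def by measurable
  then have "(\<lambda>y. density_at s y * indicator (cell_image s) y) \<in> borel_measurable (simplex_lebesgue P s)"
    using cell_image_sets[of UNIV, OF _ assms(1)] by (subst (asm) borel_measurable_restrict_space_iff_ennreal) auto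
  then have "(\<lambda>y. density_at s y * indicator (cell_image s) y * indicator (pos P ` (A \<inter> open_cell P s)) y)
      \<in> borel_measurable (simplex_lebesgue P s)"
    using cell_image_sets[OF assms(2,1)] by measurable
  moreover have "density_at s y * indicator (cell_image s) y * indicator (pos P ` (A \<inter> open_cell P s)) y
      = density_at s y * indicator (pos P ` (A \<inter> open_cell P s)) y" for y
    by (auto split: split_indicator)
  ultimately show ?thesis by simp
qed

text \<open>\<open>measure_of\<close> takes the prescribed values only for a countably additive set
  function. Additivity is checked in each cell, where injectivity of \<open>pos\<close> keeps images
  disjoint, and then the sums over sets and cells are exchanged.\<close>

lemma emeasure_borel_vol:
  assumes "A \<in> sets borel"
  shows "emeasure borel_vol A = (\<integral>\<^sup>+s. cell_vol s A \<partial>count_space (max_simplexes P))"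
  unfolding borel_vol_def
proof (rule emeasure_measure_of_sigma[OF _ _ _ assms])
  show "sigma_algebra UNIV (sets borel)" using sets.sigma_algebra_axioms[of borel] by simp
  show "positive (sets borel) (\<lambda>A. \<integral>\<^sup>+s. cell_vol s A \<partial>count_space (max_simplexes P))"
    by (simp add: positive_def cell_vol_def)
  show "countably_additive (sets borel) (\<lambda>A. \<integral>\<^sup>+s. cell_vol s A \<partial>count_space (max_simplexes P))"
  proof (rule countably_additiveI)
    fix A :: "nat \<Rightarrow> 'x set" assume A: "range A \<subseteq> sets borel" "disjoint_family A"
    have cell: "(\<Sum>i. cell_vol s (A i)) = cell_vol s (\<Union>i. A i)" if s: "s \<in> max_simplexes P" for s
    proof -
      have "(\<Sum>i. cell_vol s (A i))
          = (\<integral>\<^sup>+y. (\<Sum>i. density_at s y * indicator (pos P ` (A i \<inter> open_cell P s)) y) \<partial>simplex_lebesgue P s)"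
        unfolding cell_vol_def using A density_measurable[OF s] by (intro nn_integral_suminf[symmetric]) auto
      also have "\<dots> = cell_vol s (\<Union>i. A i)"
        unfolding cell_vol_def
      proof (intro nn_integral_cong)
        fix y
        have disj: "disjoint_family (\<lambda>i. pos P ` (A i \<inter> open_cell P s))"
          using A(2) inj_pos by (fastforce simp: disjoint_family_on_def inj_def)
        have "(\<Sum>i. indicator (pos P ` (A i \<inter> open_cell P s)) y) = (indicator (\<Union>i. pos P ` (A i \<inter> open_cell P s)) y :: ennreal)"
          by (rule suminf_indicator[OF disj])
        moreover have "(\<Union>i. pos P ` (A i \<inter> open_cell P s)) = pos P ` ((\<Union>i. A i) \<inter> open_cell P s)" by auto
        ultimately show "(\<Sum>i. density_at s y * indicator (pos P ` (A i \<inter> open_cell P s)) y)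
            = density_at s y * indicator (pos P ` ((\<Union>i. A i) \<inter> open_cell P s)) y"
          by (simp add: ennreal_suminf_cmult)
      qed
      finally show ?thesis .
    qed
    have "(\<Sum>i. \<integral>\<^sup>+s. cell_vol s (A i) \<partial>count_space (max_simplexes P))
        = (\<integral>\<^sup>+s. (\<Sum>i. cell_vol s (A i)) \<partial>count_space (max_simplexes P))"
      by (intro nn_integral_suminf[symmetric]) auto
    also have "\<dots> = (\<integral>\<^sup>+s. cell_vol s (\<Union>i. A i) \<partial>count_space (max_simplexes P))"
      using cell by (intro nn_integral_cong) simp
    finally show "(\<Sum>i. \<integral>\<^sup>+s. cell_vol s (A i) \<partial>count_space (max_simplexes P))
        = (\<integral>\<^sup>+s. cell_vol s (\<Union>i. A i) \<partial>count_space (max_simplexes P))" .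
  qed
qed

lemma cell_vol_le:
  assumes "A \<in> sets borel" "s \<in> max_simplexes P"
  shows "cell_vol s A \<le> emeasure borel_vol A"
  unfolding emeasure_borel_vol[OF assms(1)]
  using nn_integral_ge_point[OF assms(2), of "\<lambda>s. cell_vol s A"] by simp

text \<open>The volume is a sum over open maximal cells, so it suffices to argue cell by cell; for
  the same reason almost every point has a maximal carrier.\<close>

lemma AE_volI:
  assumes "\<And>s. s \<in> max_simplexes P \<Longrightarrow> AE y in simplex_lebesgue P s. y \<in> cell_image s \<longrightarrow> Q (pt P y)"
  shows "AE x in vol P. carrier_simplex P x \<in> max_simplexes P \<and> Q x"
proof -
  have "\<exists>N. N \<in> null_sets (plane_measure s) \<and> {y. \<not> (y \<in> cell_image s \<longrightarrow> Q (pt P y))} \<subseteq> N"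
    if "s \<in> max_simplexes P" for s
    using assms[OF that] unfolding simplex_lebesgue_eq AE_completion_iff by (elim AE_E3) (intro exI conjI, auto)
  then obtain N where N: "\<And>s. s \<in> max_simplexes P \<Longrightarrow> N s \<in> null_sets (plane_measure s)"
    "\<And>s. s \<in> max_simplexes P \<Longrightarrow> {y. \<not> (y \<in> cell_image s \<longrightarrow> Q (pt P y))} \<subseteq> N s" by metis
  \<comment> \<open>\<open>Z\<close> collects the exceptional points of all cells and everything
    outside the open maximal cells. It is Borel because there are only countably many cells.\<close>
  define Z where "Z = (\<Union>s\<in>max_simplexes P. pos P -` N s \<inter> open_cell P s) \<union> - (\<Union>s\<in>max_simplexes P. open_cell P s)"
  have Z: "Z \<in> sets borel"
  proof -
    have "pos P -` N s \<inter> open_cell P s \<in> sets borel" if s: "s \<in> max_simplexes P" for s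
    proof -
      have "N s \<in> sets borel" using N(1)[OF s] by (auto simp: null_sets_def)
      then have "pos P -` N s \<in> sets borel" using measurable_sets_borel[OF borel_pos] by simp
      then show ?thesis using borel_open_cell[OF s] by simp
    qed
    then have "(\<Union>s\<in>max_simplexes P. pos P -` N s \<inter> open_cell P s) \<in> sets borel"
      by (rule sets.countable_UN''[OF countable_max_simplexes])
    moreover have "(\<Union>s\<in>max_simplexes P. open_cell P s) \<in> sets borel"
      by (rule sets.countable_UN''[OF countable_max_simplexes borel_open_cell])
    ultimately show ?thesis unfolding Z_def by (intro sets.Un borel_comp)
  qed
  have "cell_vol s Z = 0" if s: "s \<in> max_simplexes P" for s
  proof -
    have "pos P ` (Z \<inter> open_cell P s) \<subseteq> N s"
      using s by (auto simp: Z_def open_cell_def)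
    then have "AE y in simplex_lebesgue P s. y \<notin> pos P ` (Z \<inter> open_cell P s)"
      unfolding simplex_lebesgue_eq AE_completion_iff
      using AE_not_in[OF N(1)[OF s]] by (auto elim!: eventually_mono)
    then have "cell_vol s Z = (\<integral>\<^sup>+y. 0 \<partial>simplex_lebesgue P s)"
      unfolding cell_vol_def by (intro nn_integral_cong_AE) (auto elim!: eventually_mono)
    then show ?thesis by simp
  qed
  then have "emeasure borel_vol Z = 0"
    unfolding emeasure_borel_vol[OF Z] by (simp add: nn_integral_0_iff_AE AE_count_space)
  then have "AE x in borel_vol. x \<notin> Z"
    using Z by (intro AE_not_in) (simp add: null_sets_def)
  then show ?thesis
    unfolding vol_eq AE_completion_iff
  proof eventually_elim
    case (elim x)
    then have s: "carrier_simplex P x \<in> max_simplexes P" "x \<in> open_cell P (carrier_simplex P x)"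
      by (auto simp: Z_def open_cell_def)
    then have "pos P x \<notin> N (carrier_simplex P x)" using elim by (auto simp: Z_def)
    then show ?case using N(2)[OF s(1)] s by auto
  qed
qed

section \<open>Ellipticity, and comparison of the flat measure with the volume\<close>

definition elliptic :: "real \<Rightarrow> 'x \<Rightarrow> bool" where
  "elliptic \<Lambda> x \<longleftrightarrow> (\<forall>\<xi>\<in>tangent P (carrier_simplex P x).
     (norm \<xi>)\<^sup>2 / \<Lambda>\<^sup>2 \<le> metric_form P x \<xi> \<xi> \<and> metric_form P x \<xi> \<xi> \<le> \<Lambda>\<^sup>2 * (norm \<xi>)\<^sup>2)"

lemma elliptic_cell:
  obtains \<Lambda> where "\<Lambda> > 0" "\<And>s. s \<in> max_simplexes P \<Longrightarrow>
     AE y in simplex_lebesgue P s. y \<in> cell_image s \<longrightarrow> elliptic \<Lambda> (pt P y)"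
proof -
  obtain \<Lambda> where \<Lambda>: "\<Lambda> > 0" "\<And>s. s \<in> max_simplexes P \<Longrightarrow>
      AE y in simplex_lebesgue P s. y \<in> cell_image s \<longrightarrow>
          (\<forall>\<xi>\<in>tangent P s. (norm \<xi>)\<^sup>2 / \<Lambda>\<^sup>2 \<le> metric_form P (pt P y) \<xi> \<xi> \<and>
             metric_form P (pt P y) \<xi> \<xi> \<le> \<Lambda>\<^sup>2 * (norm \<xi>)\<^sup>2)"
    using riemannian unfolding riemannian_polyhedron_def by blast
  have "AE y in simplex_lebesgue P s. y \<in> cell_image s \<longrightarrow> elliptic \<Lambda> (pt P y)"
    if "s \<in> max_simplexes P" for s
    using \<Lambda>(2)[OF that]
  proof eventually_elim
    case (elim y)
    show ?case
    proof
      assume y: "y \<in> cell_image s"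
      then have "carrier_simplex P (pt P y) = s" by (auto simp: open_cell_def)
      then show "elliptic \<Lambda> (pt P y)" using elim y by (simp add: elliptic_def)
    qed
  qed
  then show ?thesis using that \<Lambda>(1) by blast
qed

text \<open>In the orthonormal frame the lower ellipticity bound says that the matrix of the form
  dominates \<open>1 / \<Lambda>\<^sup>2\<close> times the identity, which is the situation of
  \<open>det_on_ge\<close>.\<close>

lemma density_bound:
  assumes "0 < \<Lambda>" "x \<in> open_cell P s" "elliptic \<Lambda> x"
  shows "ennreal (sqrt ((1 / \<Lambda>\<^sup>2) ^ card (frame P s))) \<le> density_at s (pos P x)"
proof -
  let ?B = "frame P s"
  have "(1 / \<Lambda>\<^sup>2) ^ card ?B \<le> det_on ?B (metric_form P x)"
  proof (rule det_on_ge[OF frame_finite])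
    show "metric_form P x i k = metric_form P x k i" for i k by (rule metric_sym)
    fix c :: "'e \<Rightarrow> real"
    let ?\<xi> = "\<Sum>b\<in>?B. c b *\<^sub>R b"
    have "?\<xi> \<in> tangent P s"
      unfolding span_frame[symmetric] by (intro span_sum span_scale span_base)
    then have "(norm ?\<xi>)\<^sup>2 / \<Lambda>\<^sup>2 \<le> metric_form P x ?\<xi> ?\<xi>"
      using assms by (auto simp: elliptic_def open_cell_def)
    also have "metric_form P x ?\<xi> ?\<xi> = (\<Sum>i\<in>?B. \<Sum>k\<in>?B. metric_form P x i k * c i * c k)"
      using metric_bilinear[of x]
      by (simp add: bilinear_sum sum.cartesian_product bilinear_lmul bilinear_rmul mult_ac)
    finally show "1 / \<Lambda>\<^sup>2 * (\<Sum>i\<in>?B. (c i)\<^sup>2) \<le> (\<Sum>i\<in>?B. \<Sum>k\<in>?B. metric_form P x i k * c i * c k)"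
      by (simp add: orthonormal_norm_sum[OF frame_orthonormal])
  qed (use assms in auto)
  then show ?thesis by (auto simp: density_at_def intro!: ennreal_leI)
qed

definition cell_measure :: "'v set \<Rightarrow> 'x measure" where
  "cell_measure s = distr (restrict_space (plane_measure s) (cell_image s)) borel (pt P)"

lemma sets_cell_measure [simp, measurable_cong]: "sets (cell_measure s) = sets borel"
  and space_cell_measure [simp]: "space (cell_measure s) = UNIV"
  by (simp_all add: cell_measure_def)

lemma pt_measurable [measurable]: "pt P \<in> borel_measurable (restrict_space (plane_measure s) (cell_image s))"
proof -
  have "pt P \<in> borel_measurable (restrict_space borel (cell_image s))"
    by (rule borel_measurable_continuous_on_restrict[OF continuous_on_subset[OF continuous_pt]]) auto
  then show ?thesis
    by (simp cong: measurable_cong_sets sets_restrict_space_cong)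
qed

lemma nn_integral_cell_measure:
  assumes "s \<in> max_simplexes P" "h \<in> borel_measurable borel"
  shows "(\<integral>\<^sup>+x. h x \<partial>cell_measure s) = (\<integral>\<^sup>+y\<in>cell_image s. h (pt P y) \<partial>plane_measure s)"
  unfolding cell_measure_def using assms borel_pos_image[OF borel_open_cell[OF assms(1)]]
  by (subst nn_integral_distr) (auto simp: nn_integral_restrict_space)

text \<open>The constant is the lower bound for the volume density. This domination carries null
  sets and vanishing integrals from the volume to the flat measure.\<close>

lemma cell_measure_le_vol:
  assumes s: "s \<in> max_simplexes P"
  shows "\<exists>\<kappa>>0. scale_measure (ennreal \<kappa>) (cell_measure s) \<le> borel_vol"
proof -
  obtain \<Lambda> where \<Lambda>: "\<Lambda> > 0" "\<And>s. s \<in> max_simplexes P \<Longrightarrow>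
     AE y in simplex_lebesgue P s. y \<in> cell_image s \<longrightarrow> elliptic \<Lambda> (pt P y)"
    using elliptic_cell by blast
  define \<kappa> where "\<kappa> = sqrt ((1 / \<Lambda>\<^sup>2) ^ card (frame P s))"
  have "ennreal \<kappa> * emeasure (cell_measure s) A \<le> emeasure borel_vol A" if A: "A \<in> sets borel" for A
  proof -
    have eq: "pt P -` A \<inter> cell_image s = pos P ` (A \<inter> open_cell P s)" by auto
    have "emeasure (cell_measure s) A = emeasure (plane_measure s) (pos P ` (A \<inter> open_cell P s))"
      unfolding cell_measure_def using A borel_pos_image[OF borel_open_cell[OF s]]
      by (subst emeasure_distr) (auto simp: space_restrict_space eq intro!: emeasure_restrict_space)
    also have "ennreal \<kappa> * \<dots> = (\<integral>\<^sup>+y\<in>pos P ` (A \<inter> open_cell P s). ennreal \<kappa> \<partial>simplex_lebesgue P s)"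
      using A s unfolding simplex_lebesgue_eq nn_integral_completion
      by (subst nn_integral_cmult_indicator) (auto intro!: borel_pos_image borel_open_cell)
    also have "\<dots> \<le> cell_vol s A"
      unfolding cell_vol_def
    proof (intro nn_integral_mono_AE)
      show "AE y in simplex_lebesgue P s. ennreal \<kappa> * indicator (pos P ` (A \<inter> open_cell P s)) y
          \<le> density_at s y * indicator (pos P ` (A \<inter> open_cell P s)) y"
        using \<Lambda>(2)[OF s]
      proof eventually_elim
        case (elim y)
        show ?case
          using elim density_bound[OF \<Lambda>(1)] by (auto split: split_indicator simp: \<kappa>_def)
      qed
    qed
    also have "\<dots> \<le> emeasure borel_vol A" by (rule cell_vol_le[OF A s])
    finally show ?thesis .
  qed
  then have "scale_measure (ennreal \<kappa>) (cell_measure s) \<le> borel_vol"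
    by (subst le_measure) auto
  moreover have "0 < \<kappa>" using \<Lambda>(1) by (simp add: \<kappa>_def)
  ultimately show ?thesis by blast
qed

lemma nn_integral_plane_le_vol:
  assumes s: "s \<in> max_simplexes P"
  shows "\<exists>\<kappa>>0. \<forall>h\<in>borel_measurable borel.
      ennreal \<kappa> * (\<integral>\<^sup>+y\<in>cell_image s. h (pt P y) \<partial>plane_measure s) \<le> (\<integral>\<^sup>+x. h x \<partial>vol P)"
proof -
  obtain \<kappa> where \<kappa>: "\<kappa> > 0" "scale_measure (ennreal \<kappa>) (cell_measure s) \<le> borel_vol"
    using cell_measure_le_vol[OF s] by blast
  have "ennreal \<kappa> * (\<integral>\<^sup>+y\<in>cell_image s. h (pt P y) \<partial>plane_measure s) \<le> (\<integral>\<^sup>+x. h x \<partial>vol P)"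
    if h: "h \<in> borel_measurable borel" for h
  proof -
    have "ennreal \<kappa> * (\<integral>\<^sup>+y\<in>cell_image s. h (pt P y) \<partial>plane_measure s)
        = (\<integral>\<^sup>+x. h x \<partial>scale_measure (ennreal \<kappa>) (cell_measure s))"
      using h by (simp add: nn_integral_scale_measure nn_integral_cell_measure[OF s])
    also have "\<dots> \<le> (\<integral>\<^sup>+x. h x \<partial>borel_vol)"
      by (rule nn_integral_mono_measure[OF _ \<kappa>(2)]) simp
    finally show ?thesis by (simp add: vol_eq nn_integral_completion)
  qed
  then show ?thesis using \<kappa>(1) by blast
qed

lemma AE_vol_imp_AE_plane:
  assumes s: "s \<in> max_simplexes P" and "AE x in vol P. Q x"
  shows "AE y in plane_measure s. y \<in> cell_image s \<longrightarrow> Q (pt P y)"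
proof -
  obtain \<kappa> where \<kappa>: "\<kappa> > 0" "scale_measure (ennreal \<kappa>) (cell_measure s) \<le> borel_vol"
    using cell_measure_le_vol[OF s] by blast
  obtain N where N: "N \<in> null_sets borel_vol" "{x. \<not> Q x} \<subseteq> N"
    using assms(2) unfolding vol_eq AE_completion_iff by (elim AE_E3) auto
  have "ennreal \<kappa> * emeasure (cell_measure s) N \<le> 0"
    using le_measureD3[OF \<kappa>(2), of N] N(1) by (auto simp: null_sets_def)
  then have "N \<in> null_sets (cell_measure s)"
    using \<kappa>(1) N(1) by (auto simp: null_sets_def)
  then have "AE x in cell_measure s. x \<notin> N" by (rule AE_not_in)
  then have "AE y in restrict_space (plane_measure s) (cell_image s). pt P y \<notin> N"
    unfolding cell_measure_def by (rule AE_distrD[rotated]) measurable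
  then have "AE y in plane_measure s. y \<in> cell_image s \<longrightarrow> pt P y \<notin> N"
    using borel_pos_image[OF borel_open_cell[OF s]] by (subst (asm) AE_restrict_space_iff) auto
  then show ?thesis using N(2) by (auto elim!: eventually_mono)
qed

lemma AE_vol_elliptic:
  "\<exists>\<Lambda>>0. AE x in vol P. carrier_simplex P x \<in> max_simplexes P \<and> elliptic \<Lambda> x"
proof -
  obtain \<Lambda> where \<Lambda>: "\<Lambda> > 0" "\<And>s. s \<in> max_simplexes P \<Longrightarrow>
     AE y in simplex_lebesgue P s. y \<in> cell_image s \<longrightarrow> elliptic \<Lambda> (pt P y)"
    using elliptic_cell by blast
  show ?thesis by (rule exI[of _ \<Lambda>]) (intro conjI \<Lambda>(1) AE_volI \<Lambda>(2))
qed

text \<open>The form is measurable for the completed Lebesgue measure of the simplex. A Borel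
  representative in the plane is composed with \<open>pos\<close>, and the equality almost
  everywhere is carried over to the completed volume.\<close>

lemma metric_form_cell_measurable:
  assumes s: "s \<in> max_simplexes P" and bc: "b \<in> tangent P s" "c \<in> tangent P s"
  shows "(\<lambda>x. metric_form P x b c * indicator (open_cell P s) x) \<in> borel_measurable (vol P)"
proof -
  let ?h = "\<lambda>y. indicator (cell_image s) y *\<^sub>R metric_form P (pt P y) b c"
  have "?h \<in> borel_measurable (simplex_lebesgue P s)"
    using metric_form_measurable[OF s bc] cell_image_sets[of UNIV, OF _ s]
    by (subst (asm) borel_measurable_restrict_space_iff) auto
  then obtain h where h: "h \<in> borel_measurable (plane_measure s)" "AE y in plane_measure s. ?h y = h y"
    unfolding simplex_lebesgue_eq using completion_ex_borel_measurable_real by blast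
  have hb [measurable]: "h \<in> borel_measurable borel" using h(1) by (simp cong: measurable_cong_sets)
  have [measurable]: "open_cell P s \<in> sets borel" using s by (rule borel_open_cell)
  have "(\<lambda>x. h (pos P x) * indicator (open_cell P s) x) \<in> borel_measurable (vol P)"
    by (intro borel_measurable_vol) measurable
  moreover have "AE x in vol P. carrier_simplex P x \<in> max_simplexes P
      \<and> (x \<in> open_cell P s \<longrightarrow> h (pos P x) = metric_form P x b c)"
  proof (rule AE_volI)
    fix t assume t: "t \<in> max_simplexes P"
    show "AE y in simplex_lebesgue P t. y \<in> cell_image t \<longrightarrow>
        (pt P y \<in> open_cell P s \<longrightarrow> h (pos P (pt P y)) = metric_form P (pt P y) b c)"
    proof (cases "t = s")
      case True
      have "AE y in simplex_lebesgue P s. ?h y = h y"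
        using h(2) unfolding simplex_lebesgue_eq AE_completion_iff .
      then show ?thesis unfolding True by eventually_elim auto
    next
      case False
      then show ?thesis by (intro AE_I2) (auto simp: open_cell_def)
    qed
  qed
  then have "AE x in vol P. h (pos P x) * indicator (open_cell P s) x = metric_form P x b c * indicator (open_cell P s) x"
    by eventually_elim (auto split: split_indicator)
  ultimately show ?thesis
    unfolding vol_eq by (rule completion.measurable_AE_eq) simp
qed

text \<open>The frame depends on the cell. On one cell the value is a finite sum over frame
  coordinates with measurable entries; the countably many cells are then glued together.\<close>

lemma metric_form_vector_fields_measurable:
  assumes G: "vector_field_on P U G" and H: "vector_field_on P U H" and U: "U \<in> sets borel"
  shows "(\<lambda>x. metric_form P x (G x) (H x) * indicator U x) \<in> borel_measurable (vol P)"
proof -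
  have U': "U \<inter> space (vol P) \<in> sets (vol P)" using U by (simp add: sets_vol_borel)
  have G' [measurable]: "(\<lambda>x. indicator U x *\<^sub>R G x) \<in> borel_measurable (vol P)"
    and H' [measurable]: "(\<lambda>x. indicator U x *\<^sub>R H x) \<in> borel_measurable (vol P)"
    using G H U' unfolding vector_field_on_def by (auto simp: borel_measurable_restrict_space_iff)
  define f where "f s x = (if s = {} then 0 else (\<Sum>b\<in>frame P s. \<Sum>c\<in>frame P s.
      (((indicator U x *\<^sub>R G x) \<bullet> b) * ((indicator U x *\<^sub>R H x) \<bullet> c)) * (metric_form P x b c * indicator (open_cell P s) x)))" for s x
  \<comment> \<open>The empty set is not a simplex, so it can mark the points outside all open
    maximal cells.\<close>
  define g where "g x = (if carrier_simplex P x \<in> max_simplexes P then carrier_simplex P x else {})" for x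
  have g: "g \<in> measurable (vol P) (count_space (insert {} (max_simplexes P)))"
  proof (subst measurable_count_space_eq_countable)
    have ne: "s \<noteq> {}" if "s \<in> max_simplexes P" for s using that max_simplexesD complexD by blast
    have "g -` {s} = (if s = {} then - (\<Union>t\<in>max_simplexes P. open_cell P t) else open_cell P s)"
      if "s \<in> insert {} (max_simplexes P)" for s
      using that ne by (auto simp: g_def open_cell_def split: if_splits)
    moreover have "- (\<Union>t\<in>max_simplexes P. open_cell P t) \<in> sets borel"
      by (intro borel_comp sets.countable_UN''[OF countable_max_simplexes borel_open_cell])
    ultimately show "g \<in> space (vol P) \<rightarrow> insert {} (max_simplexes P) \<and>
        (\<forall>s\<in>insert {} (max_simplexes P). g -` {s} \<inter> space (vol P) \<in> sets (vol P))"
      using borel_open_cell ne by (auto simp: g_def intro!: sets_vol_borel)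
  qed (use countable_max_simplexes in auto)
  have "(\<lambda>x. f (g x) x) \<in> borel_measurable (vol P)"
  proof (rule measurable_compose_countable'[OF _ g])
    fix s assume s: "s \<in> insert {} (max_simplexes P)"
    show "f s \<in> borel_measurable (vol P)"
    proof (cases "s = {}")
      case False
      then have s: "s \<in> max_simplexes P" using s by simp
      have "b \<in> tangent P s" if "b \<in> frame P s" for b
        using that span_base[of b "frame P s"] by (simp add: span_frame)
      then show ?thesis
        unfolding f_def using False
        by (auto intro!: borel_measurable_sum borel_measurable_times[OF _ metric_form_cell_measurable[OF s]]
            simp del: inner_scaleR_left)
    qed (simp add: f_def[abs_def])
  qed (use countable_max_simplexes in auto)
  moreover have "AE x in vol P. f (g x) x = metric_form P x (G x) (H x) * indicator U x"
  proof -
    have "AE x in vol P. carrier_simplex P x \<in> max_simplexes P" using AE_vol_elliptic by auto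
    moreover have "AE x in vol P. x \<in> U \<longrightarrow> G x \<in> tangent P (carrier_simplex P x)"
      "AE x in vol P. x \<in> U \<longrightarrow> H x \<in> tangent P (carrier_simplex P x)"
      using G H by (auto simp: vector_field_on_def)
    ultimately show ?thesis
    proof eventually_elim
      case (elim x)
      let ?s = "carrier_simplex P x" let ?B = "frame P ?s"
      have s: "g x = ?s" "?s \<noteq> {}" using elim complexD(2) carrier_in_K by (auto simp: g_def)
      show ?case
      proof (cases "x \<in> U")
        case True
        have "G x = (\<Sum>b\<in>?B. (G x \<bullet> b) *\<^sub>R b)" "H x = (\<Sum>b\<in>?B. (H x \<bullet> b) *\<^sub>R b)"
          using elim True by (auto intro!: orthonormal_expansion[OF frame_orthonormal] simp: span_frame)
        then have "metric_form P x (G x) (H x)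
            = metric_form P x (\<Sum>b\<in>?B. (G x \<bullet> b) *\<^sub>R b) (\<Sum>b\<in>?B. (H x \<bullet> b) *\<^sub>R b)" by simp
        also have "\<dots> = (\<Sum>b\<in>?B. \<Sum>c\<in>?B. (G x \<bullet> b) * (H x \<bullet> c) * metric_form P x b c)"
          using metric_bilinear[of x]
          by (simp add: bilinear_sum sum.cartesian_product bilinear_lmul bilinear_rmul mult_ac)
        finally show ?thesis using True s by (simp add: f_def open_cell_def)
      qed (simp add: f_def)
    qed
  qed
  ultimately show ?thesis
    unfolding vol_eq by (rule completion.measurable_AE_eq) simp
qed

end

section \<open>The intrinsic distance on open simplexes\<close>

text \<open>For each fixed \<open>t > 0\<close> the contraction of \<open>z\<close> towards
  \<open>w\<close> pulls null sets back to null sets, and Fubini exchanges the two quantifiers. The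
  value \<open>t = 0\<close> is excluded because there the map collapses to the point
  \<open>w\<close>.\<close>

lemma AE_flat_measure_rays:
  fixes B :: "'e::euclidean_space set"
  assumes B: "pairwise orthogonal B" "\<forall>b\<in>B. norm b = 1" and w: "w \<in> span B"
    and N: "N \<in> null_sets (flat_measure B)"
  shows "AE z in flat_measure B. AE t in lborel. t \<in> {0<..1} \<longrightarrow> w + t *\<^sub>R (z - w) \<notin> N"
proof -
  note fin = orthonormal_finite[OF B]
  interpret F: sigma_finite_measure "flat_measure B" by (rule sigma_finite_flat_measure[OF B])
  interpret pair_sigma_finite "flat_measure B" "lborel :: real measure" by standard
  have [measurable]: "N \<in> sets borel" using N by (auto simp: null_sets_def)
  have "AE z in flat_measure B. t \<in> {0<..1} \<longrightarrow> w + t *\<^sub>R (z - w) \<notin> N" for t :: real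
  proof (cases "t \<in> {0<..1}")
    case True
    have "AE z in flat_measure B. (1 - t) *\<^sub>R w + t *\<^sub>R z \<notin> N"
      using True w AE_not_in[OF N] by (intro AE_flat_measure_affine[OF fin]) (auto intro: span_scale)
    then show ?thesis by eventually_elim (simp add: algebra_simps)
  next
    case False
    then show ?thesis by (intro AE_I2) blast
  qed
  then have "AE t in lborel. AE z in flat_measure B. t \<in> {0<..1} \<longrightarrow> w + t *\<^sub>R (z - w) \<notin> N"
    by simp
  moreover have "{x \<in> space (flat_measure B \<Otimes>\<^sub>M lborel). snd x \<in> {0<..1::real} \<longrightarrow> w + snd x *\<^sub>R (fst x - w) \<notin> N}
      \<in> sets (flat_measure B \<Otimes>\<^sub>M lborel)"
  proof -
    have [measurable]: "fst \<in> borel_measurable (flat_measure B \<Otimes>\<^sub>M (lborel :: real measure))"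
      "snd \<in> borel_measurable (flat_measure B \<Otimes>\<^sub>M (lborel :: real measure))"
      using measurable_fst[of "flat_measure B" "lborel :: real measure"]
        measurable_snd[of "flat_measure B" "lborel :: real measure"]
      by (simp_all cong: measurable_cong_sets)
    show ?thesis by measurable
  qed
  ultimately show ?thesis
    using AE_commute[of "\<lambda>z t. t \<in> {0<..1} \<longrightarrow> w + t *\<^sub>R (z - w) \<notin> N"] by blast
qed

context riemannian_complex
begin

text \<open>
  Two points of a flat ball are joined through a third one; for almost every choice of the latter
  both segments meet a given null set in a null set of parameters.
\<close>

lemma intrinsic_dist_le:
  assumes s: "s \<in> max_simplexes P" and x0: "x0 \<in> open_cell P s"
    and \<Lambda>: "\<Lambda> > 0" "AE y in simplex_lebesgue P s. y \<in> cell_image s \<longrightarrow> elliptic \<Lambda> (pt P y)"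
    and cell: "\<And>w. w \<in> tangent P s \<Longrightarrow> norm w < r \<Longrightarrow> pos P x0 + w \<in> cell_image s"
    and lip: "\<And>v w. v \<in> tangent P s \<Longrightarrow> norm v < r \<Longrightarrow> w \<in> tangent P s \<Longrightarrow> norm w < r \<Longrightarrow>
        dist (pt P (pos P x0 + v)) (pt P (pos P x0 + w)) \<le> L * dist v w" and "0 \<le> L"
    and w: "w \<in> tangent P s" "norm w < r" and w': "w' \<in> tangent P s" "norm w' < r" and "w \<noteq> w'"
  shows "intrinsic_dist P (pt P (pos P x0 + w)) (pt P (pos P x0 + w')) \<le> ennreal (4 * \<Lambda> * dist w w')"
  unfolding intrinsic_dist_def
proof (rule SUP_least)
  fix Z assume "Z \<in> {Z. null_subset P Z}"
  then have Z: "pos P ` (Z \<inter> closed_cell P s) \<in> null_sets (simplex_lebesgue P s)"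
    using s by (auto simp: null_subset_def)
  let ?B = "frame P s" let ?a = "pos P x0" let ?T = "tangent P s" let ?d = "dist w w'"
  \<comment> \<open>Avoidance of \<open>Z\<close> makes the path admissible for the infimum;
    ellipticity bounds its speed.\<close>
  define Good where "Good y \<longleftrightarrow> y \<notin> pos P ` (Z \<inter> closed_cell P s) \<and> (y \<in> cell_image s \<longrightarrow> elliptic \<Lambda> (pt P y))" for y
  have "AE y in simplex_lebesgue P s. Good y"
    using AE_not_in[OF Z] \<Lambda>(2) unfolding Good_def by eventually_elim auto
  then have "AE y in distr (flat_measure ?B) borel (\<lambda>y. ?a + y). Good y"
    unfolding simplex_lebesgue_eq AE_completion_iff plane_measure_at[OF pos_minus_base[OF x0]] .
  then have "AE y in flat_measure ?B. Good (?a + y)"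
    by (rule AE_distrD[rotated]) measurable
  then obtain N where N: "N \<in> null_sets (flat_measure ?B)" "\<And>y. y \<notin> N \<Longrightarrow> Good (?a + y)"
    by (elim AE_E3) auto
  have [measurable]: "N \<in> sets borel" using N(1) by (auto simp: null_sets_def)
  have d: "0 < ?d" using \<open>w \<noteq> w'\<close> by simp
  \<comment> \<open>Closeness to \<open>w\<close> limits the length of the detour through
    \<open>z\<close>, and the ball of radius \<open>r\<close> keeps it in the chart.\<close>
  define V where "V = ball w ?d \<inter> ball 0 r"
  \<comment> \<open>If no such point existed, \<open>V\<close> would avoid almost every point of the
    plane; but \<open>V\<close> contains a ball around \<open>w\<close>, which has positive flat
    measure.\<close>
  have "\<exists>z. z \<in> V \<and> z \<in> ?T
      \<and> (AE t in lborel. t \<in> {0<..1} \<longrightarrow> w + t *\<^sub>R (z - w) \<notin> N)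
      \<and> (AE t in lborel. t \<in> {0<..1} \<longrightarrow> w' + t *\<^sub>R (z - w') \<notin> N)"
  proof (rule ccontr)
    assume neg: "\<not> ?thesis"
    have "AE z in flat_measure ?B. z \<in> ?T"
      using AE_flat_measure_span[OF frame_finite] by (simp add: span_frame)
    moreover have "AE z in flat_measure ?B. AE t in lborel. t \<in> {0<..1} \<longrightarrow> w + t *\<^sub>R (z - w) \<notin> N"
      "AE z in flat_measure ?B. AE t in lborel. t \<in> {0<..1} \<longrightarrow> w' + t *\<^sub>R (z - w') \<notin> N"
      using w w' N(1) by (intro AE_flat_measure_rays[OF frame_orthonormal]; simp add: span_frame)+
    ultimately have "AE z in flat_measure ?B. z \<notin> V"
      by eventually_elim (use neg in auto)
    have "open V" "w \<in> V" using d w by (auto simp: V_def)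
    then obtain \<delta> where \<delta>: "\<delta> > 0" "ball w \<delta> \<subseteq> V" by (meson openE)
    have "AE z in flat_measure ?B. z \<notin> ball w \<delta>"
      using \<open>AE z in flat_measure ?B. z \<notin> V\<close> by eventually_elim (use \<delta> in auto)
    then have "emeasure (flat_measure ?B) (ball w \<delta>) = 0"
      by (subst (asm) AE_iff_measurable[of "ball w \<delta>"]) auto
    then show False
      using emeasure_flat_ball_pos[OF frame_orthonormal _ \<delta>(1), of w s] w by (simp add: span_frame)
  qed
  then obtain z where z: "z \<in> V" "z \<in> ?T"
    and zw: "AE t in lborel. t \<in> {0<..1} \<longrightarrow> w + t *\<^sub>R (z - w) \<notin> N"
    and zw': "AE t in lborel. t \<in> {0<..1} \<longrightarrow> w' + t *\<^sub>R (z - w') \<notin> N" by blast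
  have zd: "norm (z - w) \<le> ?d" "norm (w' - z) \<le> 2 * ?d" "norm z < r"
    using z dist_triangle[of w' z w] by (auto simp: V_def dist_norm norm_minus_commute)
  \<comment> \<open>The path runs from \<open>w\<close> to \<open>z\<close> on the first half of the
    interval and from \<open>z\<close> to \<open>w'\<close> on the second. The single formula with
    \<open>min\<close> and \<open>max\<close> makes it Lipschitz across the junction.\<close>
  define p where "p t = w + min (2 * t) 1 *\<^sub>R (z - w) + max (2 * t - 1) 0 *\<^sub>R (w' - z)" for t :: real
  have p1: "p t = w + (2 * t) *\<^sub>R (z - w)" if "t \<le> 1 / 2" for t using that by (simp add: p_def)
  have p2: "p t = w' + (2 - 2 * t) *\<^sub>R (z - w')" if "1 / 2 \<le> t" for t
    using that by (simp add: p_def algebra_simps scaleR_2)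
  have pT: "p t \<in> ?T" for t
    unfolding p_def using w w' z subspace_tangent
    by (intro subspace_add subspace_scale subspace_diff) auto
  have pr: "norm (p t) < r" if t: "t \<in> {0..1}" for t
  proof (cases "t \<le> 1 / 2")
    case True
    have "p t = (1 - 2 * t) *\<^sub>R w + (2 * t) *\<^sub>R z" using p1[OF True] by (simp add: algebra_simps)
    moreover have "(1 - 2 * t) *\<^sub>R w + (2 * t) *\<^sub>R z \<in> ball 0 r"
      using w zd t True by (intro convexD[OF convex_ball]) auto
    ultimately show ?thesis by simp
  next
    case False
    have "p t = (2 * t - 1) *\<^sub>R w' + (2 - 2 * t) *\<^sub>R z" using False by (subst p2) (simp_all add: algebra_simps scaleR_2)
    moreover have "(2 * t - 1) *\<^sub>R w' + (2 - 2 * t) *\<^sub>R z \<in> ball 0 r"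
      using w' zd t False by (intro convexD[OF convex_ball]) auto
    ultimately show ?thesis by simp
  qed
  have plip: "dist (p t) (p u) \<le> (6 * ?d) * dist t u" for t u
  proof -
    have "p t - p u = (min (2 * t) 1 - min (2 * u) 1) *\<^sub>R (z - w) + (max (2 * t - 1) 0 - max (2 * u - 1) 0) *\<^sub>R (w' - z)"
      by (simp add: p_def algebra_simps)
    then have "norm (p t - p u) \<le> \<bar>min (2 * t) 1 - min (2 * u) 1\<bar> * norm (z - w)
        + \<bar>max (2 * t - 1) 0 - max (2 * u - 1) 0\<bar> * norm (w' - z)"
      by (metis norm_scaleR norm_triangle_ineq)
    also have "\<dots> \<le> (2 * \<bar>t - u\<bar>) * ?d + (2 * \<bar>t - u\<bar>) * (2 * ?d)"
    proof (intro add_mono mult_mono)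
      show "\<bar>min (2 * t) 1 - min (2 * u) 1\<bar> \<le> 2 * \<bar>t - u\<bar>"
        "\<bar>max (2 * t - 1) 0 - max (2 * u - 1) 0\<bar> \<le> 2 * \<bar>t - u\<bar>"
        by (auto simp: min_def max_def abs_if)
    qed (use zd in auto)
    finally show ?thesis by (simp add: dist_norm mult_ac)
  qed
  define \<gamma> where "\<gamma> t = pt P (?a + p t)" for t
  have pcell: "?a + p t \<in> cell_image s" if "t \<in> {0..1}" for t by (rule cell[OF pT pr[OF that]])
  have pos\<gamma>: "pos P (\<gamma> t) = ?a + p t" and \<gamma>cell: "\<gamma> t \<in> open_cell P s" if "t \<in> {0..1}" for t
    using pcell[OF that] by (auto simp: \<gamma>_def)
  have "(L * (6 * ?d))-lipschitz_on {0..1} \<gamma>"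
  proof (rule lipschitz_onI)
    fix t u :: real assume t: "t \<in> {0..1}" and u: "u \<in> {0..1}"
    have "dist (\<gamma> t) (\<gamma> u) \<le> L * dist (p t) (p u)"
      unfolding \<gamma>_def by (intro lip pT pr t u)
    also have "\<dots> \<le> L * ((6 * ?d) * dist t u)" by (intro mult_left_mono plip \<open>0 \<le> L\<close>)
    finally show "dist (\<gamma> t) (\<gamma> u) \<le> L * (6 * ?d) * dist t u" by simp
  qed (use \<open>0 \<le> L\<close> in simp)
  have ae1: "AE t in lborel. 0 + 2 * t \<in> {0<..1} \<longrightarrow> w + (0 + 2 * t) *\<^sub>R (z - w) \<notin> N"
    by (rule AE_borel_affine[OF _ _ zw]) (simp, measurable)
  \<comment> \<open>The second segment is parametrised from \<open>w'\<close> towards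
    \<open>z\<close>, so time is reversed by \<open>2 - 2 * t\<close>.\<close>
  have ae2: "AE t in lborel. 2 + (- 2) * t \<in> {0<..1} \<longrightarrow> w' + (2 + (- 2) * t) *\<^sub>R (z - w') \<notin> N"
    by (rule AE_borel_affine[OF _ _ zw']) (simp, measurable)
  \<comment> \<open>The rays leave out the parameters 0 and 1, and the path may have a kink at
    \<open>1 / 2\<close>; these three points form a null set.\<close>
  have ae: "AE t in lborel. t \<in> {0..1} \<longrightarrow> t \<noteq> 1 / 2 \<and> t \<noteq> 0 \<and> t \<noteq> 1 \<and> p t \<notin> N"
    using ae1 ae2 AE_lborel_singleton[of "1 / 2 :: real"] AE_lborel_singleton[of "0 :: real"] AE_lborel_singleton[of "1 :: real"]
  proof eventually_elim
    case (elim t)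
    then show ?case using p1[of t] p2[of t] by (cases "t \<le> 1 / 2") auto
  qed
  then have aeL: "AE t in lebesgue. t \<in> {0..1} \<longrightarrow> t \<noteq> 1 / 2 \<and> t \<noteq> 0 \<and> t \<noteq> 1 \<and> p t \<notin> N"
    by (rule AE_completion)
  have "negligible {t\<in>{0..1}. \<gamma> t \<in> Z}"
  proof -
    have "AE t in lebesgue. t \<notin> {t\<in>{0..1}. \<gamma> t \<in> Z}"
      using aeL
    proof eventually_elim
      case (elim t)
      have "Good (?a + p t)" if "t \<in> {0..1}" using elim N(2) that by blast
      then show ?case
      proof (intro notI, elim CollectE conjE)
        assume t: "t \<in> {0..1}" and "\<gamma> t \<in> Z"
        then have "pos P (\<gamma> t) \<in> pos P ` (Z \<inter> closed_cell P s)"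
          using \<gamma>cell[OF t] by (intro imageI) (simp add: open_cell_def closed_cell_def)
        then show False using \<open>t \<in> {0..1} \<Longrightarrow> Good (?a + p t)\<close>[OF t] by (simp add: Good_def pos\<gamma>[OF t])
      qed
    qed
    then have "{t\<in>{0..1}. \<gamma> t \<in> Z} \<in> null_sets lebesgue"
      by (simp add: completion.null_sets_iff_AE)
    then show ?thesis by (simp add: negligible_iff_null_sets)
  qed
  \<comment> \<open>The velocity is twice \<open>z - w\<close> or twice \<open>w' - z\<close>, hence
    of norm at most \<open>4 * ?d\<close>; ellipticity contributes the factor \<Lambda>.\<close>
  moreover have "path_length P \<gamma> \<le> ennreal (4 * \<Lambda> * ?d)"
  proof -
    have "path_length P \<gamma> \<le> (\<integral>\<^sup>+t\<in>{0..1::real}. ennreal (4 * \<Lambda> * ?d) \<partial>lebesgue)"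
      unfolding path_length_def
    proof (rule nn_integral_mono_AE)
      show "AE t in lebesgue. (let \<xi> = vector_derivative (\<lambda>r. pos P (\<gamma> r)) (at t within {0..1})
               in ennreal (sqrt (metric_form P (\<gamma> t) \<xi> \<xi>))) * indicator {0..1} t
          \<le> ennreal (4 * \<Lambda> * ?d) * indicator {0..1} t"
        using aeL
      proof eventually_elim
        case (elim t)
        show ?case
        proof (cases "t \<in> {0..1}")
          case t: True
          have t': "t \<noteq> 1 / 2" "p t \<notin> N" using elim t by auto
          let ?\<xi> = "vector_derivative (\<lambda>r. pos P (\<gamma> r)) (at t within {0..1})"
          have vd: "?\<xi> = \<xi>" if "(p has_vector_derivative \<xi>) (at t)" for \<xi>
          proof -
            have "(p has_vector_derivative \<xi>) (at t within {0..1})"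
              using that by (rule has_vector_derivative_at_within)
            from has_vector_derivative_add[OF has_vector_derivative_const this, of ?a]
            have "((\<lambda>r. ?a + p r) has_vector_derivative \<xi>) (at t within {0..1})"
              by simp
            then have "((\<lambda>r. pos P (\<gamma> r)) has_vector_derivative \<xi>) (at t within {0..1})"
              by (rule has_vector_derivative_transform[OF t, rotated]) (simp add: pos\<gamma>)
            then show ?thesis
              using t by (intro vector_derivative_within_cbox[of 0 1, unfolded cbox_interval]) auto
          qed
          have "?\<xi> \<in> ?T \<and> norm ?\<xi> \<le> 4 * ?d"
          proof (cases "t < 1 / 2")
            case True
            have "(p has_vector_derivative (2 *\<^sub>R (z - w))) (at t)"
            proof (rule has_vector_derivative_transform_within_open[where S = "{..<1/2}"])
              show "((\<lambda>t. w + (2 * t) *\<^sub>R (z - w)) has_vector_derivative (2 *\<^sub>R (z - w))) (at t)"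
                by (auto intro!: derivative_eq_intros)
            qed (use True p1 in auto)
            then have "?\<xi> = 2 *\<^sub>R (z - w)" by (rule vd)
            moreover have "norm (2 *\<^sub>R (z - w)) \<le> 4 * ?d" using zd(1) d by (simp only: norm_scaleR abs_numeral)
            moreover have "2 *\<^sub>R (z - w) \<in> ?T"
              using w z subspace_tangent by (intro subspace_scale subspace_diff) auto
            ultimately show ?thesis by simp
          next
            case False
            have "(p has_vector_derivative (2 *\<^sub>R (w' - z))) (at t)"
            proof (rule has_vector_derivative_transform_within_open[where S = "{1/2<..}"])
              show "((\<lambda>t. w' + (2 - 2 * t) *\<^sub>R (z - w')) has_vector_derivative (2 *\<^sub>R (w' - z))) (at t)"
                by (auto intro!: derivative_eq_intros simp: algebra_simps)
            qed (use False t' p2 in auto)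
            then have "?\<xi> = 2 *\<^sub>R (w' - z)" by (rule vd)
            moreover have "norm (2 *\<^sub>R (w' - z)) \<le> 4 * ?d" using zd(2) unfolding norm_scaleR by simp
            moreover have "2 *\<^sub>R (w' - z) \<in> ?T"
              using w' z subspace_tangent by (intro subspace_scale subspace_diff) auto
            ultimately show ?thesis by simp
          qed
          moreover have "elliptic \<Lambda> (\<gamma> t)"
            using N(2)[OF t'(2)] pcell[OF t] by (auto simp: Good_def \<gamma>_def)
          moreover have "carrier_simplex P (\<gamma> t) = s" using \<gamma>cell[OF t] by (simp add: open_cell_def)
          ultimately have \<xi>: "norm ?\<xi> \<le> 4 * ?d" "metric_form P (\<gamma> t) ?\<xi> ?\<xi> \<le> \<Lambda>\<^sup>2 * (norm ?\<xi>)\<^sup>2"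
            by (auto simp: elliptic_def)
          have "sqrt (metric_form P (\<gamma> t) ?\<xi> ?\<xi>) \<le> sqrt ((\<Lambda> * norm ?\<xi>)\<^sup>2)"
            using \<xi>(2) by (simp add: power_mult_distrib)
          also have "\<dots> = \<Lambda> * norm ?\<xi>" using \<Lambda>(1) by simp
          also have "\<dots> \<le> \<Lambda> * (4 * ?d)" using \<xi>(1) \<Lambda>(1) by (intro mult_left_mono) auto
          finally show ?thesis using t by (simp add: Let_def ennreal_leI mult_ac)
        qed simp
      qed
    qed
    also have "\<dots> = ennreal (4 * \<Lambda> * ?d)"
      by (subst nn_integral_cmult_indicator) auto
    finally show ?thesis .
  qed
  moreover have "\<gamma> 0 = pt P (?a + w)" "\<gamma> 1 = pt P (?a + w')"
    by (simp_all add: \<gamma>_def p_def)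
  ultimately show "(INF \<gamma>\<in>{\<gamma>. (\<exists>C. C-lipschitz_on {0..1} \<gamma>) \<and> \<gamma> 0 = pt P (?a + w) \<and> \<gamma> 1 = pt P (?a + w') \<and>
                  negligible {t\<in>{0..1}. \<gamma> t \<in> Z}}. path_length P \<gamma>) \<le> ennreal (4 * \<Lambda> * ?d)"
    using \<open>(L * (6 * ?d))-lipschitz_on {0..1} \<gamma>\<close> by (intro INF_lower2[of \<gamma>]) auto
qed

text \<open>The radius \<open>r\<close> is fixed before the function, so one chart serves a whole
  approximating sequence; only the Lipschitz constant depends on its member.\<close>

lemma lipschitz_fun_chart:
  assumes s: "s \<in> max_simplexes P" and x0: "x0 \<in> open_cell P s"
  shows "\<exists>r>0. (\<forall>w\<in>tangent P s. norm w < r \<longrightarrow> pos P x0 + w \<in> cell_image s) \<and>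
     (\<forall>U u \<rho>. lipschitz_fun P U u \<longrightarrow> \<rho> \<le> r \<longrightarrow> (\<forall>w\<in>tangent P s. norm w < \<rho> \<longrightarrow> pt P (pos P x0 + w) \<in> U) \<longrightarrow>
        (\<exists>C. C-lipschitz_on (tangent P s \<inter> ball 0 \<rho>) (\<lambda>w. u (pt P (pos P x0 + w)))))"
proof -
  let ?a = "pos P x0"
  obtain \<Lambda> where \<Lambda>: "\<Lambda> > 0" "AE y in simplex_lebesgue P s. y \<in> cell_image s \<longrightarrow> elliptic \<Lambda> (pt P y)"
    using elliptic_cell s by metis
  obtain r1 where r1: "r1 > 0" "\<forall>w\<in>tangent P s. norm w < r1 \<longrightarrow> ?a + w \<in> cell_image s"
    using open_cell_relatively_open[OF x0] by blast
  obtain e L where e: "e > 0" "\<forall>y\<in>range (pos P). \<forall>z\<in>range (pos P). dist ?a y < e \<and> dist ?a z < e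
      \<longrightarrow> dist (pt P y) (pt P z) \<le> L * dist y z"
    using pt_lipschitz unfolding loc_lipschitz_def by blast
  define r where "r = min r1 e"
  have cell: "?a + w \<in> cell_image s" if "w \<in> tangent P s" "norm w < r" for w
    using that r1 by (simp add: r_def)
  have lip: "dist (pt P (?a + v)) (pt P (?a + w)) \<le> \<bar>L\<bar> * dist v w"
    if "v \<in> tangent P s" "norm v < r" "w \<in> tangent P s" "norm w < r" for v w
  proof -
    have "?a + v \<in> range (pos P)" "?a + w \<in> range (pos P)" using cell that by blast+
    then have "dist (pt P (?a + v)) (pt P (?a + w)) \<le> L * dist (?a + v) (?a + w)"
      using e(2)[rule_format, of "?a + v" "?a + w"] that by (simp add: r_def dist_norm)
    also have "\<dots> \<le> \<bar>L\<bar> * dist (?a + v) (?a + w)" by (intro mult_right_mono) auto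
    finally show ?thesis by simp
  qed
  have "\<exists>C. C-lipschitz_on (tangent P s \<inter> ball 0 \<rho>) (\<lambda>w. u (pt P (?a + w)))"
    if u: "lipschitz_fun P U u" and \<rho>: "\<rho> \<le> r" and U: "\<forall>w\<in>tangent P s. norm w < \<rho> \<longrightarrow> pt P (?a + w) \<in> U" for U u \<rho>
  proof -
    obtain C where C: "C \<ge> 0" "\<forall>x\<in>U. \<forall>y\<in>U. ennreal \<bar>u x - u y\<bar> \<le> ennreal C * intrinsic_dist P x y"
      using u unfolding lipschitz_fun_def by blast
    have "(C * (4 * \<Lambda>))-lipschitz_on (tangent P s \<inter> ball 0 \<rho>) (\<lambda>w. u (pt P (?a + w)))"
    proof (rule lipschitz_onI)
      fix v w assume vw: "v \<in> tangent P s \<inter> ball 0 \<rho>" "w \<in> tangent P s \<inter> ball 0 \<rho>"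
      show "dist (u (pt P (?a + v))) (u (pt P (?a + w))) \<le> C * (4 * \<Lambda>) * dist v w"
      \<comment> \<open>The distance estimate is stated for distinct points, since its detour point
        is taken from a ball of radius \<open>dist v w\<close>.\<close>
      proof (cases "v = w")
        case False
        have "ennreal \<bar>u (pt P (?a + v)) - u (pt P (?a + w))\<bar>
            \<le> ennreal C * intrinsic_dist P (pt P (?a + v)) (pt P (?a + w))"
          using C(2) U vw by simp
        also have "\<dots> \<le> ennreal C * ennreal (4 * \<Lambda> * dist v w)"
          using vw False \<rho> by (intro mult_left_mono intrinsic_dist_le[OF s x0 \<Lambda> cell lip]) auto
        also have "\<dots> = ennreal (C * (4 * \<Lambda>) * dist v w)"
          using C(1) \<Lambda>(1) by (simp add: ennreal_mult[symmetric] mult_ac)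
        finally show ?thesis
          using C(1) \<Lambda>(1) by (subst (asm) ennreal_le_iff) (auto simp: dist_real_def)
      qed simp
    qed (use C \<Lambda> in auto)
    then show ?thesis by blast
  qed
  then show ?thesis using cell r1(1) e(1) by (intro exI[of _ r]) (auto simp: r_def)
qed

end

section \<open>The energy estimate\<close>

definition squash :: "real \<Rightarrow> real" where
  "squash t = t\<^sup>2 / (1 + t\<^sup>2)"

lemma one_plus_square_pos: "0 < 1 + (t::real)\<^sup>2"
  by (rule add_pos_nonneg) auto

lemma squash_bounds: "0 \<le> squash t" "squash t \<le> 1" "squash t \<le> t\<^sup>2"
proof -
  show "0 \<le> squash t" by (simp add: squash_def)
  show "squash t \<le> 1" unfolding squash_def by (subst pos_divide_le_eq) (auto simp: one_plus_square_pos)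
  have "t\<^sup>2 / (1 + t\<^sup>2) \<le> t\<^sup>2 / 1" by (rule divide_left_mono) (auto simp: one_plus_square_pos)
  then show "squash t \<le> t\<^sup>2" by (simp add: squash_def)
qed

text \<open>The difference factors through \<open>a - b\<close>, and the cofactor is at most 1 by
  \<open>2 * \<bar>a\<bar> \<le> 1 + a\<^sup>2\<close> and the same bound for
  \<open>b\<close>.\<close>

lemma squash_lipschitz: "\<bar>squash a - squash b\<bar> \<le> \<bar>a - b\<bar>"
proof -
  have pos: "0 < (1 + a\<^sup>2) * (1 + b\<^sup>2)" by (intro mult_pos_pos one_plus_square_pos)
  have "squash a - squash b = (a - b) * ((a + b) / ((1 + a\<^sup>2) * (1 + b\<^sup>2)))"
    using one_plus_square_pos[of a] one_plus_square_pos[of b]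
    by (simp add: squash_def field_simps power2_eq_square)
  moreover have "\<bar>(a + b) / ((1 + a\<^sup>2) * (1 + b\<^sup>2))\<bar> \<le> 1"
  proof -
    have "2 * \<bar>a\<bar> \<le> 1 + a\<^sup>2" "2 * \<bar>b\<bar> \<le> 1 + b\<^sup>2"
      using sum_squares_bound[of 1 "\<bar>a\<bar>"] sum_squares_bound[of 1 "\<bar>b\<bar>"] by auto
    then have "\<bar>a + b\<bar> \<le> 1 + a\<^sup>2 + b\<^sup>2" using abs_triangle_ineq[of a b] zero_le_power2[of a] zero_le_power2[of b] by linarith
    also have "\<dots> \<le> (1 + a\<^sup>2) * (1 + b\<^sup>2)" by (simp add: algebra_simps)
    finally have "\<bar>a + b\<bar> / ((1 + a\<^sup>2) * (1 + b\<^sup>2)) \<le> 1" using pos by (subst pos_divide_le_eq) auto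
    then show ?thesis using pos by (simp only: abs_divide abs_of_pos)
  qed
  ultimately show ?thesis
    using mult_left_le[of "\<bar>(a + b) / ((1 + a\<^sup>2) * (1 + b\<^sup>2))\<bar>" "\<bar>a - b\<bar>"]
    by (simp only: abs_mult abs_ge_zero)
qed

lemma squash_derivative: "(squash has_field_derivative 2 * t / (1 + t\<^sup>2)\<^sup>2) (at t)"
proof -
  have nz: "1 + t\<^sup>2 \<noteq> 0" using one_plus_square_pos[of t] by simp
  show ?thesis
    unfolding squash_def
    by (rule derivative_eq_intros refl nz | simp add: nz)+ (simp add: power2_eq_square field_simps)
qed

lemma squash_derivative_bound: "\<bar>2 * t / (1 + t\<^sup>2)\<^sup>2\<bar> \<le> (1::real)"
proof -
  have "2 * \<bar>t\<bar> \<le> 1 + t\<^sup>2" using sum_squares_bound[of 1 "\<bar>t\<bar>"] by auto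
  also have "\<dots> \<le> (1 + t\<^sup>2)\<^sup>2" by (rule self_le_power) auto
  finally show ?thesis using one_plus_square_pos[of t] by (simp add: abs_mult abs_divide divide_le_eq)
qed

lemma abs_arctan_le_2: "\<bar>arctan t\<bar> \<le> 2"
  using arctan_bounded[of t] pi_less_4 by (simp add: abs_le_iff)

lemma arctan_lipschitz: "\<bar>arctan a - arctan b\<bar> \<le> \<bar>a - b\<bar>"
proof -
  have "norm (arctan a - arctan b) \<le> 1 * norm (a - b)"
  proof (rule field_differentiable_bound[of UNIV])
    show "(arctan has_field_derivative inverse (1 + t\<^sup>2)) (at t within UNIV)" for t
      using DERIV_arctan[of t] by simp
    show "norm (inverse (1 + t\<^sup>2)) \<le> 1" for t :: real
      using one_plus_square_pos[of t] by (simp add: field_simps)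
  qed auto
  then show ?thesis by simp
qed

text \<open>Meant for zeros of the cutoff: a function dominated by one with vanishing value and
  derivative is differentiable there, however irregular it is elsewhere.\<close>

lemma has_derivative_zero_dominated:
  fixes f g :: "'a::real_normed_vector \<Rightarrow> real"
  assumes "(g has_derivative (\<lambda>_. 0)) (at a within S)" "\<And>y. \<bar>f y\<bar> \<le> c * \<bar>g y\<bar>" "g a = 0"
  shows "(f has_derivative (\<lambda>_. 0)) (at a within S)"
proof -
  have fa: "f a = 0" using assms(2)[of a] assms(3) by simp
  have "((\<lambda>y. norm (g y) / norm (y - a)) \<longlongrightarrow> 0) (at a within S)"
    using assms(1,3) unfolding has_derivative_iff_norm by simp
  then have lim: "((\<lambda>y. c * (norm (g y) / norm (y - a))) \<longlongrightarrow> 0) (at a within S)"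
    by (rule tendsto_mult_right_zero)
  have "((\<lambda>y. norm (f y) / norm (y - a)) \<longlongrightarrow> 0) (at a within S)"
  proof (rule Lim_null_comparison[OF _ lim])
    show "\<forall>\<^sub>F y in at a within S. norm (norm (f y) / norm (y - a)) \<le> c * (norm (g y) / norm (y - a))"
      using assms(2) by (intro always_eventually allI) (simp add: divide_right_mono)
  qed
  then show ?thesis unfolding has_derivative_iff_norm by (simp add: fa)
qed

context riemannian_complex
begin

section \<open>The metric form at an elliptic point\<close>

lemma metric_linear:
  "metric_form P x (c *\<^sub>R u + d *\<^sub>R v) \<xi> = c * metric_form P x u \<xi> + d * metric_form P x v \<xi>"
  "metric_form P x (u - v) \<xi> = metric_form P x u \<xi> - metric_form P x v \<xi>"
  "metric_form P x \<xi> (c *\<^sub>R u + d *\<^sub>R v) = c * metric_form P x \<xi> u + d * metric_form P x \<xi> v"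
  "metric_form P x \<xi> (u - v) = metric_form P x \<xi> u - metric_form P x \<xi> v"
  "metric_form P x 0 \<xi> = 0" "metric_form P x \<xi> 0 = 0"
  using metric_bilinear[of x]
  by (simp_all add: bilinear_ladd bilinear_radd bilinear_lmul bilinear_rmul bilinear_lsub bilinear_rsub
      bilinear_lzero bilinear_rzero)

lemma elliptic_nonneg:
  assumes "elliptic \<Lambda> x" "\<xi> \<in> tangent P (carrier_simplex P x)"
  shows "0 \<le> metric_form P x \<xi> \<xi>"
proof -
  have "0 \<le> (norm \<xi>)\<^sup>2 / \<Lambda>\<^sup>2" by simp
  also have "\<dots> \<le> metric_form P x \<xi> \<xi>" using assms unfolding elliptic_def by blast
  finally show ?thesis .
qed

text \<open>Expand the nonnegative form at \<open>\<epsilon> *\<^sub>R u + v\<close> and at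
  \<open>\<epsilon> *\<^sub>R u - v\<close>, then divide by \<epsilon>.\<close>

lemma metric_young:
  assumes "elliptic \<Lambda> x" "u \<in> tangent P (carrier_simplex P x)" "v \<in> tangent P (carrier_simplex P x)" "0 < \<epsilon>"
  shows "2 * \<bar>metric_form P x u v\<bar> \<le> \<epsilon> * metric_form P x u u + metric_form P x v v / \<epsilon>"
proof -
  have "0 \<le> \<epsilon>\<^sup>2 * metric_form P x u u + metric_form P x v v + 2 * \<sigma> * \<epsilon> * metric_form P x u v"
    if "\<sigma>\<^sup>2 = 1" for \<sigma>
  proof -
    have "\<epsilon> *\<^sub>R u + \<sigma> *\<^sub>R v \<in> tangent P (carrier_simplex P x)"
      using assms subspace_tangent by (intro subspace_add subspace_scale) auto
    from elliptic_nonneg[OF assms(1) this]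
    have "0 \<le> \<epsilon>\<^sup>2 * metric_form P x u u + \<sigma>\<^sup>2 * metric_form P x v v + 2 * \<sigma> * \<epsilon> * metric_form P x u v"
      by (simp add: metric_linear metric_sym[of x v u] power2_eq_square algebra_simps)
    then show ?thesis using that by simp
  qed
  from this[of 1] this[of "- 1"]
  have "\<epsilon> * (2 * \<bar>metric_form P x u v\<bar>) \<le> \<epsilon>\<^sup>2 * metric_form P x u u + metric_form P x v v"
    by (simp add: abs_if algebra_simps)
  also have "\<dots> = \<epsilon> * (\<epsilon> * metric_form P x u u + metric_form P x v v / \<epsilon>)"
    using assms(4) by (simp add: power2_eq_square field_simps)
  finally show ?thesis using assms(4) by simp
qed

text \<open>The form at \<open>u + t *\<^sub>R v\<close> is nonnegative at its minimiser
  \<open>?t\<close>. Ellipticity makes the denominator positive when \<open>v\<close> is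
  nonzero.\<close>

lemma metric_Cauchy_Schwarz:
  assumes "elliptic \<Lambda> x" "\<Lambda> > 0" "u \<in> tangent P (carrier_simplex P x)" "v \<in> tangent P (carrier_simplex P x)"
  shows "(metric_form P x u v)\<^sup>2 \<le> metric_form P x u u * metric_form P x v v"
proof (cases "v = 0")
  case False
  then have "0 < (norm v)\<^sup>2 / \<Lambda>\<^sup>2" using assms by simp
  also have "\<dots> \<le> metric_form P x v v" using assms unfolding elliptic_def by blast
  finally have v: "0 < metric_form P x v v" .
  let ?t = "- metric_form P x u v / metric_form P x v v"
  have expand: "metric_form P x (1 *\<^sub>R u + t *\<^sub>R v) (1 *\<^sub>R u + t *\<^sub>R v)
      = metric_form P x u u + 2 * t * metric_form P x u v + t\<^sup>2 * metric_form P x v v" for t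
    unfolding metric_linear metric_sym[of x v u] by (simp add: power2_eq_square algebra_simps)
  have "1 *\<^sub>R u + ?t *\<^sub>R v \<in> tangent P (carrier_simplex P x)"
    using assms subspace_tangent by (intro subspace_add subspace_scale) auto
  from elliptic_nonneg[OF assms(1) this]
  have "0 \<le> metric_form P x u u + 2 * ?t * metric_form P x u v + ?t\<^sup>2 * metric_form P x v v"
    unfolding expand .
  also have "\<dots> = metric_form P x u u - (metric_form P x u v)\<^sup>2 / metric_form P x v v"
    using v by (simp add: power2_eq_square field_simps)
  finally show ?thesis using v by (simp add: field_simps)
qed (simp add: metric_linear)

lemma AE_elliptic: "\<exists>\<Lambda>>0. AE x in vol P. elliptic \<Lambda> x"
  using AE_vol_elliptic by (metis (mono_tags, lifting) eventually_mono)

lemma borel_measurable_restrict_indicator: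
  fixes f :: "'x \<Rightarrow> 'b::real_normed_vector"
  assumes "U \<in> sets borel"
  shows "f \<in> borel_measurable (restrict_space (vol P) U) \<longleftrightarrow> (\<lambda>x. indicator U x *\<^sub>R f x) \<in> borel_measurable (vol P)"
  using assms by (intro borel_measurable_restrict_space_iff) (simp add: sets_vol_borel)

lemma borel_measurable_restrict_UNIV [simp]:
  fixes f :: "'x \<Rightarrow> 'b::real_normed_vector"
  shows "f \<in> borel_measurable (restrict_space (vol P) UNIV) \<longleftrightarrow> f \<in> borel_measurable (vol P)"
  by (subst borel_measurable_restrict_indicator) auto

text \<open>\<open>q\<close> is Lipschitz on \<open>U\<close> only. If one of two points lies
  outside \<open>U\<close>, then \<open>w\<close> vanishes there, and the increment of the product
  is bounded by twice that of \<open>w\<close> alone.\<close>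

lemma lip_c_test_function:
  assumes w: "w \<in> lip_c P UNIV" and U: "closure {x. w x \<noteq> 0} \<subseteq> U" and q: "lipschitz_fun P U q"
  shows "(\<lambda>x. squash (w x) * arctan (q x)) \<in> lip_c P UNIV"
proof -
  let ?\<rho> = "\<lambda>x. squash (w x) * arctan (q x)"
  obtain C where C: "C \<ge> 0" "\<And>x y. ennreal \<bar>w x - w y\<bar> \<le> ennreal C * intrinsic_dist P x y"
    using w by (auto simp: lip_c_def lipschitz_fun_def)
  obtain C' where C': "C' \<ge> 0" "\<And>x y. x \<in> U \<Longrightarrow> y \<in> U \<Longrightarrow> ennreal \<bar>q x - q y\<bar> \<le> ennreal C' * intrinsic_dist P x y"
    using q by (auto simp: lipschitz_fun_def)
  have w0: "w x = 0" if "x \<notin> U" for x using U closure_subset[of "{x. w x \<noteq> 0}"] that by auto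
  have step: "\<bar>?\<rho> x - ?\<rho> y\<bar> \<le> (if x \<in> U \<and> y \<in> U then \<bar>q x - q y\<bar> else 0) + 2 * \<bar>w x - w y\<bar>" for x y
  proof -
    have "\<bar>squash (w x) - squash (w y)\<bar> * \<bar>arctan t\<bar> \<le> \<bar>w x - w y\<bar> * 2" for t
      by (intro mult_mono squash_lipschitz abs_arctan_le_2) auto
    note bound = this
    show ?thesis
    proof (cases "x \<in> U \<and> y \<in> U")
      case True
      have "?\<rho> x - ?\<rho> y = squash (w x) * (arctan (q x) - arctan (q y)) + (squash (w x) - squash (w y)) * arctan (q y)"
        by (simp add: algebra_simps)
      then have "\<bar>?\<rho> x - ?\<rho> y\<bar> \<le> squash (w x) * \<bar>arctan (q x) - arctan (q y)\<bar> + \<bar>squash (w x) - squash (w y)\<bar> * \<bar>arctan (q y)\<bar>"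
        using squash_bounds(1)[of "w x"] by (metis abs_mult abs_of_nonneg abs_triangle_ineq)
      also have "\<dots> \<le> 1 * \<bar>q x - q y\<bar> + \<bar>w x - w y\<bar> * 2"
        by (intro add_mono mult_mono bound squash_bounds arctan_lipschitz) auto
      finally show ?thesis using True by simp
    next
      case False
      then consider "w x = 0" | "w y = 0" using w0 by blast
      then show ?thesis
      proof cases
        case 1
        then show ?thesis using bound[of "q y"] unfolding if_not_P[OF False] by (simp add: squash_def abs_mult)
      next
        case 2
        then show ?thesis using bound[of "q x"] unfolding if_not_P[OF False] by (simp add: squash_def abs_mult)
      qed
    qed
  qed
  have "lipschitz_fun P UNIV ?\<rho>"
    unfolding lipschitz_fun_def
  proof (intro exI conjI ballI)
    show "0 \<le> C' + 2 * C" using C C' by simp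
    fix x y
    let ?d = "intrinsic_dist P x y"
    have "ennreal \<bar>?\<rho> x - ?\<rho> y\<bar> \<le> ennreal ((if x \<in> U \<and> y \<in> U then \<bar>q x - q y\<bar> else 0) + 2 * \<bar>w x - w y\<bar>)"
      by (rule ennreal_leI[OF step])
    also have "\<dots> = ennreal (if x \<in> U \<and> y \<in> U then \<bar>q x - q y\<bar> else 0) + ennreal 2 * ennreal \<bar>w x - w y\<bar>"
      by (subst ennreal_plus) (auto simp: ennreal_mult)
    also have "\<dots> \<le> ennreal C' * ?d + ennreal 2 * (ennreal C * ?d)"
      using C C' by (intro add_mono mult_left_mono) auto
    also have "\<dots> = ennreal (C' + 2 * C) * ?d"
      using C C' by (simp add: ennreal_plus ennreal_mult distrib_right mult.assoc)
    finally show "ennreal \<bar>?\<rho> x - ?\<rho> y\<bar> \<le> ennreal (C' + 2 * C) * ?d" .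
  qed
  moreover have "compact (closure {x. ?\<rho> x \<noteq> 0})"
  proof -
    have "{x. ?\<rho> x \<noteq> 0} \<subseteq> {x. w x \<noteq> 0}" by (auto simp: squash_def)
    then have "closure {x. w x \<noteq> 0} \<inter> closure {x. ?\<rho> x \<noteq> 0} = closure {x. ?\<rho> x \<noteq> 0}"
      using closure_mono by blast
    moreover have "compact (closure {x. w x \<noteq> 0})" using w by (simp add: lip_c_def)
    then have "compact (closure {x. w x \<noteq> 0} \<inter> closure {x. ?\<rho> x \<noteq> 0})" by (rule compact_Int_closed) simp
    ultimately show ?thesis by (rule subst)
  qed
  ultimately show ?thesis by (simp add: lip_c_def)
qed

text \<open>The chain rule on \<open>U\<close>, and 0 elsewhere, where \<open>Q\<close> carries no
  information and \<open>w\<close> vanishes.\<close>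

definition test_gradient :: "'x set \<Rightarrow> ('x \<Rightarrow> real) \<Rightarrow> ('x \<Rightarrow> 'e) \<Rightarrow> ('x \<Rightarrow> real) \<Rightarrow> ('x \<Rightarrow> 'e) \<Rightarrow> 'x \<Rightarrow> 'e" where
  "test_gradient U w W q Q x = (if x \<in> U then
     (2 * w x / (1 + (w x)\<^sup>2)\<^sup>2 * arctan (q x)) *\<^sub>R W x + (squash (w x) / (1 + (q x)\<^sup>2)) *\<^sub>R Q x else 0)"

lemma has_gradient_test_function:
  assumes U: "U \<in> sets borel" and w0: "\<And>x. x \<notin> U \<Longrightarrow> w x = 0"
    and w: "w \<in> borel_measurable (vol P)" "has_gradient_on P UNIV w W"
    and q: "q \<in> borel_measurable (restrict_space (vol P) U)" "has_gradient_on P U q Q"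
  shows "has_gradient_on P UNIV (\<lambda>x. squash (w x) * arctan (q x)) (test_gradient U w W q Q)"
proof -
  let ?\<rho> = "\<lambda>x. squash (w x) * arctan (q x)" and ?R = "test_gradient U w W q Q"
  have vf: "vector_field_on P UNIV W" "vector_field_on P U Q" using w q by (auto simp: has_gradient_on_def)
  have W [measurable]: "W \<in> borel_measurable (vol P)"
    using vf(1) by (simp add: vector_field_on_def)
  have [measurable]: "U \<in> sets (vol P)" using U by (rule sets_vol_borel)
  have [measurable]: "(\<lambda>x. indicator U x *\<^sub>R Q x) \<in> borel_measurable (vol P)"
    "(\<lambda>x. indicator U x *\<^sub>R q x) \<in> borel_measurable (vol P)"
    using vf(2) q(1) by (simp_all only: vector_field_on_def borel_measurable_restrict_indicator[OF U])
  note [measurable] = w(1)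
  \<comment> \<open>\<open>q\<close> and \<open>Q\<close> are measurable on \<open>U\<close> only,
    so they must appear multiplied by its indicator.\<close>
  have R_eq: "?R x = (2 * w x / (1 + (w x)\<^sup>2)\<^sup>2 * arctan (indicator U x *\<^sub>R q x)) *\<^sub>R (indicator U x *\<^sub>R W x)
      + ((w x)\<^sup>2 / (1 + (w x)\<^sup>2) / (1 + (indicator U x *\<^sub>R q x)\<^sup>2)) *\<^sub>R (indicator U x *\<^sub>R Q x)" for x
    by (simp add: test_gradient_def squash_def)
  have [measurable]: "arctan \<in> borel_measurable borel"
    by (intro borel_measurable_continuous_onI continuous_on_arctan continuous_on_id)
  have "?R \<in> borel_measurable (vol P)"
    unfolding R_eq[abs_def] by measurable
  moreover have "AE x in vol P. ?R x \<in> tangent P (carrier_simplex P x)"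
  proof -
    have "AE x in vol P. x \<in> UNIV \<longrightarrow> W x \<in> tangent P (carrier_simplex P x)"
      "AE x in vol P. x \<in> U \<longrightarrow> Q x \<in> tangent P (carrier_simplex P x)"
      using vf by (auto simp: vector_field_on_def)
    then show ?thesis
    proof eventually_elim
      case (elim x)
      then show ?case
        using subspace_tangent[of "carrier_simplex P x"]
        by (auto simp: test_gradient_def intro!: subspace_add subspace_scale subspace_0)
    qed
  qed
  moreover have "AE x in vol P. x \<in> UNIV \<longrightarrow> (let s = carrier_simplex P x
         in \<exists>L. ((\<lambda>y. ?\<rho> (pt P y)) has_derivative L) (at (pos P x) within cell_image s) \<and>
                (\<forall>\<xi>\<in>tangent P s. metric_form P x (?R x) \<xi> = L \<xi>))"
  proof -
    have "AE x in vol P. x \<in> UNIV \<longrightarrow> (let s = carrier_simplex P x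
         in \<exists>L. ((\<lambda>y. w (pt P y)) has_derivative L) (at (pos P x) within cell_image s) \<and>
                (\<forall>\<xi>\<in>tangent P s. metric_form P x (W x) \<xi> = L \<xi>))"
      "AE x in vol P. x \<in> U \<longrightarrow> (let s = carrier_simplex P x
         in \<exists>L. ((\<lambda>y. q (pt P y)) has_derivative L) (at (pos P x) within cell_image s) \<and>
                (\<forall>\<xi>\<in>tangent P s. metric_form P x (Q x) \<xi> = L \<xi>))"
      using w q by (auto simp: has_gradient_on_def)
    then show ?thesis
    proof eventually_elim
      case (elim x)
      let ?s = "carrier_simplex P x"
      let ?F = "at (pos P x) within cell_image ?s"
      from elim(1) obtain L where L: "((\<lambda>y. w (pt P y)) has_derivative L) ?F"
        "\<forall>\<xi>\<in>tangent P ?s. metric_form P x (W x) \<xi> = L \<xi>" by (auto simp: Let_def)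
      have "\<exists>L. ((\<lambda>y. ?\<rho> (pt P y)) has_derivative L) ?F \<and>
                (\<forall>\<xi>\<in>tangent P ?s. metric_form P x (?R x) \<xi> = L \<xi>)"
      proof (cases "x \<in> U")
        case True
        with elim(2) obtain L' where L': "((\<lambda>y. q (pt P y)) has_derivative L') ?F"
          "\<forall>\<xi>\<in>tangent P ?s. metric_form P x (Q x) \<xi> = L' \<xi>" by (auto simp: Let_def)
        have 1: "((\<lambda>y. squash (w (pt P y))) has_derivative (\<lambda>\<xi>. L \<xi> * (2 * w x / (1 + (w x)\<^sup>2)\<^sup>2))) ?F"
          by (rule DERIV_compose_FDERIV[OF _ L(1)]) (simp add: squash_derivative)
        have 2: "((\<lambda>y. arctan (q (pt P y))) has_derivative (\<lambda>\<xi>. L' \<xi> * inverse (1 + (q x)\<^sup>2))) ?F"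
          by (rule DERIV_compose_FDERIV[OF _ L'(1)]) (simp add: DERIV_arctan)
        have "metric_form P x (?R x) \<xi> = squash (w (pt P (pos P x))) * (L' \<xi> * inverse (1 + (q x)\<^sup>2))
            + L \<xi> * (2 * w x / (1 + (w x)\<^sup>2)\<^sup>2) * arctan (q (pt P (pos P x)))" if "\<xi> \<in> tangent P ?s" for \<xi>
          using that True L(2) L'(2) by (simp add: test_gradient_def metric_linear field_simps)
        then show ?thesis using has_derivative_mult[OF 1 2] by blast
      next
        \<comment> \<open>\<open>q\<close> may be irregular here, but the product is \<open>O(w\<^sup>2)\<close> at a zero of \<open>w\<close>.\<close>
        case False
        have "((\<lambda>y. (w (pt P y))\<^sup>2) has_derivative (\<lambda>_. 0)) ?F"
          using has_derivative_power[OF L(1), of 2] w0[OF False] by simp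
        moreover have "\<bar>?\<rho> (pt P y)\<bar> \<le> 2 * \<bar>(w (pt P y))\<^sup>2\<bar>" for y
        proof -
          have "\<bar>?\<rho> (pt P y)\<bar> = squash (w (pt P y)) * \<bar>arctan (q (pt P y))\<bar>"
            using squash_bounds(1) by (simp add: abs_mult)
          also have "\<dots> \<le> (w (pt P y))\<^sup>2 * 2" by (intro mult_mono squash_bounds abs_arctan_le_2) auto
          finally show ?thesis by simp
        qed
        ultimately have "((\<lambda>y. ?\<rho> (pt P y)) has_derivative (\<lambda>_. 0)) ?F"
          by (rule has_derivative_zero_dominated) (simp add: w0[OF False])
        moreover have "metric_form P x (?R x) \<xi> = 0" for \<xi>
          using False by (simp add: test_gradient_def metric_linear)
        ultimately show ?thesis by (intro exI[of _ "\<lambda>_. 0"]) simp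
      qed
      then show ?case by (simp add: Let_def)
    qed
  qed
  ultimately show ?thesis
    by (simp add: has_gradient_on_def vector_field_on_def)
qed

section \<open>Vector fields of finite energy\<close>

lemma vector_field_diff:
  assumes "vector_field_on P U G" "vector_field_on P U H"
  shows "vector_field_on P U (\<lambda>x. G x - H x)"
  using assms subspace_diff[OF subspace_tangent]
  unfolding vector_field_on_def by (auto elim: eventually_elim2)

lemma vector_field_subset:
  assumes "vector_field_on P U G" "V \<subseteq> U" "U \<in> sets borel" "V \<in> sets borel"
  shows "vector_field_on P V G"
proof -
  have [measurable]: "(\<lambda>x. indicator U x *\<^sub>R G x) \<in> borel_measurable (vol P)" "V \<in> sets (vol P)"
    using assms(1) sets_vol_borel[OF assms(4)]
    unfolding vector_field_on_def borel_measurable_restrict_indicator[OF assms(3)] by auto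
  have "(\<lambda>x. indicator V x *\<^sub>R (indicator U x *\<^sub>R G x)) \<in> borel_measurable (vol P)"
    by measurable
  moreover have "indicator V x *\<^sub>R (indicator U x *\<^sub>R G x) = indicator V x *\<^sub>R G x" for x
    using assms(2) by (auto split: split_indicator)
  ultimately have "(\<lambda>x. indicator V x *\<^sub>R G x) \<in> borel_measurable (vol P)" by (simp only:)
  moreover have "AE x in vol P. x \<in> V \<longrightarrow> G x \<in> tangent P (carrier_simplex P x)"
    using assms(1,2) unfolding vector_field_on_def by (auto elim!: eventually_mono)
  ultimately show ?thesis
    by (simp add: vector_field_on_def borel_measurable_restrict_indicator[OF assms(4)])
qed

lemma AE_metric_nonneg:
  assumes "vector_field_on P U G"
  shows "AE x in vol P. x \<in> U \<longrightarrow> 0 \<le> metric_form P x (G x) (G x)"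
proof -
  obtain \<Lambda> where "AE x in vol P. elliptic \<Lambda> x" using AE_elliptic by blast
  moreover have "AE x in vol P. x \<in> U \<longrightarrow> G x \<in> tangent P (carrier_simplex P x)"
    using assms by (simp add: vector_field_on_def)
  ultimately show ?thesis by eventually_elim (auto intro: elliptic_nonneg)
qed

lemma integrable_metric:
  assumes G: "vector_field_on P U G" and U: "U \<in> sets borel" and fin: "dirichlet_integral P U G \<le> ennreal E"
    and "0 \<le> E"
  shows "integrable (vol P) (\<lambda>x. metric_form P x (G x) (G x) * indicator U x)"
    and "(\<integral>x. metric_form P x (G x) (G x) * indicator U x \<partial>vol P) \<le> E"
proof -
  let ?f = "\<lambda>x. metric_form P x (G x) (G x) * indicator U x"
  have nn: "AE x in vol P. 0 \<le> ?f x"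
    using AE_metric_nonneg[OF G] by eventually_elim (auto split: split_indicator)
  have "(\<integral>\<^sup>+x. ennreal (?f x) \<partial>vol P) = dirichlet_integral P U G"
    unfolding dirichlet_integral_def by (intro nn_integral_cong) (auto split: split_indicator)
  then have le: "(\<integral>\<^sup>+x. ennreal (?f x) \<partial>vol P) \<le> ennreal E" using fin by simp
  then show int: "integrable (vol P) ?f"
    using nn by (intro integrableI_nonneg metric_form_vector_fields_measurable[OF G G U])
      (auto intro: le_less_trans)
  have "ennreal (\<integral>x. ?f x \<partial>vol P) \<le> ennreal E"
    using le nn_integral_eq_integral[OF int nn] by simp
  then show "(\<integral>x. ?f x \<partial>vol P) \<le> E" using \<open>0 \<le> E\<close> by simp
qed

text \<open>Substituting \<open>Q = G + ?D\<close> in the test gradient gives the weighted energy of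
  \<open>G\<close> plus the products of \<open>G\<close> with \<open>W\<close> and with
  \<open>?D\<close>, whose coefficients are at most 2 and 1 in absolute value. Harmonicity makes the
  integral of the whole 0. Young's inequality with parameter \<epsilon> balances errors of energy
  \<open>\<epsilon>\<^sup>2\<close> against \<open>\<epsilon> * E\<close>, leaving a bound of order
  \<epsilon>.\<close>

lemma energy_estimate:
  assumes harm: "weakly_harmonic P f" and grad: "weak_gradient P f G"
    and E: "dirichlet_integral P UNIV G \<le> ennreal E" "0 \<le> E" and \<epsilon>: "0 < \<epsilon>"
    and U: "rel_compact_domain U" and supp: "closure {x. w x \<noteq> 0} \<subseteq> U"
    and w: "w \<in> lip_c P UNIV" "w \<in> borel_measurable (vol P)" "has_gradient_on P UNIV w W"
      "dirichlet_integral P UNIV W \<le> ennreal (\<epsilon>\<^sup>2)"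
    and q: "lipschitz_fun P U q" "q \<in> borel_measurable (restrict_space (vol P) U)" "has_gradient_on P U q Q"
      "dirichlet_integral P U (\<lambda>x. Q x - G x) \<le> ennreal (\<epsilon>\<^sup>2)"
  shows "(\<integral>\<^sup>+x\<in>U. ennreal (squash (w x) / (1 + (q x)\<^sup>2) * metric_form P x (G x) (G x)) \<partial>vol P)
     \<le> ennreal (\<epsilon> * (2 * E + 2))"
proof -
  let ?R = "test_gradient U w W q Q" and ?D = "\<lambda>x. Q x - G x"
  let ?b = "\<lambda>x. squash (w x) / (1 + (q x)\<^sup>2)"
  let ?g = "\<lambda>A B x. metric_form P x (A x) (B x) * indicator U x"
  have Ub: "U \<in> sets borel" using U by (simp add: rel_compact_domain_def)
  have w0: "w x = 0" if "x \<notin> U" for x using supp closure_subset[of "{x. w x \<noteq> 0}"] that by auto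
  have vG: "vector_field_on P U G"
    using grad U by (auto simp: weak_gradient_def W12_grad_def sobolev_closure_def)
  have vQ: "vector_field_on P U Q" using q by (simp add: has_gradient_on_def)
  have vW': "vector_field_on P UNIV W" using w by (simp add: has_gradient_on_def)
  then have vW: "vector_field_on P U W" by (rule vector_field_subset) (use Ub in auto)
  have vD: "vector_field_on P U ?D" by (rule vector_field_diff[OF vQ vG])
  have gradR: "has_gradient_on P UNIV (\<lambda>x. squash (w x) * arctan (q x)) ?R"
    by (rule has_gradient_test_function[OF Ub w0 w(2,3) q(2,3)])
  then have "vector_field_on P UNIV ?R" unfolding has_gradient_on_def by (rule conjunct1)
  then have vR: "vector_field_on P U ?R" by (rule vector_field_subset) (use Ub in auto)
  have sub: "dirichlet_integral P U H \<le> dirichlet_integral P UNIV H" for H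
    unfolding dirichlet_integral_def by (intro nn_integral_mono) (auto split: split_indicator)
  have \<epsilon>2: "0 \<le> \<epsilon>\<^sup>2" by simp
  note iG = integrable_metric[OF vG Ub order_trans[OF sub E(1)] E(2)]
  note iW = integrable_metric[OF vW Ub order_trans[OF sub w(4)] \<epsilon>2]
  note iD = integrable_metric[OF vD Ub q(4) \<epsilon>2]
  obtain \<Lambda> where ell: "AE x in vol P. elliptic \<Lambda> x" using AE_elliptic by blast
  have tan: "AE x in vol P. x \<in> U \<longrightarrow> G x \<in> tangent P (carrier_simplex P x)"
    "AE x in vol P. x \<in> U \<longrightarrow> W x \<in> tangent P (carrier_simplex P x)"
    "AE x in vol P. x \<in> U \<longrightarrow> Q x \<in> tangent P (carrier_simplex P x)"
    using vG vW vQ by (auto simp: vector_field_on_def)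
  have b: "0 \<le> ?b x" "?b x \<le> 1" for x
  proof -
    show "0 \<le> ?b x" using squash_bounds(1)[of "w x"] one_plus_square_pos[of "q x"] by simp
    have "squash (w x) \<le> 1 + (q x)\<^sup>2" using squash_bounds(2)[of "w x"] zero_le_power2[of "q x"] by linarith
    then show "?b x \<le> 1" using one_plus_square_pos[of "q x"] by (subst pos_divide_le_eq) auto
  qed
  have split: "AE x in vol P. (\<forall>\<delta>>0. \<bar>?g G ?R x - ?b x * ?g G G x\<bar> \<le>
      \<delta> * ?g G G x + ?g W W x / \<delta> + (\<delta> * ?g G G x + ?g ?D ?D x / \<delta>) / 2)"
    using ell tan
  proof eventually_elim
    case (elim x)
    show ?case
    proof (cases "x \<in> U")
      case True
      let ?T = "tangent P (carrier_simplex P x)" and ?m = "metric_form P x"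
      let ?c = "2 * w x / (1 + (w x)\<^sup>2)\<^sup>2 * arctan (q x)"
      have T: "G x \<in> ?T" "W x \<in> ?T" "?D x \<in> ?T" using elim True subspace_diff[OF subspace_tangent] by auto
      have c: "\<bar>?c\<bar> \<le> 1 * 2" unfolding abs_mult[of "2 * w x / (1 + (w x)\<^sup>2)\<^sup>2"]
        by (intro mult_mono squash_derivative_bound abs_arctan_le_2) auto
      have "?m (G x) (?R x) - ?b x * ?m (G x) (G x) = ?c * ?m (G x) (W x) + ?b x * ?m (G x) (?D x)"
        using True by (simp add: test_gradient_def metric_linear algebra_simps)
      then have eq: "\<bar>?m (G x) (?R x) - ?b x * ?m (G x) (G x)\<bar> \<le> \<bar>?c\<bar> * \<bar>?m (G x) (W x)\<bar> + ?b x * \<bar>?m (G x) (?D x)\<bar>"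
        using b(1)[of x] by (metis abs_mult abs_of_nonneg abs_triangle_ineq)
      also have "\<dots> \<le> 2 * \<bar>?m (G x) (W x)\<bar> + 1 * \<bar>?m (G x) (?D x)\<bar>"
        using c b by (intro add_mono mult_right_mono) auto
      finally have "\<bar>?m (G x) (?R x) - ?b x * ?m (G x) (G x)\<bar> \<le> 2 * \<bar>?m (G x) (W x)\<bar> + \<bar>?m (G x) (?D x)\<bar>" by simp
      note bound = this
      have young: "2 * \<bar>?m (G x) (W x)\<bar> \<le> \<delta> * ?m (G x) (G x) + ?m (W x) (W x) / \<delta>"
        "2 * \<bar>?m (G x) (?D x)\<bar> \<le> \<delta> * ?m (G x) (G x) + ?m (?D x) (?D x) / \<delta>" if "0 < \<delta>" for \<delta>
        using metric_young[OF elim(1) T(1) T(2) that] metric_young[OF elim(1) T(1) T(3) that] by auto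
      show ?thesis
      proof (intro allI impI)
        fix \<delta> :: real assume \<delta>: "0 < \<delta>"
        have "\<bar>?m (G x) (?R x) - ?b x * ?m (G x) (G x)\<bar>
            \<le> \<delta> * ?m (G x) (G x) + ?m (W x) (W x) / \<delta> + (\<delta> * ?m (G x) (G x) + ?m (?D x) (?D x) / \<delta>) / 2"
        proof -
          have "s \<le> u + v / 2" if "s \<le> 2 * y + z" "2 * y \<le> u" "2 * z \<le> v" for s y z u v :: real
            using that by simp
          then show ?thesis using bound young[OF \<delta>] by blast
        qed
        then show "\<bar>?g G ?R x - ?b x * ?g G G x\<bar> \<le>
            \<delta> * ?g G G x + ?g W W x / \<delta> + (\<delta> * ?g G G x + ?g ?D ?D x / \<delta>) / 2"
          using True by simp
      qed
    qed simp
  qed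
  have nonneg: "AE x in vol P. 0 \<le> ?g G G x"
    using AE_metric_nonneg[OF vG] by eventually_elim (auto split: split_indicator)
  have [measurable]: "(\<lambda>x. indicator U x *\<^sub>R q x) \<in> borel_measurable (vol P)" "w \<in> borel_measurable (vol P)"
    "?g G G \<in> borel_measurable (vol P)"
    using q(2) w(2) metric_form_vector_fields_measurable[OF vG vG Ub]
    by (simp_all only: borel_measurable_restrict_indicator[OF Ub])
  have bG_eq: "?b x * ?g G G x = (w x)\<^sup>2 / (1 + (w x)\<^sup>2) / (1 + (indicator U x *\<^sub>R q x)\<^sup>2) * ?g G G x" for x
    by (simp add: squash_def split: split_indicator)
  have bGm [measurable]: "(\<lambda>x. ?b x * ?g G G x) \<in> borel_measurable (vol P)"
    unfolding bG_eq by measurable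
  have ibG: "integrable (vol P) (\<lambda>x. ?b x * ?g G G x)"
  proof (rule Bochner_Integration.integrable_bound[OF iG(1) bGm])
    show "AE x in vol P. norm (?b x * ?g G G x) \<le> norm (?g G G x)"
    proof (intro AE_I2)
      fix x
      have "\<bar>?b x\<bar> * \<bar>?g G G x\<bar> \<le> 1 * \<bar>?g G G x\<bar>"
        using b[of x] by (intro mult_right_mono) auto
      then show "norm (?b x * ?g G G x) \<le> norm (?g G G x)"
        unfolding real_norm_def abs_mult[of "?b x"] by simp
    qed
  qed
  let ?H = "\<lambda>x. \<epsilon> * ?g G G x + ?g W W x / \<epsilon> + (\<epsilon> * ?g G G x + ?g ?D ?D x / \<epsilon>) / 2"
  have iH: "integrable (vol P) ?H"
    using iG(1) iW(1) iD(1) by (intro Bochner_Integration.integrable_add integrable_mult_right integrable_divide)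
  \<comment> \<open>Harmonicity states that a Bochner integral is 0, which also holds by convention
    for a nonintegrable function. Integrability is therefore obtained separately, from the pointwise
    Young bound.\<close>
  have igR: "integrable (vol P) (?g G ?R)"
  proof -
    have "integrable (vol P) (\<lambda>x. ?g G ?R x - ?b x * ?g G G x)"
    proof (rule Bochner_Integration.integrable_bound[OF iH])
      show "(\<lambda>x. ?g G ?R x - ?b x * ?g G G x) \<in> borel_measurable (vol P)"
        using metric_form_vector_fields_measurable[OF vG vR Ub] bGm by (rule borel_measurable_diff)
      show "AE x in vol P. norm (?g G ?R x - ?b x * ?g G G x) \<le> norm (?H x)"
        using split by eventually_elim (use \<epsilon> in \<open>auto intro: order_trans[OF _ abs_ge_self]\<close>)
    qed
    from Bochner_Integration.integrable_add[OF this ibG] show ?thesis by simp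
  qed
  have "(\<integral>x. ?g G ?R x \<partial>vol P) = (\<integral>x. metric_form P x (G x) (?R x) \<partial>vol P)"
    by (intro Bochner_Integration.integral_cong) (auto simp: test_gradient_def metric_linear split: split_indicator)
  also have "\<dots> = 0"
    using harm grad gradR lip_c_test_function[OF w(1) supp q(1)] unfolding weakly_harmonic_def by blast
  finally have zero: "(\<integral>x. ?g G ?R x \<partial>vol P) = 0" .
  have "(\<integral>x. ?b x * ?g G G x \<partial>vol P) \<le> (\<integral>x. ?g G ?R x + ?H x \<partial>vol P)"
  proof (rule integral_mono_AE[OF ibG Bochner_Integration.integrable_add[OF igR iH]])
    show "AE x in vol P. ?b x * ?g G G x \<le> ?g G ?R x + ?H x"
      using split
    proof eventually_elim
      case (elim x)
      from elim[rule_format, OF \<epsilon>] show ?case by linarith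
    qed
  qed
  also have "\<dots> = (\<integral>x. ?H x \<partial>vol P)"
    using Bochner_Integration.integral_add[OF igR iH] zero by simp
  also have "\<dots> = \<epsilon> * (\<integral>x. ?g G G x \<partial>vol P) + (\<integral>x. ?g W W x \<partial>vol P) / \<epsilon>
      + (\<epsilon> * (\<integral>x. ?g G G x \<partial>vol P) + (\<integral>x. ?g ?D ?D x \<partial>vol P) / \<epsilon>) / 2"
    using iG(1) iW(1) iD(1) by simp
  also have "\<dots> \<le> \<epsilon> * E + \<epsilon>\<^sup>2 / \<epsilon> + (\<epsilon> * E + \<epsilon>\<^sup>2 / \<epsilon>) / 2"
    using iG(2) iW(2) iD(2) \<epsilon> by (intro add_mono mult_left_mono divide_right_mono) auto
  \<comment> \<open>The sum is three halves of \<open>\<epsilon> * E + \<epsilon>\<close>, rounded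
    up to a factor 2.\<close>
  also have "\<dots> \<le> \<epsilon> * (2 * E + 2)"
  proof -
    have "\<epsilon>\<^sup>2 / \<epsilon> = \<epsilon>" using \<epsilon> by (simp add: power2_eq_square)
    moreover have "0 \<le> \<epsilon> * E" using \<epsilon> E by simp
    ultimately show ?thesis using \<epsilon> by (simp add: algebra_simps)
  qed
  finally have le: "(\<integral>x. ?b x * ?g G G x \<partial>vol P) \<le> \<epsilon> * (2 * E + 2)" .
  have "(\<integral>\<^sup>+x\<in>U. ennreal (?b x * metric_form P x (G x) (G x)) \<partial>vol P) = (\<integral>\<^sup>+x. ennreal (?b x * ?g G G x) \<partial>vol P)"
    by (intro nn_integral_cong) (auto split: split_indicator)
  also have "\<dots> = ennreal (\<integral>x. ?b x * ?g G G x \<partial>vol P)"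
  proof (rule nn_integral_eq_integral[OF ibG])
    show "AE x in vol P. 0 \<le> ?b x * ?g G G x"
      using nonneg by eventually_elim (rule mult_nonneg_nonneg[OF b(1)])
  qed
  also have "\<dots> \<le> ennreal (\<epsilon> * (2 * E + 2))" using le by (rule ennreal_leI)
  finally show ?thesis .
qed

end

section \<open>Vanishing of the gradient\<close>

lemma AE_tendsto_0_of_summable_integrals:
  fixes a :: "nat \<Rightarrow> 'a \<Rightarrow> real"
  assumes [measurable]: "\<And>j. (\<lambda>x. a j x * indicator D x) \<in> borel_measurable M"
    and le: "\<And>j. (\<integral>\<^sup>+x\<in>D. ennreal (a j x) \<partial>M) \<le> ennreal (C * (1 / 2) ^ j)" and "0 \<le> C"
  shows "AE x in M. x \<in> D \<longrightarrow> (\<lambda>j. max 0 (a j x)) \<longlonglongrightarrow> 0"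
proof -
  \<comment> \<open>Conversion to \<open>ennreal\<close> discards negative values, so the integrals
    control only positive parts. Their series has finite integral, hence is finite almost everywhere
    and its terms tend to 0, without passing to a subsequence.\<close>
  let ?b = "\<lambda>j x. max 0 (a j x * indicator D x)"
  have b: "(\<integral>\<^sup>+x. ennreal (?b j x) \<partial>M) \<le> ennreal (C * (1 / 2) ^ j)" for j
  proof -
    have "(\<integral>\<^sup>+x. ennreal (?b j x) \<partial>M) = (\<integral>\<^sup>+x\<in>D. ennreal (a j x) \<partial>M)"
      by (intro nn_integral_cong) (auto split: split_indicator simp: max_def ennreal_neg)
    then show ?thesis using le by simp
  qed
  have "(\<integral>\<^sup>+x. (\<Sum>j. ennreal (?b j x)) \<partial>M) = (\<Sum>j. \<integral>\<^sup>+x. ennreal (?b j x) \<partial>M)"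
    by (intro nn_integral_suminf) measurable
  also have "\<dots> \<le> (\<Sum>j. ennreal (C * (1 / 2) ^ j))" by (intro suminf_le b) auto
  also have "\<dots> = ennreal (\<Sum>j. C * (1 / 2) ^ j)"
    using \<open>0 \<le> C\<close> by (intro suminf_ennreal2) (auto intro: summable_mult summable_geometric)
  also have "\<dots> < \<infinity>" by simp
  finally have "AE x in M. (\<Sum>j. ennreal (?b j x)) \<noteq> \<infinity>"
    by (intro nn_integral_PInf_AE) auto
  then show ?thesis
  proof eventually_elim
    case (elim x)
    then have "summable (\<lambda>j. ?b j x)" by (intro summable_suminf_not_top) auto
    then have "(\<lambda>j. ?b j x) \<longlonglongrightarrow> 0" by (rule summable_LIMSEQ_zero)
    then show ?case by auto
  qed
qed

lemma ennreal_tendsto_0_of_cmult_le: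
  fixes A B :: "nat \<Rightarrow> ennreal"
  assumes "0 < \<kappa>" "\<And>k. ennreal \<kappa> * A k \<le> B k" "B \<longlonglongrightarrow> 0"
  shows "A \<longlonglongrightarrow> 0"
proof -
  have lim: "(\<lambda>k. ennreal (1 / \<kappa>) * B k) \<longlonglongrightarrow> 0"
    using ennreal_tendsto_cmult[OF _ assms(3), of "ennreal (1 / \<kappa>)"] by simp
  have "A k \<le> ennreal (1 / \<kappa>) * B k" for k
  proof -
    have "A k = ennreal (1 / \<kappa>) * (ennreal \<kappa> * A k)"
      using assms(1) by (simp add: mult.assoc[symmetric] ennreal_mult[symmetric])
    also have "\<dots> \<le> ennreal (1 / \<kappa>) * B k" by (intro mult_left_mono assms(2)) simp
    finally show ?thesis .
  qed
  then show ?thesis by (intro tendsto_sandwich[OF _ _ tendsto_const lim]) auto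
qed

text \<open>A cell may have empty interior in the ambient space. In a direction along which both
  signs of small \<open>t\<close> stay in \<open>S\<close>, restriction to the line nevertheless
  yields a two-sided derivative.\<close>

lemma has_derivative_imp_directional_limit:
  fixes F :: "'a::real_normed_vector \<Rightarrow> real"
  assumes F: "(F has_derivative L) (at c within S)" and S: "\<forall>\<^sub>F t in at (0::real). c + t *\<^sub>R \<xi> \<in> S" and "c \<in> S"
  shows "((\<lambda>t. (F (c + t *\<^sub>R \<xi>) - F c) / t) \<longlongrightarrow> L \<xi>) (at 0)"
proof -
  obtain e where e: "0 < e" "\<And>t. t \<noteq> 0 \<Longrightarrow> \<bar>t\<bar> < e \<Longrightarrow> c + t *\<^sub>R \<xi> \<in> S"
    using S unfolding eventually_at by (auto simp: dist_real_def)
  have sub: "(\<lambda>t. c + t *\<^sub>R \<xi>) ` {- e<..<e} \<subseteq> S"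
  proof safe
    fix t assume "t \<in> {- e<..<e}"
    then show "c + t *\<^sub>R \<xi> \<in> S" using e(2)[of t] \<open>c \<in> S\<close> by (cases "t = 0") (auto simp: abs_less_iff)
  qed
  have lin: "((\<lambda>t. c + t *\<^sub>R \<xi>) has_derivative (\<lambda>t. t *\<^sub>R \<xi>)) (at 0 within {- e<..<e})"
    by (auto intro!: derivative_eq_intros)
  have "(F has_derivative L) (at (c + 0 *\<^sub>R \<xi>) within (\<lambda>t. c + t *\<^sub>R \<xi>) ` {- e<..<e})"
    using has_derivative_subset[OF F sub] by simp
  from has_derivative_in_compose[OF lin this]
  have "((\<lambda>t. F (c + t *\<^sub>R \<xi>)) has_derivative (\<lambda>t. L (t *\<^sub>R \<xi>))) (at 0 within {- e<..<e})" .
  moreover have "(\<lambda>t. L (t *\<^sub>R \<xi>)) = (*) (L \<xi>)"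
    using has_derivative_linear[OF F] by (simp add: linear_scale fun_eq_iff mult.commute)
  ultimately have "((\<lambda>t. F (c + t *\<^sub>R \<xi>)) has_field_derivative L \<xi>) (at 0 within {- e<..<e})"
    unfolding has_field_derivative_def by simp
  then have "((\<lambda>t. F (c + t *\<^sub>R \<xi>)) has_field_derivative L \<xi>) (at 0)"
    using e(1) by (simp add: at_within_open[of _ "{- e<..<e}"])
  then show ?thesis unfolding has_field_derivative_iff by simp
qed

context riemannian_complex
begin

lemma sobolev_norm_bounds:
  assumes "vector_field_on P U H"
  shows "(\<integral>\<^sup>+x\<in>U. ennreal ((u x)\<^sup>2) \<partial>vol P) \<le> sobolev_norm_sq P U u H"
    and "dirichlet_integral P U H \<le> sobolev_norm_sq P U u H"
proof -
  show "(\<integral>\<^sup>+x\<in>U. ennreal ((u x)\<^sup>2) \<partial>vol P) \<le> sobolev_norm_sq P U u H"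
    unfolding sobolev_norm_sq_def
  proof (rule nn_integral_mono_AE)
    show "AE x in vol P. ennreal ((u x)\<^sup>2) * indicator U x
        \<le> ennreal ((u x)\<^sup>2 + metric_form P x (H x) (H x)) * indicator U x"
      using AE_metric_nonneg[OF assms] by eventually_elim (auto split: split_indicator intro!: ennreal_leI)
  qed
  show "dirichlet_integral P U H \<le> sobolev_norm_sq P U u H"
    unfolding sobolev_norm_sq_def dirichlet_integral_def
    by (intro nn_integral_mono mult_right_mono ennreal_leI) auto
qed

text \<open>The parallelogram identity for \<open>?D\<close> and \<open>H\<close>, whose sum is
  \<open>W\<close>; the term of the difference \<open>?D - H\<close> is nonnegative.\<close>

lemma dirichlet_integral_le_sum:
  assumes "vector_field_on P UNIV W" "vector_field_on P UNIV H"
  shows "dirichlet_integral P UNIV W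
    \<le> 2 * dirichlet_integral P UNIV (\<lambda>x. W x - H x) + 2 * dirichlet_integral P UNIV H"
proof -
  let ?D = "\<lambda>x. W x - H x"
  have vD: "vector_field_on P UNIV ?D" by (rule vector_field_diff[OF assms])
  have [measurable]: "(\<lambda>x. metric_form P x (H x) (H x)) \<in> borel_measurable (vol P)"
    "(\<lambda>x. metric_form P x (?D x) (?D x)) \<in> borel_measurable (vol P)"
    using metric_form_vector_fields_measurable[OF assms(2,2)] metric_form_vector_fields_measurable[OF vD vD] by auto
  obtain \<Lambda> where ell: "AE x in vol P. elliptic \<Lambda> x" using AE_elliptic by blast
  have tan: "AE x in vol P. W x \<in> tangent P (carrier_simplex P x)"
    "AE x in vol P. H x \<in> tangent P (carrier_simplex P x)"
    using assms by (auto simp: vector_field_on_def)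
  have "dirichlet_integral P UNIV W
      \<le> (\<integral>\<^sup>+x. 2 * ennreal (metric_form P x (?D x) (?D x)) + 2 * ennreal (metric_form P x (H x) (H x)) \<partial>vol P)"
    unfolding dirichlet_integral_def
  proof (rule nn_integral_mono_AE)
    show "AE x in vol P. ennreal (metric_form P x (W x) (W x)) * indicator UNIV x
        \<le> 2 * ennreal (metric_form P x (?D x) (?D x)) + 2 * ennreal (metric_form P x (H x) (H x))"
      using ell tan
    proof eventually_elim
      case (elim x)
      let ?T = "tangent P (carrier_simplex P x)" and ?m = "metric_form P x"
      have T: "?D x \<in> ?T" "?D x - H x \<in> ?T"
        using elim subspace_diff[OF subspace_tangent] by auto
      have nn: "0 \<le> ?m (?D x) (?D x)" "0 \<le> ?m (H x) (H x)"
        using elim T by (auto intro: elliptic_nonneg)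
      have "0 \<le> ?m (?D x - H x) (?D x - H x)" by (rule elliptic_nonneg[OF elim(1) T(2)])
      then have "?m (W x) (W x) \<le> 2 * ?m (?D x) (?D x) + 2 * ?m (H x) (H x)"
        by (simp add: metric_linear metric_sym[of x "H x" "W x"])
      then have "ennreal (?m (W x) (W x)) \<le> ennreal (2 * ?m (?D x) (?D x) + 2 * ?m (H x) (H x))"
        by (rule ennreal_leI)
      also have "\<dots> = 2 * ennreal (?m (?D x) (?D x)) + 2 * ennreal (?m (H x) (H x))"
        using nn by (simp add: ennreal_plus ennreal_mult)
      finally show ?case by simp
    qed
  qed
  also have "\<dots> = 2 * dirichlet_integral P UNIV ?D + 2 * dirichlet_integral P UNIV H"
    unfolding dirichlet_integral_def by (subst nn_integral_add) (auto simp: nn_integral_cmult)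
  finally show ?thesis .
qed

text \<open>A competitor for the capacity is a Sobolev function and is replaced by a Lipschitz
  approximation. This may lose the pointwise bound by 1 on \<open>D\<close>, but the deficit
  \<open>max 0 (1 - w x)\<close> is at most the approximation error and so small in L2.\<close>

lemma parabolic_cutoff:
  assumes par: "parabolic P UNIV" and D: "compact D" and \<epsilon>: "0 < \<epsilon>"
  shows "\<exists>w W. w \<in> lip_c P UNIV \<and> w \<in> borel_measurable (vol P) \<and> has_gradient_on P UNIV w W \<and>
    dirichlet_integral P UNIV W \<le> ennreal (\<epsilon>\<^sup>2) \<and>
    (\<integral>\<^sup>+x\<in>D. ennreal ((max 0 (1 - w x))\<^sup>2) \<partial>vol P) \<le> ennreal (\<epsilon>\<^sup>2)"
proof -
  \<comment> \<open>Competitor and approximation error each contribute twice this amount to the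
    energy of the cutoff.\<close>
  let ?\<delta> = "ennreal (\<epsilon>\<^sup>2 / 4)"
  have "capacity P D UNIV < ?\<delta>" using par D \<epsilon> by (simp add: parabolic_def)
  then obtain u H V where uH: "W12_0_grad P UNIV u H" "D \<subseteq> V"
    "AE x in vol P. x \<in> V \<longrightarrow> 1 \<le> u x" "dirichlet_integral P UNIV H < ?\<delta>"
    unfolding capacity_def INF_less_iff by auto
  then have vH: "vector_field_on P UNIV H" and "\<exists>(w :: nat \<Rightarrow> 'x \<Rightarrow> real) (W :: nat \<Rightarrow> 'x \<Rightarrow> 'e).
        (\<forall>k. w k \<in> lip_c P UNIV \<and> w k \<in> borel_measurable (restrict_space (vol P) UNIV) \<and>
             has_gradient_on P UNIV (w k) (W k) \<and> sobolev_norm_sq P UNIV (w k) (W k) < \<infinity>) \<and>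
        (\<lambda>k. sobolev_norm_sq P UNIV (\<lambda>x. w k x - u x) (\<lambda>x. W k x - H x)) \<longlonglongrightarrow> 0"
    by (auto simp: W12_0_grad_def sobolev_closure_def)
  then obtain w W where w: "\<And>k. w k \<in> lip_c P UNIV" "\<And>k. w k \<in> borel_measurable (vol P)"
    "\<And>k. has_gradient_on P UNIV (w k) (W k)"
    and lim: "(\<lambda>k::nat. sobolev_norm_sq P UNIV (\<lambda>x. w k x - u x) (\<lambda>x. W k x - H x)) \<longlonglongrightarrow> 0"
    by auto
  have "\<forall>\<^sub>F k in sequentially. sobolev_norm_sq P UNIV (\<lambda>x. w k x - u x) (\<lambda>x. W k x - H x) < ?\<delta>"
    using lim \<epsilon> by (intro order_tendstoD) auto
  then obtain k where k: "sobolev_norm_sq P UNIV (\<lambda>x. w k x - u x) (\<lambda>x. W k x - H x) < ?\<delta>"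
    by (auto simp: eventually_sequentially)
  have vW: "vector_field_on P UNIV (W k)" using w(3) by (simp add: has_gradient_on_def)
  note bounds = sobolev_norm_bounds[OF vector_field_diff[OF vW vH], of "\<lambda>x. w k x - u x"]
  have "dirichlet_integral P UNIV (W k) \<le> 2 * ?\<delta> + 2 * ?\<delta>"
    using bounds(2) k uH(4)
    by (intro order_trans[OF dirichlet_integral_le_sum[OF vW vH]] add_mono mult_left_mono) auto
  also have "\<dots> = ennreal (\<epsilon>\<^sup>2)"
  proof -
    have "2 * ?\<delta> = ennreal (\<epsilon>\<^sup>2 / 2)" using ennreal_mult[of 2 "\<epsilon>\<^sup>2 / 4"] by simp
    then show ?thesis using ennreal_plus[of "\<epsilon>\<^sup>2 / 2" "\<epsilon>\<^sup>2 / 2"] by simp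
  qed
  finally have "dirichlet_integral P UNIV (W k) \<le> ennreal (\<epsilon>\<^sup>2)" .
  moreover have "(\<integral>\<^sup>+x\<in>D. ennreal ((max 0 (1 - w k x))\<^sup>2) \<partial>vol P) \<le> ennreal (\<epsilon>\<^sup>2)"
  proof -
    have "(\<integral>\<^sup>+x\<in>D. ennreal ((max 0 (1 - w k x))\<^sup>2) \<partial>vol P) \<le> (\<integral>\<^sup>+x\<in>UNIV. ennreal ((w k x - u x)\<^sup>2) \<partial>vol P)"
    proof (rule nn_integral_mono_AE)
      show "AE x in vol P. ennreal ((max 0 (1 - w k x))\<^sup>2) * indicator D x
          \<le> ennreal ((w k x - u x)\<^sup>2) * indicator UNIV x"
        using uH(3)
      proof eventually_elim
        case (elim x)
        show ?case
        proof (cases "x \<in> D")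
          case True
          then have "\<bar>max 0 (1 - w k x)\<bar> \<le> \<bar>w k x - u x\<bar>" using elim uH(2) by auto
          then have "(max 0 (1 - w k x))\<^sup>2 \<le> (w k x - u x)\<^sup>2" by (simp only: abs_le_square_iff)
          then show ?thesis using True by (simp add: ennreal_leI)
        qed simp
      qed
    qed
    also have "\<dots> \<le> ?\<delta>" using bounds(1) k by simp
    also have "\<dots> \<le> ennreal (\<epsilon>\<^sup>2)" by (rule ennreal_leI) simp
    finally show ?thesis .
  qed
  ultimately show ?thesis using w by blast
qed

text \<open>The order of choices matters: the cutoff comes first, then a domain \<open>U\<close>
  containing \<open>D\<close> and the support of the cutoff, and only then an approximation of
  \<open>f\<close> on \<open>U\<close>.\<close>

lemma approximants:
  assumes par: "parabolic P UNIV" and harm: "weakly_harmonic P f" and grad: "weak_gradient P f G"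
    and E: "dirichlet_integral P UNIV G \<le> ennreal E" "0 \<le> E" and D: "compact D" and \<epsilon>: "0 < \<epsilon>"
  shows "\<exists>w q. w \<in> borel_measurable (vol P) \<and> q \<in> borel_measurable (vol P) \<and>
    (\<integral>\<^sup>+x\<in>D. ennreal ((max 0 (1 - w x))\<^sup>2) \<partial>vol P) \<le> ennreal (\<epsilon>\<^sup>2) \<and>
    (\<integral>\<^sup>+x\<in>D. ennreal ((q x - f x)\<^sup>2) \<partial>vol P) \<le> ennreal (\<epsilon>\<^sup>2) \<and>
    (\<integral>\<^sup>+x\<in>D. ennreal (squash (w x) / (1 + (q x)\<^sup>2) * metric_form P x (G x) (G x)) \<partial>vol P)
      \<le> ennreal (\<epsilon> * (2 * E + 2))"
proof -
  obtain w W where w: "w \<in> lip_c P UNIV" "w \<in> borel_measurable (vol P)" "has_gradient_on P UNIV w W"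
    "dirichlet_integral P UNIV W \<le> ennreal (\<epsilon>\<^sup>2)"
    and wD: "(\<integral>\<^sup>+x\<in>D. ennreal ((max 0 (1 - w x))\<^sup>2) \<partial>vol P) \<le> ennreal (\<epsilon>\<^sup>2)"
    using parabolic_cutoff[OF par D \<epsilon>] by blast
  have "compact (D \<union> closure {x. w x \<noteq> 0})" using D w(1) by (auto simp: lip_c_def)
  then obtain U where U: "rel_compact_domain U" "D \<subseteq> U" "closure {x. w x \<noteq> 0} \<subseteq> U"
    using rel_compact_domain_covering_compact by (metis Un_subset_iff)
  have Ub: "U \<in> sets borel" using U by (simp add: rel_compact_domain_def)
  have "W12_grad P U f G" using grad U by (simp add: weak_gradient_def)
  then have vG: "vector_field_on P U G" and "\<exists>(q :: nat \<Rightarrow> 'x \<Rightarrow> real) (Q :: nat \<Rightarrow> 'x \<Rightarrow> 'e).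
        (\<forall>k. q k \<in> {u. lipschitz_fun P U u} \<and> q k \<in> borel_measurable (restrict_space (vol P) U) \<and>
             has_gradient_on P U (q k) (Q k) \<and> sobolev_norm_sq P U (q k) (Q k) < \<infinity>) \<and>
        (\<lambda>k. sobolev_norm_sq P U (\<lambda>x. q k x - f x) (\<lambda>x. Q k x - G x)) \<longlonglongrightarrow> 0"
    by (auto simp: W12_grad_def sobolev_closure_def)
  then obtain q Q where q: "\<And>k. lipschitz_fun P U (q k)" "\<And>k. q k \<in> borel_measurable (restrict_space (vol P) U)"
    "\<And>k. has_gradient_on P U (q k) (Q k)"
    and lim: "(\<lambda>k::nat. sobolev_norm_sq P U (\<lambda>x. q k x - f x) (\<lambda>x. Q k x - G x)) \<longlonglongrightarrow> 0"
    by auto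
  have "\<forall>\<^sub>F k in sequentially. sobolev_norm_sq P U (\<lambda>x. q k x - f x) (\<lambda>x. Q k x - G x) < ennreal (\<epsilon>\<^sup>2)"
    using lim \<epsilon> by (intro order_tendstoD) auto
  then obtain k where k: "sobolev_norm_sq P U (\<lambda>x. q k x - f x) (\<lambda>x. Q k x - G x) < ennreal (\<epsilon>\<^sup>2)"
    by (auto simp: eventually_sequentially)
  have vQ: "vector_field_on P U (Q k)" using q(3) by (simp add: has_gradient_on_def)
  note bounds = sobolev_norm_bounds[OF vector_field_diff[OF vQ vG], of "\<lambda>x. q k x - f x"]
  \<comment> \<open>Extension by zero gives a measurable function on the whole space without
    changing it on \<open>D\<close>.\<close>
  let ?q = "\<lambda>x. indicator U x *\<^sub>R q k x"
  have "?q \<in> borel_measurable (vol P)" using q(2) by (simp only: borel_measurable_restrict_indicator[OF Ub])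
  moreover have "(\<integral>\<^sup>+x\<in>D. ennreal ((?q x - f x)\<^sup>2) \<partial>vol P) \<le> ennreal (\<epsilon>\<^sup>2)"
  proof -
    have "(\<integral>\<^sup>+x\<in>D. ennreal ((?q x - f x)\<^sup>2) \<partial>vol P) \<le> (\<integral>\<^sup>+x\<in>U. ennreal ((q k x - f x)\<^sup>2) \<partial>vol P)"
      using U(2) by (intro nn_integral_mono) (auto split: split_indicator)
    then show ?thesis using bounds(1) k by simp
  qed
  moreover have "(\<integral>\<^sup>+x\<in>D. ennreal (squash (w x) / (1 + (?q x)\<^sup>2) * metric_form P x (G x) (G x)) \<partial>vol P)
      \<le> ennreal (\<epsilon> * (2 * E + 2))"
  proof -
    have "(\<integral>\<^sup>+x\<in>D. ennreal (squash (w x) / (1 + (?q x)\<^sup>2) * metric_form P x (G x) (G x)) \<partial>vol P)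
        \<le> (\<integral>\<^sup>+x\<in>U. ennreal (squash (w x) / (1 + (q k x)\<^sup>2) * metric_form P x (G x) (G x)) \<partial>vol P)"
      using U(2) by (intro nn_integral_mono) (auto split: split_indicator)
    also have "\<dots> \<le> ennreal (\<epsilon> * (2 * E + 2))"
      using bounds(2) k
      by (intro energy_estimate[OF harm grad E \<epsilon> U(1,3) w q(1,2,3)]) auto
    finally show ?thesis .
  qed
  ultimately show ?thesis using w(2) wD by blast
qed

text \<open>Errors of size \<open>(1 / 2) ^ j\<close> are summable, so almost everywhere on
  \<open>D\<close> the deficit and the difference of \<open>q j\<close> and \<open>f\<close> tend to
  0, as does the positive part of the weighted energy density. The weight then stays above a
  positive number depending on the point.\<close>

lemma gradient_vanishes:
  assumes par: "parabolic P UNIV" and harm: "weakly_harmonic P f" and grad: "weak_gradient P f G"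
    and E: "dirichlet_integral P UNIV G \<le> ennreal E" "0 \<le> E" and D: "compact D"
    and [measurable]: "f \<in> borel_measurable (vol P)"
  shows "AE x in vol P. x \<in> D \<longrightarrow> metric_form P x (G x) (G x) = 0"
proof -
  let ?m = "\<lambda>x. metric_form P x (G x) (G x)"
  define good where "good j w q \<longleftrightarrow> w \<in> borel_measurable (vol P) \<and> q \<in> borel_measurable (vol P) \<and>
    (\<integral>\<^sup>+x\<in>D. ennreal ((max 0 (1 - w x))\<^sup>2) \<partial>vol P) \<le> ennreal (((1 / 2) ^ j)\<^sup>2) \<and>
    (\<integral>\<^sup>+x\<in>D. ennreal ((q x - f x)\<^sup>2) \<partial>vol P) \<le> ennreal (((1 / 2) ^ j)\<^sup>2) \<and>
    (\<integral>\<^sup>+x\<in>D. ennreal (squash (w x) / (1 + (q x)\<^sup>2) * ?m x) \<partial>vol P) \<le> ennreal ((1 / 2) ^ j * (2 * E + 2))"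
    for j :: nat and w q
  have "\<forall>j. \<exists>w q. good j w q"
    unfolding good_def by (intro allI approximants[OF par harm grad E D]) simp
  then obtain w q where "\<And>j. good j (w j) (q j)" by metis
  then have wq: "\<And>j::nat. w j \<in> borel_measurable (vol P)" "\<And>j. q j \<in> borel_measurable (vol P)"
    and le: "\<And>j. (\<integral>\<^sup>+x\<in>D. ennreal ((max 0 (1 - w j x))\<^sup>2) \<partial>vol P) \<le> ennreal (((1 / 2) ^ j)\<^sup>2)"
      "\<And>j. (\<integral>\<^sup>+x\<in>D. ennreal ((q j x - f x)\<^sup>2) \<partial>vol P) \<le> ennreal (((1 / 2) ^ j)\<^sup>2)"
      "\<And>j. (\<integral>\<^sup>+x\<in>D. ennreal (squash (w j x) / (1 + (q j x)\<^sup>2) * ?m x) \<partial>vol P) \<le> ennreal ((1 / 2) ^ j * (2 * E + 2))"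
    unfolding good_def by blast+
  note [measurable] = wq
  have Db: "D \<in> sets borel" using D by (simp add: borel_compact)
  have [measurable]: "D \<in> sets (vol P)" using Db by (rule sets_vol_borel)
  obtain U where U: "rel_compact_domain U" "D \<subseteq> U" using rel_compact_domain_covering_compact[OF D] by blast
  have Ub: "U \<in> sets borel" using U by (simp add: rel_compact_domain_def)
  have "vector_field_on P U G"
    using grad U by (auto simp: weak_gradient_def W12_grad_def sobolev_closure_def)
  then have vG: "vector_field_on P D G" by (rule vector_field_subset) (use U Ub Db in auto)
  have mD [measurable]: "(\<lambda>x. ?m x * indicator D x) \<in> borel_measurable (vol P)"
    by (rule metric_form_vector_fields_measurable[OF vG vG Db])
  \<comment> \<open>This brings the two L2 bounds into the geometric form required for
    summation.\<close>
  have square_le: "((1 / 2 :: real) ^ j)\<^sup>2 \<le> 1 * (1 / 2) ^ j" for j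
  proof -
    have "(1 / 2 :: real) ^ j * (1 / 2) ^ j \<le> 1 * (1 / 2) ^ j"
      by (intro mult_right_mono power_le_one) auto
    then show ?thesis by (simp add: power2_eq_square)
  qed
  have "AE x in vol P. x \<in> D \<longrightarrow> (\<lambda>j. max 0 ((max 0 (1 - w j x))\<^sup>2)) \<longlonglongrightarrow> 0"
    by (rule AE_tendsto_0_of_summable_integrals[OF _ order_trans[OF le(1) ennreal_leI[OF square_le]]]) auto
  moreover have "AE x in vol P. x \<in> D \<longrightarrow> (\<lambda>j. max 0 ((q j x - f x)\<^sup>2)) \<longlonglongrightarrow> 0"
    by (rule AE_tendsto_0_of_summable_integrals[OF _ order_trans[OF le(2) ennreal_leI[OF square_le]]]) auto
  moreover have "AE x in vol P. x \<in> D \<longrightarrow> (\<lambda>j. max 0 (squash (w j x) / (1 + (q j x)\<^sup>2) * ?m x)) \<longlonglongrightarrow> 0"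
  proof (rule AE_tendsto_0_of_summable_integrals[of _ _ _ "2 * E + 2"])
    show "(\<lambda>x. squash (w j x) / (1 + (q j x)\<^sup>2) * ?m x * indicator D x) \<in> borel_measurable (vol P)" for j
    proof -
      have "(\<lambda>x. (w j x)\<^sup>2 / (1 + (w j x)\<^sup>2) / (1 + (q j x)\<^sup>2) * (?m x * indicator D x)) \<in> borel_measurable (vol P)"
        by measurable
      then show ?thesis by (simp add: squash_def mult.assoc)
    qed
  qed (use le(3) E in \<open>auto simp: mult.commute\<close>)
  moreover have "AE x in vol P. x \<in> D \<longrightarrow> 0 \<le> ?m x" by (rule AE_metric_nonneg[OF vG])
  ultimately show ?thesis
  proof eventually_elim
    case (elim x)
    show ?case
    proof
      assume x: "x \<in> D"
      have w0: "(\<lambda>j. (max 0 (1 - w j x))\<^sup>2) \<longlonglongrightarrow> 0" and q0: "(\<lambda>j. (q j x - f x)\<^sup>2) \<longlonglongrightarrow> 0"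
        and m0: "(\<lambda>j. max 0 (squash (w j x) / (1 + (q j x)\<^sup>2) * ?m x)) \<longlonglongrightarrow> 0" and m: "0 \<le> ?m x"
        using elim x by (auto simp: max_absorb2)
      \<comment> \<open>Eventually \<open>w j x > 1 / 2\<close>, where \<open>squash\<close> is at
        least \<open>(1 / 4) / (5 / 4) = 1 / 5\<close>, and \<open>q j x\<close> is within 1 of
        \<open>f x\<close>.\<close>
      let ?c = "(1 / 5) / (1 + (\<bar>f x\<bar> + 1)\<^sup>2)"
      have e1: "\<forall>\<^sub>F j in sequentially. (max 0 (1 - w j x))\<^sup>2 < 1 / 4"
        and e2: "\<forall>\<^sub>F j in sequentially. (q j x - f x)\<^sup>2 < 1"
        by (rule order_tendstoD(2)[OF w0] order_tendstoD(2)[OF q0], simp)+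
      have "\<forall>\<^sub>F j in sequentially. ?c * ?m x \<le> max 0 (squash (w j x) / (1 + (q j x)\<^sup>2) * ?m x)"
        using e1 e2
      proof eventually_elim
        case (elim j)
        have "(max 0 (1 - w j x))\<^sup>2 < (1 / 2)\<^sup>2" using elim by (simp add: power2_eq_square)
        then have "max 0 (1 - w j x) < 1 / 2" by (rule power2_less_imp_less) simp
        then have "1 / 2 < w j x" by linarith
        then have "(1 / 2)\<^sup>2 \<le> (w j x)\<^sup>2" by (intro power_mono) auto
        then have sq: "1 / 5 \<le> squash (w j x)"
          unfolding squash_def using one_plus_square_pos[of "w j x"]
          by (subst pos_le_divide_eq) (auto simp: power2_eq_square)
        have "(q j x - f x)\<^sup>2 < 1\<^sup>2" using elim by simp
        then have "\<bar>q j x - f x\<bar> < 1" by (simp add: abs_square_less_1)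
        then have "\<bar>q j x\<bar> \<le> \<bar>\<bar>f x\<bar> + 1\<bar>" by linarith
        then have "(q j x)\<^sup>2 \<le> (\<bar>f x\<bar> + 1)\<^sup>2" by (simp only: abs_le_square_iff)
        then have "?c \<le> squash (w j x) / (1 + (q j x)\<^sup>2)"
          using sq one_plus_square_pos[of "q j x"] by (intro frac_le) auto
        then have "?c * ?m x \<le> squash (w j x) / (1 + (q j x)\<^sup>2) * ?m x" using m by (rule mult_right_mono)
        then show ?case by simp
      qed
      then have "?c * ?m x \<le> 0" by (intro tendsto_lowerbound[OF m0]) auto
      moreover have "0 < ?c" by (intro divide_pos_pos one_plus_square_pos) auto
      ultimately show "?m x = 0" using m mult_pos_pos[of ?c "?m x"] by linarith
    qed
  qed
qed

text \<open>The comparison of flat measure and volume, rewritten in the chart centred at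
  \<open>x0\<close>.\<close>

lemma chart_nn_integral_le:
  assumes s: "s \<in> max_simplexes P" and x0: "x0 \<in> open_cell P s"
    and cell: "\<And>w. w \<in> tangent P s \<Longrightarrow> norm w < \<rho> \<Longrightarrow> pos P x0 + w \<in> cell_image s"
  shows "\<exists>\<kappa>>0. \<forall>\<phi>\<in>borel_measurable borel.
     ennreal \<kappa> * (\<integral>\<^sup>+y\<in>ball 0 \<rho>. \<phi> y \<partial>flat_measure (frame P s))
       \<le> (\<integral>\<^sup>+x\<in>{x \<in> open_cell P s. norm (pos P x - pos P x0) < \<rho>}. \<phi> (pos P x - pos P x0) \<partial>vol P)"
proof -
  let ?a = "pos P x0" let ?V = "{x \<in> open_cell P s. norm (pos P x - ?a) < \<rho>}" let ?\<mu> = "flat_measure (frame P s)"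
  obtain \<kappa> where \<kappa>: "\<kappa> > 0" "\<And>h. h \<in> borel_measurable borel \<Longrightarrow>
      ennreal \<kappa> * (\<integral>\<^sup>+y\<in>cell_image s. h (pt P y) \<partial>plane_measure s) \<le> (\<integral>\<^sup>+x. h x \<partial>vol P)"
    using nn_integral_plane_le_vol[OF s] by blast
  have [measurable]: "open_cell P s \<in> sets borel" by (rule borel_open_cell[OF s])
  have Vb [measurable]: "?V \<in> sets borel" by measurable
  have [measurable]: "pos P ` ?V \<in> sets borel" by (rule borel_pos_image[OF Vb])
  have "ennreal \<kappa> * (\<integral>\<^sup>+y\<in>ball 0 \<rho>. \<phi> y \<partial>?\<mu>) \<le> (\<integral>\<^sup>+x\<in>?V. \<phi> (pos P x - ?a) \<partial>vol P)"
    if [measurable]: "\<phi> \<in> borel_measurable borel" for \<phi>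
  proof -
    have "(\<integral>\<^sup>+y\<in>ball 0 \<rho>. \<phi> y \<partial>?\<mu>) \<le> (\<integral>\<^sup>+y. \<phi> (?a + y - ?a) * indicator (pos P ` ?V) (?a + y) \<partial>?\<mu>)"
    proof (rule nn_integral_mono_AE)
      show "AE y in ?\<mu>. \<phi> y * indicator (ball 0 \<rho>) y \<le> \<phi> (?a + y - ?a) * indicator (pos P ` ?V) (?a + y)"
        using AE_flat_measure_span[OF frame_finite]
      proof eventually_elim
        case (elim y)
        show ?case
        proof (cases "y \<in> ball 0 \<rho>")
          case True
          then obtain x where x: "x \<in> open_cell P s" "?a + y = pos P x"
            using cell[of y] elim by (auto simp: span_frame)
          then have "pos P x - ?a = y" by (metis add_diff_cancel_left')
          then have "x \<in> ?V" using x True by simp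
          then have "?a + y \<in> pos P ` ?V" using x(2) by simp
          then show ?thesis using True by simp
        qed simp
      qed
    qed
    also have "\<dots> = (\<integral>\<^sup>+y. \<phi> (y - ?a) * indicator (pos P ` ?V) y \<partial>plane_measure s)"
      unfolding plane_measure_at[OF pos_minus_base[OF x0]] by (subst nn_integral_distr) measurable
    also have "\<dots> = (\<integral>\<^sup>+y\<in>cell_image s. (\<lambda>x. \<phi> (pos P x - ?a) * indicator ?V x) (pt P y) \<partial>plane_measure s)"
    proof (intro nn_integral_cong)
      fix y
      show "\<phi> (y - ?a) * indicator (pos P ` ?V) y
          = (\<lambda>x. \<phi> (pos P x - ?a) * indicator ?V x) (pt P y) * indicator (cell_image s) y"
      proof (cases "y \<in> cell_image s")
        case True
        then obtain x where x: "x \<in> open_cell P s" "y = pos P x" by auto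
        have "y \<in> pos P ` ?V \<longleftrightarrow> x \<in> ?V" unfolding x(2) using inj_pos by (simp add: inj_image_mem_iff)
        then show ?thesis using True x by (simp split: split_indicator)
      next
        case False
        then have "y \<notin> pos P ` ?V" by auto
        then show ?thesis using False by simp
      qed
    qed
    finally have "ennreal \<kappa> * (\<integral>\<^sup>+y\<in>ball 0 \<rho>. \<phi> y \<partial>?\<mu>)
        \<le> ennreal \<kappa> * (\<integral>\<^sup>+y\<in>cell_image s. (\<lambda>x. \<phi> (pos P x - ?a) * indicator ?V x) (pt P y) \<partial>plane_measure s)"
      by (rule mult_left_mono) simp
    also have "\<dots> \<le> (\<integral>\<^sup>+x\<in>?V. \<phi> (pos P x - ?a) \<partial>vol P)"
      by (rule \<kappa>(2)) measurable
    finally show ?thesis .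
  qed
  then show ?thesis using \<kappa>(1) by blast
qed

end

section \<open>Local constancy\<close>

context riemannian_complex
begin

lemma locally_constant_on_open_cell:
  assumes s: "s \<in> max_simplexes P" and x0: "x0 \<in> open_cell P s"
    and cont: "continuous_on UNIV f" and grad: "weak_gradient P f G"
    and zero: "\<And>D. compact D \<Longrightarrow> AE x in vol P. x \<in> D \<longrightarrow> metric_form P x (G x) (G x) = 0"
  shows "\<forall>\<^sub>F y in nhds x0. f y = f x0"
proof -
  let ?a = "pos P x0" and ?T = "tangent P s"
  let ?c = "\<lambda>w. pt P (?a + w)"
  interpret flat_space "frame P s" by standard (rule frame_orthonormal(1), rule frame_orthonormal(2))
  from lipschitz_fun_chart[OF s x0] obtain r where r: "r > 0"
    and r1: "\<forall>w\<in>?T. norm w < r \<longrightarrow> ?a + w \<in> cell_image s"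
    and r2: "\<forall>U u \<rho>. lipschitz_fun P U u \<longrightarrow> \<rho> \<le> r \<longrightarrow> (\<forall>w\<in>?T. norm w < \<rho> \<longrightarrow> ?c w \<in> U) \<longrightarrow>
        (\<exists>C. C-lipschitz_on (?T \<inter> ball 0 \<rho>) (\<lambda>w. u (?c w)))"
    by (elim exE conjE)
  have cell: "?a + w \<in> cell_image s" if "w \<in> ?T" "norm w < r" for w
    using r1 that by simp
  have chart_lip: "\<exists>C. C-lipschitz_on (?T \<inter> ball 0 \<rho>) (\<lambda>w. u (?c w))"
    if "lipschitz_fun P U u" "\<rho> \<le> r" "\<And>w. w \<in> ?T \<Longrightarrow> norm w < \<rho> \<Longrightarrow> ?c w \<in> U" for U u \<rho>
    using r2[rule_format, OF that(1,2)] that(3) by simp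
  \<comment> \<open>The closed chart ball of radius \<rho> gives \<open>U\<close> a compact closure
    inside the chart. The smaller closed ball of radius \<delta> lies within the chart of
    \<open>U\<close>, and constancy will be proved at radius \<open>\<delta> / 2\<close>.\<close>
  define \<rho> where "\<rho> = r / 2"
  define \<delta> where "\<delta> = \<rho> / 2"
  have \<rho>: "0 < \<rho>" "\<rho> < r" and \<delta>: "0 < \<delta>" "\<delta> < \<rho>" using r by (auto simp: \<rho>_def \<delta>_def)
  define B where "B \<eta> = {x \<in> open_cell P s. norm (pos P x - ?a) < \<eta>}" for \<eta>
  have openB: "open (B \<eta>)" for \<eta>
  proof -
    have "open {x. norm (pos P x - ?a) < \<eta>}"
      by (intro open_Collect_less continuous_intros continuous_pos)
    moreover have "B \<eta> = open_cell P s \<inter> {x. norm (pos P x - ?a) < \<eta>}" by (auto simp: B_def)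
    ultimately show ?thesis using open_cell_open[OF s] by (simp add: open_Int)
  qed
  have tan: "pos P x - ?a \<in> ?T" if "x \<in> open_cell P s" for x
    using subspace_diff[OF subspace_tangent pos_minus_base[OF that] pos_minus_base[OF x0]] by simp
  have chart: "?c w \<in> open_cell P s" "pos P (?c w) = ?a + w" if "w \<in> ?T" "norm w < r" for w
    using cell[OF that] by auto
  have chart_B: "?c w \<in> B \<eta>" if "w \<in> ?T" "norm w < \<eta>" "\<eta> \<le> r" for w \<eta>
    using chart[of w] that by (simp add: B_def)
  have chart_pos: "?c (pos P x - ?a) = x" for x by simp
  define U where "U = B \<rho>"
  have U_eq: "U = ?c ` (?T \<inter> ball 0 \<rho>)"
  proof
    show "U \<subseteq> ?c ` (?T \<inter> ball 0 \<rho>)"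
    proof
      fix x assume "x \<in> U"
      then have "pos P x - ?a \<in> ?T \<inter> ball 0 \<rho>" using tan by (auto simp: U_def B_def)
      then show "x \<in> ?c ` (?T \<inter> ball 0 \<rho>)" using chart_pos by (metis imageI)
    qed
    show "?c ` (?T \<inter> ball 0 \<rho>) \<subseteq> U" using chart_B \<rho> by (auto simp: U_def)
  qed
  have cont_chart: "continuous_on (?T \<inter> cball 0 \<rho>) ?c"
    using cell \<rho> by (intro continuous_on_compose2[OF continuous_pt] continuous_intros) fastforce
  have closed_T: "closed ?T" by (simp add: tangent_def closed_span)
  have dom: "rel_compact_domain U"
    unfolding rel_compact_domain_def
  proof (intro conjI)
    show "open U" unfolding U_def by (rule openB)
    have "convex (?T \<inter> ball 0 \<rho>)"
      by (intro convex_Int convex_ball subspace_imp_convex subspace_tangent)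
    then show "connected U"
      unfolding U_eq
      by (intro connected_continuous_image convex_connected continuous_on_subset[OF cont_chart]) auto
    have "compact (?T \<inter> cball 0 \<rho>)" by (intro closed_Int_compact closed_T) auto
    then have K: "compact (?c ` (?T \<inter> cball 0 \<rho>))" by (rule compact_continuous_image[OF cont_chart])
    have "U \<subseteq> ?c ` (?T \<inter> cball 0 \<rho>)" unfolding U_eq by (intro image_mono) auto
    then have "closure U \<subseteq> ?c ` (?T \<inter> cball 0 \<rho>)" using K by (intro closure_minimal compact_imp_closed)
    then have "?c ` (?T \<inter> cball 0 \<rho>) \<inter> closure U = closure U" by (rule inf.absorb2)
    then show "compact (closure U)" using compact_Int_closed[OF K closed_closure, of U] by (rule subst)
  qed
  have Ub: "U \<in> sets borel" using dom by (simp add: rel_compact_domain_def)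
  have W: "W12_grad P U f G" using grad dom by (simp add: weak_gradient_def)
  then have vG: "vector_field_on P U G" and "\<exists>(q :: nat \<Rightarrow> 'x \<Rightarrow> real) (Q :: nat \<Rightarrow> 'x \<Rightarrow> 'e).
        (\<forall>k. q k \<in> {u. lipschitz_fun P U u} \<and> q k \<in> borel_measurable (restrict_space (vol P) U) \<and>
             has_gradient_on P U (q k) (Q k) \<and> sobolev_norm_sq P U (q k) (Q k) < \<infinity>) \<and>
        (\<lambda>k. sobolev_norm_sq P U (\<lambda>x. q k x - f x) (\<lambda>x. Q k x - G x)) \<longlonglongrightarrow> 0"
    by (auto simp: W12_grad_def sobolev_closure_def)
  then obtain q Q where q: "\<And>k. lipschitz_fun P U (q k)" "\<And>k. has_gradient_on P U (q k) (Q k)"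
    and lim: "(\<lambda>k::nat. sobolev_norm_sq P U (\<lambda>x. q k x - f x) (\<lambda>x. Q k x - G x)) \<longlonglongrightarrow> 0"
    by auto
  have vQ: "vector_field_on P U (Q k)" for k using q(2) by (simp add: has_gradient_on_def)
  obtain \<Lambda> where \<Lambda>: "\<Lambda> > 0" and ell: "AE x in vol P. elliptic \<Lambda> x" using AE_elliptic by blast
  \<comment> \<open>The vanishing of the energy is given on compact sets, so it is applied to the
    closure of \<open>U\<close>.\<close>
  have "AE x in vol P. x \<in> closure U \<longrightarrow> metric_form P x (G x) (G x) = 0"
    using dom by (intro zero) (simp add: rel_compact_domain_def)
  moreover have "AE x in vol P. x \<in> U \<longrightarrow> G x \<in> tangent P (carrier_simplex P x)"
    using vG by (simp add: vector_field_on_def)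
  ultimately have G0: "AE x in vol P. x \<in> U \<longrightarrow> G x = 0"
    using ell
  proof eventually_elim
    case (elim x)
    show ?case
    proof
      assume x: "x \<in> U"
      then have "metric_form P x (G x) (G x) = 0" using elim closure_subset[of U] by auto
      then have "(norm (G x))\<^sup>2 / \<Lambda>\<^sup>2 \<le> 0" using elim x by (auto simp: elliptic_def)
      then show "G x = 0" using \<Lambda> by (simp add: divide_le_0_iff)
    qed
  qed
  have lim_q: "(\<lambda>k. \<integral>\<^sup>+x\<in>U. ennreal ((q k x - f x)\<^sup>2) \<partial>vol P) \<longlonglongrightarrow> 0"
    by (rule tendsto_sandwich[OF _ _ tendsto_const lim])
       (auto intro!: always_eventually sobolev_norm_bounds(1) vector_field_diff vQ vG)
  have lim_Q: "(\<lambda>k. dirichlet_integral P U (Q k)) \<longlonglongrightarrow> 0"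
  proof -
    have "dirichlet_integral P U (Q k) = dirichlet_integral P U (\<lambda>x. Q k x - G x)" for k
      unfolding dirichlet_integral_def
    proof (rule nn_integral_cong_AE)
      show "AE x in vol P. ennreal (metric_form P x (Q k x) (Q k x)) * indicator U x
          = ennreal (metric_form P x (Q k x - G x) (Q k x - G x)) * indicator U x"
        using G0 by eventually_elim (auto split: split_indicator)
    qed
    then show ?thesis
      by (intro tendsto_sandwich[OF _ _ tendsto_const lim])
         (auto intro!: always_eventually sobolev_norm_bounds(2) vector_field_diff vQ vG)
  qed
  define S where "S = span (frame P s) \<inter> cball 0 \<delta>"
  have S: "S = ?T \<inter> cball 0 \<delta>" by (simp add: S_def span_frame)
  have Sb: "S \<in> sets borel" unfolding S by (intro borel_closed closed_Int closed_T closed_cball)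
  \<comment> \<open>The cutoff gives Borel functions of a vector variable; without it, values of
    \<open>pt\<close> outside the range of \<open>pos\<close> would enter.\<close>
  define F where "F w = indicator S w *\<^sub>R f (?c w)" for w
  define p where "p k w = indicator S w *\<^sub>R q k (?c w)" for k w
  have cont_S: "continuous_on S ?c" using \<delta> by (intro continuous_on_subset[OF cont_chart]) (auto simp: S)
  have contf: "continuous_on S (\<lambda>w. f (?c w))" by (rule continuous_on_compose2[OF cont cont_S]) auto
  have "\<exists>C. C-lipschitz_on S (\<lambda>w. q k (?c w))" for k
  proof -
    have "\<exists>C. C-lipschitz_on (?T \<inter> ball 0 \<rho>) (\<lambda>w. q k (?c w))"
      using chart_B \<rho> by (intro chart_lip[OF q(1)]) (auto simp: U_def)
    moreover have "S \<subseteq> ?T \<inter> ball 0 \<rho>" using \<delta> by (auto simp: S)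
    ultimately show ?thesis using lipschitz_on_subset by blast
  qed
  then obtain C where lipq: "\<And>k. (C k)-lipschitz_on S (\<lambda>w. q k (?c w))" by metis
  have contq: "continuous_on S (\<lambda>w. q k (?c w))" for k using lipq by (rule lipschitz_on_continuous_on)
  have Fm [measurable]: "F \<in> borel_measurable borel" and pm [measurable]: "p k \<in> borel_measurable borel" for k
    unfolding F_def p_def by (intro borel_measurable_continuous_on_indicator Sb contf contq)+
  have contF: "continuous_on S F"
    using contf by (rule continuous_on_eq) (simp add: F_def)
  have lipp: "(C k)-lipschitz_on S (p k)" for k
    using lipq by (rule lipschitz_on_transform) (simp add: p_def)
  have in_S: "pos P x - ?a \<in> S" if "x \<in> B \<delta>" for x using that tan by (auto simp: S B_def)
  have FB: "F (pos P x - ?a) = f x" and pB: "p k (pos P x - ?a) = q k x" if "x \<in> B \<delta>" for x k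
    using in_S[OF that] by (simp_all add: F_def p_def)
  have BU: "B \<delta> \<subseteq> U" using \<delta> by (auto simp: U_def B_def)
  obtain \<kappa> where \<kappa>: "\<kappa> > 0" "\<And>\<phi>. \<phi> \<in> borel_measurable borel \<Longrightarrow>
     ennreal \<kappa> * (\<integral>\<^sup>+y\<in>ball 0 \<delta>. \<phi> y \<partial>\<mu>) \<le> (\<integral>\<^sup>+x\<in>B \<delta>. \<phi> (pos P x - ?a) \<partial>vol P)"
    using chart_nn_integral_le[OF s x0, of \<delta>] cell \<rho> \<delta> unfolding B_def by force
  have F_const: "F \<xi> = F 0" if \<xi>: "\<xi> \<in> ?T" "norm \<xi> < \<delta> / 2" for \<xi>
  proof -
    \<comment> \<open>A limit along the sequence \<open>1 / Suc n\<close> is Borel measurable at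
      once. Where the full directional limit exists \<open>d\<close> agrees with it; elsewhere its
      value does not affect the integrals.\<close>
    define d where "d k y = lim (\<lambda>n. (p k (y + (1 / real (Suc n)) *\<^sub>R \<xi>) - p k y) / (1 / real (Suc n)))" for k y
    have [measurable]: "d k \<in> borel_measurable borel" for k
      unfolding d_def by measurable
    have deriv: "AE x in vol P. x \<in> B \<delta> \<longrightarrow>
        ((\<lambda>t. (p k (pos P x - ?a + t *\<^sub>R \<xi>) - p k (pos P x - ?a)) / t) \<longlongrightarrow> metric_form P x (Q k x) \<xi>) (at 0)" for k
    proof -
      have "AE x in vol P. x \<in> U \<longrightarrow> (let s = carrier_simplex P x
         in \<exists>L. ((\<lambda>y. q k (pt P y)) has_derivative L) (at (pos P x) within cell_image s) \<and>
                (\<forall>\<xi>\<in>tangent P s. metric_form P x (Q k x) \<xi> = L \<xi>))"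
        using q(2) by (simp add: has_gradient_on_def)
      then show ?thesis
      proof eventually_elim
        case (elim x)
        show ?case
        proof
          assume x: "x \<in> B \<delta>"
          then have xs: "carrier_simplex P x = s" "x \<in> open_cell P s" by (auto simp: B_def open_cell_def)
          have "x \<in> U" using x BU by auto
          with elim xs obtain L where L: "((\<lambda>y. q k (pt P y)) has_derivative L) (at (pos P x) within cell_image s)"
            "metric_form P x (Q k x) \<xi> = L \<xi>" using \<xi> by (auto simp: Let_def)
          let ?y = "pos P x - ?a"
          have "((\<lambda>t. norm (?y + t *\<^sub>R \<xi>)) \<longlongrightarrow> norm ?y) (at (0::real))"
            by (auto intro!: tendsto_eq_intros)
          then have near: "\<forall>\<^sub>F t in at (0::real). norm (?y + t *\<^sub>R \<xi>) < \<delta>"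
            using x by (intro order_tendstoD) (auto simp: B_def)
          have yT: "?y + t *\<^sub>R \<xi> \<in> ?T" for t
            using tan[OF xs(2)] \<xi> subspace_tangent by (intro subspace_add subspace_scale) auto
          have "((\<lambda>t. (q k (pt P (pos P x + t *\<^sub>R \<xi>)) - q k (pt P (pos P x))) / t) \<longlongrightarrow> L \<xi>) (at 0)"
          proof (rule has_derivative_imp_directional_limit[OF L(1)])
            show "\<forall>\<^sub>F t in at 0. pos P x + t *\<^sub>R \<xi> \<in> cell_image s"
              using near
            proof eventually_elim
              case (elim t)
              then show ?case using cell[OF yT[of t]] \<delta> \<rho> by simp
            qed
          qed (use xs in auto)
          moreover have "\<forall>\<^sub>F t in at 0. (q k (pt P (pos P x + t *\<^sub>R \<xi>)) - q k (pt P (pos P x))) / t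
              = (p k (?y + t *\<^sub>R \<xi>) - p k ?y) / t"
            using near
          proof eventually_elim
            case (elim t)
            have "?y + t *\<^sub>R \<xi> \<in> S" using yT elim by (simp add: S)
            then have "p k (?y + t *\<^sub>R \<xi>) = q k (pt P (pos P x + t *\<^sub>R \<xi>))" by (simp add: p_def)
            then show ?case using pB[OF x] by simp
          qed
          ultimately show "((\<lambda>t. (p k (?y + t *\<^sub>R \<xi>) - p k ?y) / t) \<longlongrightarrow> metric_form P x (Q k x) \<xi>) (at 0)"
            unfolding L(2) by (rule Lim_transform_eventually)
        qed
      qed
    qed
    have d_eq: "d k y = m" if "((\<lambda>t. (p k (y + t *\<^sub>R \<xi>) - p k y) / t) \<longlongrightarrow> m) (at 0)" for k y m
    proof -
      have "filterlim (\<lambda>n. 1 / real (Suc n)) (at 0) sequentially"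
        using LIMSEQ_inverse_real_of_nat by (auto simp: filterlim_at inverse_eq_divide)
      from filterlim_compose[OF that this] show ?thesis unfolding d_def by (rule limI)
    qed
    have lim_p: "(\<lambda>k. \<integral>\<^sup>+z\<in>ball 0 \<delta>. ennreal ((p k z - F z)\<^sup>2) \<partial>\<mu>) \<longlonglongrightarrow> 0"
    proof (rule ennreal_tendsto_0_of_cmult_le[OF \<kappa>(1) _ lim_q])
      fix k
      have "ennreal \<kappa> * (\<integral>\<^sup>+z\<in>ball 0 \<delta>. ennreal ((p k z - F z)\<^sup>2) \<partial>\<mu>)
          \<le> (\<integral>\<^sup>+x\<in>B \<delta>. ennreal ((p k (pos P x - ?a) - F (pos P x - ?a))\<^sup>2) \<partial>vol P)"
        by (rule \<kappa>(2)) measurable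
      also have "\<dots> \<le> (\<integral>\<^sup>+x\<in>U. ennreal ((q k x - f x)\<^sup>2) \<partial>vol P)"
        using BU FB pB by (intro nn_integral_mono) (auto split: split_indicator)
      finally show "ennreal \<kappa> * (\<integral>\<^sup>+z\<in>ball 0 \<delta>. ennreal ((p k z - F z)\<^sup>2) \<partial>\<mu>)
          \<le> (\<integral>\<^sup>+x\<in>U. ennreal ((q k x - f x)\<^sup>2) \<partial>vol P)" .
    qed
    have lim_d: "(\<lambda>k. \<integral>\<^sup>+z\<in>ball 0 \<delta>. ennreal ((d k z)\<^sup>2) \<partial>\<mu>) \<longlonglongrightarrow> 0"
    proof (rule ennreal_tendsto_0_of_cmult_le[OF \<kappa>(1)])
      \<comment> \<open>The upper ellipticity bound for the form at \<xi>; with Cauchy-Schwarz it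
        bounds the squared directional derivative by the energy density.\<close>
      let ?C = "\<Lambda>\<^sup>2 * (norm \<xi>)\<^sup>2"
      show "(\<lambda>k. ennreal ?C * dirichlet_integral P U (Q k)) \<longlonglongrightarrow> 0"
        using ennreal_tendsto_cmult[OF _ lim_Q, of "ennreal ?C"] by simp
      fix k
      have "ennreal \<kappa> * (\<integral>\<^sup>+z\<in>ball 0 \<delta>. ennreal ((d k z)\<^sup>2) \<partial>\<mu>)
          \<le> (\<integral>\<^sup>+x\<in>B \<delta>. ennreal ((d k (pos P x - ?a))\<^sup>2) \<partial>vol P)"
        by (rule \<kappa>(2)) measurable
      also have "\<dots> \<le> (\<integral>\<^sup>+x. ennreal ?C * (ennreal (metric_form P x (Q k x) (Q k x)) * indicator U x) \<partial>vol P)"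
      proof (rule nn_integral_mono_AE)
        have "AE x in vol P. x \<in> U \<longrightarrow> Q k x \<in> tangent P (carrier_simplex P x)"
          using vQ by (simp add: vector_field_on_def)
        with deriv[of k] ell
        show "AE x in vol P. ennreal ((d k (pos P x - ?a))\<^sup>2) * indicator (B \<delta>) x
            \<le> ennreal ?C * (ennreal (metric_form P x (Q k x) (Q k x)) * indicator U x)"
        proof eventually_elim
          case (elim x)
          show ?case
          proof (cases "x \<in> B \<delta>")
            case True
            then have x: "x \<in> U" "carrier_simplex P x = s" using BU by (auto simp: B_def open_cell_def)
            have T: "Q k x \<in> tangent P (carrier_simplex P x)" "\<xi> \<in> tangent P (carrier_simplex P x)"
              using elim x \<xi> by auto
            have nn: "0 \<le> metric_form P x (Q k x) (Q k x)" by (rule elliptic_nonneg[OF elim(2) T(1)])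
            have "(d k (pos P x - ?a))\<^sup>2 = (metric_form P x (Q k x) \<xi>)\<^sup>2"
              using d_eq elim(1) True by simp
            also have "\<dots> \<le> metric_form P x (Q k x) (Q k x) * metric_form P x \<xi> \<xi>"
              by (rule metric_Cauchy_Schwarz[OF elim(2) \<Lambda> T])
            also have "\<dots> \<le> metric_form P x (Q k x) (Q k x) * ?C"
              using elim(2) T(2) nn by (intro mult_left_mono) (auto simp: elliptic_def)
            finally have "ennreal ((d k (pos P x - ?a))\<^sup>2) \<le> ennreal (?C * metric_form P x (Q k x) (Q k x))"
              by (simp add: ennreal_leI mult.commute)
            then show ?thesis using x True nn by (simp add: ennreal_mult)
          qed simp
        qed
      qed
      also have "\<dots> = ennreal ?C * dirichlet_integral P U (Q k)"
      proof -
        have "(\<lambda>x. ennreal (metric_form P x (Q k x) (Q k x) * indicator U x)) \<in> borel_measurable (vol P)"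
          using metric_form_vector_fields_measurable[OF vQ vQ Ub] by measurable
        moreover have "ennreal (metric_form P x (Q k x) (Q k x) * indicator U x)
            = ennreal (metric_form P x (Q k x) (Q k x)) * indicator U x" for x
          by (auto split: split_indicator)
        ultimately show ?thesis unfolding dirichlet_integral_def by (subst nn_integral_cmult) auto
      qed
      finally show "ennreal \<kappa> * (\<integral>\<^sup>+z\<in>ball 0 \<delta>. ennreal ((d k z)\<^sup>2) \<partial>\<mu>)
          \<le> ennreal ?C * dirichlet_integral P U (Q k)" .
    qed
    \<comment> \<open>The exceptional set is null for the volume. It is carried to the plane and
      then translated so that \<open>x0\<close> corresponds to the origin.\<close>
    have derivd: "AE y in \<mu>. y \<in> ball 0 \<delta> \<longrightarrow> ((\<lambda>t. (p k (y + t *\<^sub>R \<xi>) - p k y) / t) \<longlongrightarrow> d k y) (at 0)" for k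
    proof -
      let ?Q = "\<lambda>y. ((\<lambda>t. (p k (y + t *\<^sub>R \<xi>) - p k y) / t) \<longlongrightarrow> d k y) (at 0)"
      have "AE x in vol P. x \<in> B \<delta> \<longrightarrow> ?Q (pos P x - ?a)"
        using deriv[of k] by eventually_elim (use d_eq in auto)
      from AE_vol_imp_AE_plane[OF s this]
      have "AE y in distr \<mu> borel (\<lambda>y. ?a + y). y \<in> cell_image s \<longrightarrow> pt P y \<in> B \<delta> \<longrightarrow> ?Q (pos P (pt P y) - ?a)"
        unfolding plane_measure_at[OF pos_minus_base[OF x0]] .
      then have "AE y in \<mu>. ?a + y \<in> cell_image s \<longrightarrow> ?c y \<in> B \<delta> \<longrightarrow> ?Q (pos P (?c y) - ?a)"
        by (rule AE_distrD[rotated]) measurable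
      then show ?thesis
        using AE_flat_measure_span[OF frame_finite[of s]]
      proof eventually_elim
        case (elim y)
        show ?case
        proof
          assume "y \<in> ball 0 \<delta>"
          then have y: "y \<in> ?T" "norm y < \<delta>" "norm y < r" using elim(2) \<delta> \<rho> by (auto simp: span_frame)
          have "?Q (pos P (?c y) - ?a)" using elim(1) cell[OF y(1,3)] chart_B[OF y(1,2)] \<delta> \<rho> by simp
          then show "?Q y" using chart(2)[OF y(1,3)] by simp
        qed
      qed
    qed
    have "F (0 + \<xi>) = F 0"
    proof (rule constant_if_gradients_vanish[where q = p and d = d and C = C and R = \<delta>])
      show "continuous_on (span (frame P s) \<inter> cball 0 \<delta>) F" using contF by (simp add: S_def)
      show "(C k)-lipschitz_on (span (frame P s) \<inter> cball 0 \<delta>) (p k)" for k using lipp by (simp add: S_def)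
    qed (use \<delta> \<xi> derivd lim_p lim_d in \<open>auto simp: span_frame subspace_0[OF subspace_tangent]\<close>)
    then show ?thesis by simp
  qed
  have x0B: "x0 \<in> B (\<delta> / 2)" using x0 \<delta> by (simp add: B_def)
  have "\<forall>\<^sub>F y in nhds x0. y \<in> B (\<delta> / 2)"
    using openB x0B by (rule eventually_nhds_in_open)
  then show ?thesis
  proof eventually_elim
    case (elim y)
    have B: "y \<in> B \<delta>" "x0 \<in> B \<delta>" using elim x0B \<delta> by (auto simp: B_def)
    have "F (pos P y - ?a) = F 0" using elim tan by (intro F_const) (auto simp: B_def)
    then show ?case using FB[OF B(1)] FB[OF B(2)] by simp
  qed
qed

end

theorem proposition5p5:
  fixes X :: "('v, 'e::euclidean_space, 'x::metric_space) polyhedron_data"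
    and f :: "'x \<Rightarrow> real"
  assumes "riemannian_polyhedron X"
    and "admissible X"
    and "boundary X = {}"
    and "parabolic X UNIV"
    and "f \<in> W12_loc X"
    and "harmonic X f"
    and "grad_norm_sq X f < \<infinity>"
  shows "f constant_on UNIV"
proof -
  interpret riemannian_complex X by standard (rule assms(1))
  \<comment> \<open>An infimum below infinity provides at least one representative of the gradient
    with finite energy.\<close>
  obtain G where grad: "weak_gradient X f G" and fin: "dirichlet_integral X UNIV G < \<infinity>"
    using assms(7) unfolding grad_norm_sq_def INF_less_iff by auto
  have E: "dirichlet_integral X UNIV G \<le> ennreal (enn2real (dirichlet_integral X UNIV G))"
    using fin by simp
  have cont: "continuous_on UNIV f" and harm: "weakly_harmonic X f"
    using assms(6) by (auto simp: harmonic_def)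
  have "f \<in> borel_measurable (vol X)"
    by (intro borel_measurable_vol borel_measurable_continuous_onI cont)
  then have "AE x in vol X. x \<in> D \<longrightarrow> metric_form X x (G x) (G x) = 0" if "compact D" for D
    using gradient_vanishes[OF assms(4) harm grad E enn2real_nonneg that] by blast
  then show ?thesis
    by (intro constant_if_locally_constant_on_open_cells[OF cont] locally_constant_on_open_cell[OF _ _ cont grad])
qed

end
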